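(* Let $\chi$ be a good function and suppose that $a,b\in\mathbb{Z}$ are chosen so that $P_{a,b,\chi}\in\mathbb{Z}[[q]]$, that $a^2-b\not\equiv 3\pmod 4$, and that $a^2-b$ is not a square. Then there is a linear congruence for $H_{a,b,\chi}(n)$ modulo at least $50\%$ of primes; that is, the set of primes $p$ for which there exists an integer $B$ with $1\le B<p$ such that $H_{a,b,\chi}(pn-B)\equiv0\pmod p$ for all $n\in\mathbb{N}$ has (lower) natural density at least $\tfrac12$ in the set of all primes.
   Context: $\mathbb{N}$ denotes the positive integers. Good functions: for a modulus $M$, let $\psi_u(x)=1$ if $x\equiv u\pmod M$ and $\psi_u(x)=0$ otherwise ($x\in\mathbb{Z}$), and $\psi_{u,v}:=\psi_u-\psi_v$. A periodic function $\chi\colon\mathbb{Z}\to\{0,1,-1\}$ with period $M$ and mean value zero (i.e. $\sum_{j=0}^{M-1}\chi(j)=0$) is called good if it is a (finite) sum of functions of the form $\psi_{u,v}$ such that there exist natural numbers $C=C(u,v)$ with $\gcd(C,M)=1$ and $uC\equiv v\pmod M$. For $a,b\in\mathbb{Z}$ ($b\ne 0$) put $P_{a,b,\chi}(q):=\sum_{n\ge 0}n\chi(n)q^{\frac{n^2-a^2}{b}}$. Since $\chi$ has mean value zero and $P_{a,b,\chi}\in\mathbb{Z}[[q]]$, there is an asymptotic expansion $P_{a,b,\chi}(e^{-t})\sim\sum_{n\ge0}\alpha_{a,b,\chi}(n)t^n$ as $t\to0^+$. The coefficients $H_{a,b,\chi}(n)$, $n\geq 0$, are defined by re-expanding this in powers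 of $1-e^{-t}$: $$P_{a,b,\chi}(e^{-t})\sim\sum_{n\ge0}H_{a,b,\chi}(n)(1-e^{-t})^n\qquad(t\to0^+).$$ They are rational numbers, and a congruence $r\equiv0\pmod{p}$ for $r\in\mathbb{Q}$ means $r\in p\mathbb{Z}_{(p)}$. *)

theory Defs
  imports
    "HOL-Analysis.Analysis"
    "HOL-Library.Landau_Symbols"
    "HOL-Number_Theory.Number_Theory"
begin

definition psi :: "nat \<Rightarrow> int \<Rightarrow> int \<Rightarrow> int" where
  "psi M u x = (if [x = u] (mod int M) then 1 else 0)"

definition psi_diff :: "nat \<Rightarrow> int \<Rightarrow> int \<Rightarrow> int \<Rightarrow> int" where
  "psi_diff M u v x = psi M u x - psi M v x"

(* The modulus M is any positive period of chi, not necessarily the least one.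
   Using a list allows summands psi_diff M u v to be repeated. *)
definition good_function :: "nat \<Rightarrow> (int \<Rightarrow> int) \<Rightarrow> bool" where
  "good_function M chi \<longleftrightarrow>
     M > 0 \<and>
     range chi \<subseteq> {0, 1, -1} \<and>
     (\<forall>x. chi (x + int M) = chi x) \<and>
     (\<Sum>j<M. chi (int j)) = 0 \<and>
     (\<exists>uvs :: (int \<times> int) list.
        (\<forall>(u, v) \<in> set uvs. \<exists>C::nat. C > 0 \<and> coprime C M \<and> [u * int C = v] (mod int M)) \<and>
        (\<forall>x. chi x = (\<Sum>(u, v)\<leftarrow>uvs. psi_diff M u v x)))"

(* The coefficient of q^e, e rational, in the formal sum of the terms
   n chi(n) q^((n^2 - a^2)/b), n >= 0.  For b \<noteq> 0 at most one n contributes. *)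
definition P_coeff :: "int \<Rightarrow> int \<Rightarrow> (int \<Rightarrow> int) \<Rightarrow> rat \<Rightarrow> int" where
  "P_coeff a b chi e =
     (\<Sum>n | ((of_nat n)\<^sup>2 - (of_int a)\<^sup>2) / of_int b = e. int n * chi (int n))"

(* P lies in Z[[q]]: only exponents 0, 1, 2, ... occur (the coefficients are
   integers in any case). *)
definition P_in_int_power_series :: "int \<Rightarrow> int \<Rightarrow> (int \<Rightarrow> int) \<Rightarrow> bool" where
  "P_in_int_power_series a b chi \<longleftrightarrow> (\<forall>e. P_coeff a b chi e \<noteq> 0 \<longrightarrow> e \<in> \<nat>)"

definition P :: "int \<Rightarrow> int \<Rightarrow> (int \<Rightarrow> int) \<Rightarrow> real \<Rightarrow> real" where
  "P a b chi q =
     (\<Sum>n. real n * of_int (chi (int n)) * q powr (((real n)\<^sup>2 - (of_int a)\<^sup>2) / of_int b))"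

(* f(t) ~ sum_n c(n) g(t)^n as t -> 0+, in the sense of Poincare. *)
definition asymp_expansion :: "(real \<Rightarrow> real) \<Rightarrow> (real \<Rightarrow> real) \<Rightarrow> (nat \<Rightarrow> real) \<Rightarrow> bool" where
  "asymp_expansion f g c \<longleftrightarrow>
     (\<forall>N. (\<lambda>t. f t - (\<Sum>n<N. c n * g t ^ n)) \<in> O[at_right 0](\<lambda>t. g t ^ N))"

definition H :: "int \<Rightarrow> int \<Rightarrow> (int \<Rightarrow> int) \<Rightarrow> nat \<Rightarrow> real" where
  "H a b chi = (THE h. asymp_expansion (\<lambda>t. P a b chi (exp (- t))) (\<lambda>t. 1 - exp (- t)) h)"

lemma asymp_expansion_unique:
  assumes c: "asymp_expansion f g c" and d: "asymp_expansion f g d"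
    and g: "(g \<longlongrightarrow> 0) (at_right 0)" and nz: "eventually (\<lambda>t. g t \<noteq> 0) (at_right 0)"
  shows "c = d"
proof
  fix n
  show "c n = d n"
  proof (induction n rule: less_induct)
    case (less n)
    have eq: "(\<Sum>k<n. c k * g t ^ k) = (\<Sum>k<n. d k * g t ^ k)" for t
      using less by (intro sum.cong) auto
    have "(\<lambda>t. (f t - (\<Sum>k<Suc n. d k * g t ^ k)) - (f t - (\<Sum>k<Suc n. c k * g t ^ k)))
            \<in> O[at_right 0](\<lambda>t. g t ^ Suc n)"
      by (rule sum_in_bigo(2)[OF d[unfolded asymp_expansion_def, rule_format]
            c[unfolded asymp_expansion_def, rule_format]])
    also have "(\<lambda>t. (f t - (\<Sum>k<Suc n. d k * g t ^ k)) - (f t - (\<Sum>k<Suc n. c k * g t ^ k)))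
                 = (\<lambda>t. (c n - d n) * g t ^ n)"
      using eq by (simp add: algebra_simps)
    finally obtain K where
      "eventually (\<lambda>t. norm ((c n - d n) * g t ^ n) \<le> K * norm (g t ^ Suc n)) (at_right 0)"
      by (elim landau_o.bigE)
    with nz have ev: "eventually (\<lambda>t. \<bar>c n - d n\<bar> \<le> K * \<bar>g t\<bar>) (at_right 0)"
    proof eventually_elim
      case (elim t)
      have "\<bar>c n - d n\<bar> * \<bar>g t ^ n\<bar> \<le> (K * \<bar>g t\<bar>) * \<bar>g t ^ n\<bar>"
        using elim(2) by (simp add: abs_mult mult_ac)
      moreover have "\<bar>g t ^ n\<bar> > 0" using elim(1) by simp
      ultimately show ?case using mult_le_cancel_right_pos by blast
    qed
    have "((\<lambda>t. K * \<bar>g t\<bar>) \<longlongrightarrow> K * \<bar>0\<bar>) (at_right 0)"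
      by (intro tendsto_intros g)
    then have "\<bar>c n - d n\<bar> \<le> K * \<bar>0\<bar>"
      by (rule tendsto_lowerbound) (use ev in auto)
    then show ?case by simp
  qed
qed

lemma H_eqI:
  assumes "asymp_expansion (\<lambda>t. P a b chi (exp (- t))) (\<lambda>t. 1 - exp (- t)) h"
  shows "H a b chi = h"
  unfolding H_def
proof (rule the_equality)
  fix h' assume h': "asymp_expansion (\<lambda>t. P a b chi (exp (- t))) (\<lambda>t. 1 - exp (- t)) h'"
  have "((\<lambda>t::real. 1 - exp (- t)) \<longlongrightarrow> 1 - exp (- 0)) (at_right 0)"
    by (intro tendsto_intros)
  moreover have "eventually (\<lambda>t::real. 1 - exp (- t) \<noteq> 0) (at_right 0)"
    using eventually_at_right_less[of 0] by eventually_elim auto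
  ultimately show "h' = h"
    using asymp_expansion_unique[OF h' assms] by simp
qed fact

(* r lies in p Z_(p); in particular r is rational. *)
definition cong_zero_mod :: "nat \<Rightarrow> real \<Rightarrow> bool" where
  "cong_zero_mod p r \<longleftrightarrow>
     (\<exists>x y :: int. \<not> int p dvd y \<and> r = of_nat p * (of_int x / of_int y))"

definition linear_congruence :: "(nat \<Rightarrow> real) \<Rightarrow> nat \<Rightarrow> bool" where
  "linear_congruence h p \<longleftrightarrow>
     (\<exists>B. 1 \<le> B \<and> B < p \<and> (\<forall>n\<ge>1. cong_zero_mod p (h (p * n - B))))"

definition prime_lower_density :: "nat set \<Rightarrow> ereal" where
  "prime_lower_density S =
     liminf (\<lambda>N. ereal (real (card {p \<in> S. prime p \<and> p \<le> N}) / real (card {p. prime p \<and> p \<le> N})))"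

end

theory Submission
  imports
    Defs
    "HOL-Complex_Analysis.Complex_Analysis"
    "HOL-Computational_Algebra.Polynomial"
    "HOL-Computational_Algebra.Squarefree"
    "HOL-Real_Asymp.Real_Asymp"
begin

text \<open>
  Write \<open>D = a\<^sup>2 - b\<close>. The theorem rests on two facts: every prime \<open>p\<close>, outside a finite set, for
  which \<open>D\<close> is a quadratic non-residue has a linear congruence with \<open>B = 1\<close>; and these primes are
  one half of all primes, because \<open>D\<close> is not a square.

  For the congruence, put \<open>y(x) = (x\<^sup>2 - a\<^sup>2) / b\<close> and expand each summand \<open>n chi(n) q^y(n)\<close> in powers
  of \<open>1 - q\<close> by the binomial series. Formally the coefficient of \<open>(1 - q)^N\<close> in the whole sum is
  \<open>(-1)^N\<close> times the divergent series \<open>\<Sum>n. chi(n) f(n)\<close> with \<open>f(x) = x * (y(x) gchoose N)\<close>. Since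
  \<open>chi\<close> is periodic with mean value zero, it has a periodic antiderivative of mean value zero, and
  so has that one in turn; repeated summation by parts moves differences onto \<open>f\<close> and, as \<open>f\<close> is a
  polynomial, ends after finitely many steps. The regularised value of the series is therefore a
  finite combination of the differences of \<open>f\<close> at \<open>0\<close>, whose coefficients have only powers of the
  period in the denominator. The same summation by parts, applied to the smooth function
  \<open>x exp (- t y(x))\<close>, shows that these numbers are indeed the coefficients of the asymptotic
  expansion: after \<open>r\<close> steps the remaining sum contains the \<open>r\<close>-th derivative of a Gaussian
  function at scale \<open>sqrt t\<close>, which is small (\<open>theta_expansion\<close>, \<open>H_eq_reg_coeff\<close>).

  Hence \<open>H\<close> at \<open>N\<close> is divisible by \<open>p\<close> as soon as all values \<open>y(x) gchoose N\<close> at integers \<open>x\<close> are.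
  For \<open>N = p n - 1\<close> the absorption identity
  \<open>p n * ((y + 1) gchoose (p n)) = (y + 1) * (y gchoose (p n - 1))\<close> gives this whenever \<open>y + 1\<close> is a
  unit at \<open>p\<close>, and \<open>y(x) + 1 = (x\<^sup>2 - D) / b\<close> is a unit for every \<open>x\<close> exactly when \<open>D\<close> is a
  non-residue (\<open>linear_congruence_nonresidue\<close>).

  For the density, quadratic reciprocity turns \<open>p \<mapsto> Legendre D p\<close> into the restriction to primes of
  a completely multiplicative periodic function \<open>f\<close>, and the Chinese remainder theorem shows that
  \<open>f\<close> has mean value zero when \<open>D\<close> is not a square (\<open>quadratic_character_exists\<close>). What remains is
  the prime number theorem with the weights \<open>1\<close> and \<open>f\<close>. The functions \<open>zeta\<close> and \<open>L\<close> continue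
  beyond the line \<open>Re s = 1\<close> and have no zeros on it, by the inequality
  \<open>3 + 4 cos \<theta> + cos (2 \<theta>) \<ge> 0\<close> and, for \<open>L(1)\<close>, by Monsky's argument with Lambert series. Newman's
  contour argument then yields a Tauberian theorem (\<open>tauberian\<close>), which applies to the coefficients
  \<open>\<Lambda>(n)\<close> and \<open>(1 + f(n)) \<Lambda>(n)\<close>; the difference of the two results is \<open>PNT_character\<close>.
\<close>

section \<open>Finite differences\<close>

definition fdiff :: "(real \<Rightarrow> real) \<Rightarrow> real \<Rightarrow> real" where "fdiff g x = g (x + 1) - g x"

lemma fdiff_pow_Suc: "(fdiff ^^ Suc r) g = (fdiff ^^ r) (fdiff g)"
  by (simp only: funpow_Suc_right o_apply)

text \<open>
  An iterated difference is an average of the iterated derivative. By the mean value theorem each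
  difference replaces one derivative and moves the argument to the right, where the bound \<open>W\<close> is
  smaller.
\<close>
lemma fdiff_pow_bound:
  fixes F :: "nat \<Rightarrow> real \<Rightarrow> real"
  assumes D: "\<And>i x. (F i has_real_derivative F (Suc i) x) (at x)"
    and W: "\<And>x. x \<ge> 0 \<Longrightarrow> \<bar>F r x\<bar> \<le> W x" and dec: "\<And>x y. 0 \<le> x \<Longrightarrow> x \<le> y \<Longrightarrow> W y \<le> W x" and x: "x \<ge> 0"
  shows "\<bar>(fdiff ^^ r) (F 0) x\<bar> \<le> W x"
  using D W x
proof (induction r arbitrary: F x)
  case 0
  thus ?case by simp
next
  case (Suc r)
  have "\<bar>(fdiff ^^ r) (fdiff (F 0)) x\<bar> \<le> W x"
  proof (rule Suc.IH[of "\<lambda>i. fdiff (F i)"])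
    show "(fdiff (F i) has_real_derivative fdiff (F (Suc i)) y) (at y)" for i y
    proof -
      have "((\<lambda>x. F i (x + 1)) has_real_derivative F (Suc i) (y + 1)) (at y)"
        using Suc.prems(1)[of i "y + 1"] by (subst (asm) DERIV_shift)
      from DERIV_diff[OF this Suc.prems(1)[of i y]] show ?thesis unfolding fdiff_def[abs_def] .
    qed
    fix y :: real assume y: "y \<ge> 0"
    obtain z where z: "y < z" "z < y + 1" "F r (y + 1) - F r y = (y + 1 - y) * F (Suc r) z"
      using MVT2[of y "y + 1" "F r" "F (Suc r)"] Suc.prems(1) by force
    have "\<bar>fdiff (F r) y\<bar> = \<bar>F (Suc r) z\<bar>" using z by (simp add: fdiff_def)
    also have "\<dots> \<le> W z" using z y by (intro Suc.prems(2)) auto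
    also have "\<dots> \<le> W y" using z y by (intro dec) auto
    finally show "\<bar>fdiff (F r) y\<bar> \<le> W y" .
  qed (use Suc.prems in auto)
  thus ?case by (simp only: fdiff_pow_Suc)
qed

lemma fdiff_poly: "fdiff (poly p) = poly (pcompose p [:1, 1:] - p)"
  by (rule ext) (simp add: fdiff_def poly_pcompose add.commute)

text \<open>
  A shift keeps the leading coefficient, so differencing lowers the degree.
\<close>
lemma degree_shift_diff:
  fixes p :: "real poly"
  shows "pcompose p [:1, 1:] - p = 0 \<or> Polynomial.degree (pcompose p [:1, 1:] - p) < Polynomial.degree p"
proof (rule eq_zero_or_degree_less)
  have d: "Polynomial.degree (pcompose p [:1, 1:]) = Polynomial.degree p" by (simp add: degree_pcompose)
  thus "Polynomial.degree (pcompose p [:1, 1:] - p) \<le> Polynomial.degree p" by (intro degree_diff_le) auto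
  have "lead_coeff (pcompose p [:1, 1:]) = lead_coeff p" by (subst lead_coeff_comp) auto
  thus "Polynomial.coeff (pcompose p [:1, 1:] - p) (Polynomial.degree p) = 0" using d by simp
qed

lemma fdiff_pow_0: "(fdiff ^^ i) (\<lambda>_. 0) = (\<lambda>_. 0)"
  by (induction i) (auto simp: fdiff_def)

lemma fdiff_pow_poly_eq_0:
  fixes p :: "real poly"
  assumes "Polynomial.degree p < i" shows "(fdiff ^^ i) (poly p) = (\<lambda>_. 0)"
  using assms
proof (induction i arbitrary: p)
  case (Suc i)
  let ?q = "pcompose p [:1, 1:] - p"
  show ?case
  proof (cases "?q = 0")
    case True
    have "poly 0 = (\<lambda>_. 0 :: real)" by (rule ext) simp
    thus ?thesis by (simp only: fdiff_pow_Suc fdiff_poly True fdiff_pow_0)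
  next
    case False
    hence "Polynomial.degree ?q < i" using degree_shift_diff[of p] Suc.prems by auto
    thus ?thesis by (simp only: fdiff_pow_Suc fdiff_poly Suc.IH)
  qed
qed simp

lemma fdiff_pow_add: "(fdiff ^^ i) (\<lambda>x. f x + g x) y = (fdiff ^^ i) f y + (fdiff ^^ i) g y"
  by (induction i arbitrary: y) (auto simp: fdiff_def)

lemma fdiff_pow_cmult: "(fdiff ^^ i) (\<lambda>x. c * f x) y = c * (fdiff ^^ i) f y"
  by (induction i arbitrary: y) (auto simp: fdiff_def algebra_simps)

lemma fdiff_pow_sum: "(fdiff ^^ i) (\<lambda>x. \<Sum>k\<in>A. f k x) y = (\<Sum>k\<in>A. (fdiff ^^ i) (f k) y)"
  by (induction i arbitrary: y) (auto simp: fdiff_def sum_subtractf)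

section \<open>Summation by parts against periodic functions of mean value zero\<close>

text \<open>
  The constant that has to be subtracted from the partial sums of \<open>\<phi>\<close> to give an antiderivative of
  mean value zero.
\<close>
definition mean_partial :: "nat \<Rightarrow> (nat \<Rightarrow> real) \<Rightarrow> real" where
  "mean_partial M \<phi> = (\<Sum>j<M. \<Sum>k<j. \<phi> k) / real M"
text \<open>
  Minus the antiderivative of \<open>\<phi>\<close> of mean value zero, at the argument \<open>n + 1\<close>. The shift and the
  sign are those with which it appears after one summation by parts.
\<close>
definition abel_step :: "nat \<Rightarrow> (nat \<Rightarrow> real) \<Rightarrow> nat \<Rightarrow> real" where
  "abel_step M \<phi> n = mean_partial M \<phi> - (\<Sum>k<Suc n. \<phi> k)"
definition mean_zero_periodic :: "nat \<Rightarrow> (nat \<Rightarrow> real) \<Rightarrow> bool" where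
  "mean_zero_periodic M \<phi> \<longleftrightarrow> M > 0 \<and> (\<forall>n. \<phi> (n + M) = \<phi> n) \<and> (\<Sum>j<M. \<phi> j) = 0"

lemma partial_sum_periodic:
  assumes "mean_zero_periodic M \<phi>" shows "(\<Sum>k<n + M. \<phi> k) = (\<Sum>k<n. \<phi> k)"
  using assms by (induction n) (auto simp: mean_zero_periodic_def)

text \<open>
  Summation by parts can be repeated because the mean value zero of \<open>\<phi>\<close> makes the antiderivative
  periodic, and the choice of the constant makes its mean value zero again.
\<close>
lemma mean_zero_periodic_abel_step:
  assumes "mean_zero_periodic M \<phi>" shows "mean_zero_periodic M (abel_step M \<phi>)"
proof -
  have M: "M > 0" using assms by (simp add: mean_zero_periodic_def)
  have "abel_step M \<phi> (n + M) = abel_step M \<phi> n" for n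
    using partial_sum_periodic[OF assms, of "Suc n"] by (simp add: abel_step_def)
  moreover have "(\<Sum>j<M. abel_step M \<phi> j) = 0"
  proof -
    have "(\<Sum>j<M. \<Sum>k<Suc j. \<phi> k) = (\<Sum>j<M. \<Sum>k<j. \<phi> k) + (\<Sum>j<M. \<phi> j)"
      by (simp add: sum.distrib)
    also have "(\<Sum>j<M. \<phi> j) = 0" using assms by (simp add: mean_zero_periodic_def)
    finally have "(\<Sum>j<M. \<Sum>k<Suc j. \<phi> k) = (\<Sum>j<M. \<Sum>k<j. \<phi> k)" by simp
    thus ?thesis using M by (simp add: abel_step_def sum_subtractf mean_partial_def del: sum.lessThan_Suc)
  qed
  ultimately show ?thesis using M by (simp add: mean_zero_periodic_def)
qed

lemma mean_zero_periodic_pow: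
  "mean_zero_periodic M \<phi> \<Longrightarrow> mean_zero_periodic M ((abel_step M ^^ i) \<phi>)"
  by (induction i) (auto intro: mean_zero_periodic_abel_step)

lemma mean_zero_periodic_bounded:
  assumes "mean_zero_periodic M \<phi>"
  obtains B where "B \<ge> 0" "\<And>n. \<bar>\<phi> n\<bar> \<le> B"
proof -
  have M: "M > 0" and per: "\<And>n. \<phi> (n + M) = \<phi> n" using assms by (auto simp: mean_zero_periodic_def)
  have pk: "\<phi> (n + k * M) = \<phi> n" for n k
    by (induction k) (auto simp: per add.assoc[symmetric] add.commute[of M])
  have "\<bar>\<phi> n\<bar> \<le> (\<Sum>j<M. \<bar>\<phi> j\<bar>)" for n
  proof -
    have "\<phi> n = \<phi> (n mod M)" using pk[of "n mod M" "n div M"] by simp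
    moreover have "\<bar>\<phi> (n mod M)\<bar> \<le> (\<Sum>j<M. \<bar>\<phi> j\<bar>)" using M by (intro member_le_sum) auto
    ultimately show ?thesis by simp
  qed
  thus ?thesis by (intro that[of "\<Sum>j<M. \<bar>\<phi> j\<bar>"]) (auto intro: sum_nonneg)
qed

lemma abel_by_parts:
  "(\<Sum>n<N. \<phi> n * g (real n)) = mean_partial M \<phi> * g 0 + (\<Sum>n<N. abel_step M \<phi> n * fdiff g (real n))
     + ((\<Sum>k<N. \<phi> k) - mean_partial M \<phi>) * g (real N)"
  by (induction N) (simp_all add: abel_step_def fdiff_def algebra_simps)

text \<open>
  The boundary term at infinity disappears since \<open>g\<close> tends to \<open>0\<close> and the antiderivative is bounded.
\<close>
lemma abel_sums:
  assumes \<phi>: "mean_zero_periodic M \<phi>" and g: "summable (\<lambda>n. \<bar>g (real n)\<bar>)" and dg: "summable (\<lambda>n. \<bar>fdiff g (real n)\<bar>)"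
  shows "summable (\<lambda>n. \<phi> n * g (real n))"
    "(\<Sum>n. \<phi> n * g (real n)) = mean_partial M \<phi> * g 0 + (\<Sum>n. abel_step M \<phi> n * fdiff g (real n))"
proof -
  have sm: "summable (\<lambda>n. \<psi> n * h n)" if \<psi>: "mean_zero_periodic M \<psi>" and h: "summable (\<lambda>n. \<bar>h n\<bar>)" for \<psi> h :: "nat \<Rightarrow> real"
  proof -
    obtain B where B: "B \<ge> 0" "\<And>n. \<bar>\<psi> n\<bar> \<le> B" using mean_zero_periodic_bounded[OF \<psi>] by auto
    show ?thesis
      by (rule summable_comparison_test'[of "\<lambda>n. B * \<bar>h n\<bar>" 0])
         (use B h in \<open>auto intro!: summable_mult mult_right_mono simp: abs_mult\<close>)
  qed
  note step = mean_zero_periodic_abel_step[OF \<phi>]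
  show s1: "summable (\<lambda>n. \<phi> n * g (real n))" by (rule sm[OF \<phi> g])
  have s2: "summable (\<lambda>n. abel_step M \<phi> n * fdiff g (real n))" by (rule sm[OF step dg])
  obtain B where B: "B \<ge> 0" "\<And>n. \<bar>abel_step M \<phi> n\<bar> \<le> B" using mean_zero_periodic_bounded[OF step] by auto
  have "(\<lambda>N. ((\<Sum>k<Suc N. \<phi> k) - mean_partial M \<phi>) * g (real (Suc N))) \<longlonglongrightarrow> 0"
  proof (rule Lim_null_comparison)
    have "\<bar>(\<Sum>k<Suc N. \<phi> k) - mean_partial M \<phi>\<bar> \<le> B" for N
      using B(2)[of N] unfolding abel_step_def by linarith
    thus "\<forall>\<^sub>F N in sequentially. norm (((\<Sum>k<Suc N. \<phi> k) - mean_partial M \<phi>) * g (real (Suc N))) \<le> B * \<bar>g (real (Suc N))\<bar>"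
      by (intro always_eventually allI) (simp only: real_norm_def abs_mult, intro mult_right_mono, auto)
    have "(\<lambda>N. \<bar>g (real N)\<bar>) \<longlonglongrightarrow> 0" by (rule summable_LIMSEQ_zero[OF g])
    hence "(\<lambda>N. B * \<bar>g (real (Suc N))\<bar>) \<longlonglongrightarrow> B * 0" by (intro tendsto_intros) (rule LIMSEQ_Suc)
    thus "(\<lambda>N. B * \<bar>g (real (Suc N))\<bar>) \<longlonglongrightarrow> 0" by simp
  qed
  hence lim0: "(\<lambda>N. ((\<Sum>k<N. \<phi> k) - mean_partial M \<phi>) * g (real N)) \<longlonglongrightarrow> 0" by (rule LIMSEQ_imp_Suc)
  have "(\<lambda>N. \<Sum>n<N. abel_step M \<phi> n * fdiff g (real n)) \<longlonglongrightarrow> (\<Sum>n. abel_step M \<phi> n * fdiff g (real n))"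
    using s2 by (rule summable_LIMSEQ)
  hence "(\<lambda>N. mean_partial M \<phi> * g 0 + (\<Sum>n<N. abel_step M \<phi> n * fdiff g (real n))
     + ((\<Sum>k<N. \<phi> k) - mean_partial M \<phi>) * g (real N)) \<longlonglongrightarrow> mean_partial M \<phi> * g 0 + (\<Sum>n. abel_step M \<phi> n * fdiff g (real n)) + 0"
    by (intro tendsto_add tendsto_const lim0)
  hence "(\<lambda>N. \<Sum>n<N. \<phi> n * g (real n)) \<longlonglongrightarrow> mean_partial M \<phi> * g 0 + (\<Sum>n. abel_step M \<phi> n * fdiff g (real n))"
    by (simp only: abel_by_parts[symmetric] add_0_right)
  thus "(\<Sum>n. \<phi> n * g (real n)) = mean_partial M \<phi> * g 0 + (\<Sum>n. abel_step M \<phi> n * fdiff g (real n))"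
    using summable_LIMSEQ[OF s1] LIMSEQ_unique by blast
qed

text \<open>
  For a polynomial \<open>g\<close> and a periodic \<open>\<phi>\<close> of mean value zero the finite sum \<open>\<Sum>i. abel_coeff M \<phi> i * (fdiff ^^ i) g 0\<close> is the value that Abel
  summation assigns to the divergent series \<open>\<Sum>n. \<phi> n * g n\<close>.
\<close>
definition abel_coeff :: "nat \<Rightarrow> (nat \<Rightarrow> real) \<Rightarrow> nat \<Rightarrow> real" where
  "abel_coeff M \<phi> i = mean_partial M ((abel_step M ^^ i) \<phi>)"

lemma abel_iterate:
  assumes \<phi>: "mean_zero_periodic M \<phi>" and g: "\<And>i. summable (\<lambda>n. \<bar>(fdiff ^^ i) g (real n)\<bar>)"
  shows "(\<Sum>n. \<phi> n * g (real n)) = (\<Sum>i<r. abel_coeff M \<phi> i * (fdiff ^^ i) g 0)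
     + (\<Sum>n. (abel_step M ^^ r) \<phi> n * (fdiff ^^ r) g (real n))"
proof (induction r)
  case (Suc r)
  have "(\<Sum>n. (abel_step M ^^ r) \<phi> n * (fdiff ^^ r) g (real n))
      = abel_coeff M \<phi> r * (fdiff ^^ r) g 0 + (\<Sum>n. (abel_step M ^^ Suc r) \<phi> n * (fdiff ^^ Suc r) g (real n))"
    using abel_sums(2)[OF mean_zero_periodic_pow[OF \<phi>] g, of r r] g[of "Suc r"] by (simp add: abel_coeff_def)
  thus ?case using Suc by simp
qed simp

section \<open>Differences of Gaussian functions\<close>

definition gaussian :: "real \<Rightarrow> real \<Rightarrow> real poly \<Rightarrow> real \<Rightarrow> real" where
  "gaussian c s p x = poly p (s * x) * exp (- c * (s * x)\<^sup>2)"
text \<open>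
  The derivative of \<open>p(u) exp (- c u\<^sup>2)\<close> is again a polynomial times \<open>exp (- c u\<^sup>2)\<close>; this is the
  new polynomial.
\<close>
definition gaussian_deriv :: "real \<Rightarrow> real poly \<Rightarrow> real poly" where
  "gaussian_deriv c p = pderiv p - Polynomial.smult (2 * c) (pCons 0 p)"

lemma DERIV_gaussian:
  "(gaussian c s p has_real_derivative s * gaussian c s (gaussian_deriv c p) x) (at x)"
proof -
  have "((\<lambda>x. poly p (s * x) * exp (- c * (s * x)\<^sup>2)) has_real_derivative
     (poly (pderiv p) (s * x) * s) * exp (- c * (s * x)\<^sup>2) + exp (- c * (s * x)\<^sup>2) * (- c * (2 * (s * x) * s)) * poly p (s * x)) (at x)"
    by (rule DERIV_mult) (auto intro!: derivative_eq_intros DERIV_chain2[OF poly_DERIV] simp: power2_eq_square)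
  thus ?thesis unfolding gaussian_def[abs_def] gaussian_deriv_def by (simp add: algebra_simps)
qed

text \<open>
  The Taylor series of \<open>exp (c v)\<close> contains \<open>(c v)^k / k!\<close>, so that \<open>v^k exp (- c v) \<le> k! / c^k\<close>;
  odd powers of \<open>u\<close> lie below one plus an even power.
\<close>
lemma poly_times_gaussian_bounded:
  assumes c: "c > 0"
  obtains B where "B \<ge> 0" "\<And>u::real. \<bar>poly p u * exp (- c * u\<^sup>2)\<bar> \<le> B"
proof -
  have mono: "\<bar>u ^ k * exp (- c * u\<^sup>2)\<bar> \<le> 1 + fact k / c ^ k" for u :: real and k
  proof -
    have gen: "v ^ k * exp (- c * v) \<le> fact k / c ^ k" if v: "v \<ge> 0" for v
    proof -
      have "(\<Sum>i\<in>{k}. (c * v) ^ i /\<^sub>R fact i) \<le> (\<Sum>i. (c * v) ^ i /\<^sub>R fact i)"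
        using c v by (intro sum_le_suminf summable_exp_generic) auto
      hence "(c * v) ^ k / fact k \<le> exp (c * v)" by (simp add: exp_def divide_inverse mult.commute)
      hence "(c * v) ^ k / fact k / exp (c * v) * (fact k / c ^ k) \<le> 1 * (fact k / c ^ k)"
        using c by (intro mult_right_mono) (auto simp: divide_simps mult.commute)
      moreover have "v ^ k * exp (- c * v) = (c * v) ^ k / fact k / exp (c * v) * (fact k / c ^ k)"
        using c by (simp add: power_mult_distrib exp_minus field_simps)
      ultimately show ?thesis by simp
    qed
    have a: "u ^ (2 * k) * exp (- c * u\<^sup>2) \<le> fact k / c ^ k"
      using gen[of "u\<^sup>2"] by (simp add: power_mult)
    have "\<bar>u\<bar> ^ k \<le> 1 + (\<bar>u\<bar> ^ k)\<^sup>2"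
      using zero_le_power2[of "\<bar>u\<bar> ^ k - 1"] by (simp add: power2_diff) (smt (verit) zero_le_power2)
    also have "(\<bar>u\<bar> ^ k)\<^sup>2 = u ^ (2 * k)" by (simp add: power_mult[symmetric] mult.commute power_even_abs)
    finally have "\<bar>u\<bar> ^ k * exp (- c * u\<^sup>2) \<le> (1 + u ^ (2 * k)) * exp (- c * u\<^sup>2)" by (intro mult_right_mono) auto
    also have "\<dots> = exp (- c * u\<^sup>2) + u ^ (2 * k) * exp (- c * u\<^sup>2)" by (simp add: algebra_simps)
    also have "\<dots> \<le> 1 + fact k / c ^ k" using a c by (intro add_mono) auto
    finally show ?thesis by (simp add: abs_mult power_abs)
  qed
  have "\<bar>poly p u * exp (- c * u\<^sup>2)\<bar> \<le> (\<Sum>i\<le>Polynomial.degree p. \<bar>Polynomial.coeff p i\<bar> * (1 + fact i / c ^ i))" for u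
  proof -
    have "\<bar>poly p u * exp (- c * u\<^sup>2)\<bar> = \<bar>\<Sum>i\<le>Polynomial.degree p. Polynomial.coeff p i * (u ^ i * exp (- c * u\<^sup>2))\<bar>"
      by (simp add: poly_altdef sum_distrib_right mult.assoc)
    also have "\<dots> \<le> (\<Sum>i\<le>Polynomial.degree p. \<bar>Polynomial.coeff p i\<bar> * (1 + fact i / c ^ i))"
    proof (rule order_trans[OF sum_abs sum_mono])
      fix i show "\<bar>Polynomial.coeff p i * (u ^ i * exp (- c * u\<^sup>2))\<bar> \<le> \<bar>Polynomial.coeff p i\<bar> * (1 + fact i / c ^ i)"
        unfolding abs_mult[of "Polynomial.coeff p i"] by (intro mult_left_mono mono) auto
    qed
    finally show ?thesis .
  qed
  moreover have "(\<Sum>i\<le>Polynomial.degree p. \<bar>Polynomial.coeff p i\<bar> * (1 + fact i / c ^ i)) \<ge> 0" using c by (intro sum_nonneg) auto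
  ultimately show ?thesis using that by blast
qed

text \<open>
  Each derivative of a function of \<open>s x\<close> gives a factor \<open>s\<close>. The other factor, a function of \<open>s x\<close>
  that decays like \<open>1 / (1 + (s x)\<^sup>2)\<close>, has a sum over \<open>n\<close> that grows at most like \<open>1 / s\<^sup>2\<close> for small
  \<open>s\<close>; the bound is in a form in which it can be summed over \<open>n\<close> uniformly in \<open>s\<close>.
\<close>
lemma fdiff_pow_gaussian_bound:
  assumes c: "c > 0"
  obtains B where "B \<ge> 0" "\<And>s n. 0 < s \<Longrightarrow> s \<le> 1 \<Longrightarrow> s\<^sup>2 * \<bar>(fdiff ^^ r) (gaussian c s p) (real n)\<bar> \<le> s ^ r * (B / real ((Suc n)\<^sup>2))"
proof -
  define q where "q = (gaussian_deriv c ^^ r) p"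
  obtain B where B: "B \<ge> 0" "\<And>u::real. \<bar>poly ([:1, 0, 1:] * q) u * exp (- c * u\<^sup>2)\<bar> \<le> B"
    using poly_times_gaussian_bounded[OF c] by blast
  have qb: "\<bar>poly q u * exp (- c * u\<^sup>2)\<bar> \<le> B / (1 + u\<^sup>2)" for u
  proof -
    have "1 + u * u > 0" by (rule add_pos_nonneg) auto
    thus ?thesis using B(2)[of u] by (simp add: abs_mult power2_eq_square field_simps)
  qed
  show ?thesis
  proof (rule that[of "2 * B"])
    show "2 * B \<ge> 0" using B by simp
    fix s :: real and n :: nat assume s: "0 < s" "s \<le> 1"
    define F where "F = (\<lambda>i x. s ^ i * gaussian c s ((gaussian_deriv c ^^ i) p) x)"
    define W where "W = (\<lambda>x. s ^ r * (B / (1 + (s * x)\<^sup>2)))"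
    have "\<bar>(fdiff ^^ r) (F 0) (real n)\<bar> \<le> W (real n)"
    proof (rule fdiff_pow_bound)
      show "(F i has_real_derivative F (Suc i) x) (at x)" for i x
        unfolding F_def using DERIV_cmult[OF DERIV_gaussian, of "s ^ i"] by (simp add: mult_ac)
      show "\<bar>F r x\<bar> \<le> W x" for x
        unfolding F_def W_def gaussian_def q_def[symmetric] abs_mult[of "s ^ r"] using s qb[of "s * x"] by (intro mult_mono) auto
      show "W y \<le> W x" if "0 \<le> x" "x \<le> y" for x y
      proof -
        have "(s * x)\<^sup>2 \<le> (s * y)\<^sup>2" using that s by (intro power_mono mult_left_mono) auto
        moreover have "1 + (s * x)\<^sup>2 > 0" by (rule add_pos_nonneg) auto
        ultimately show ?thesis unfolding W_def using s B by (intro mult_left_mono divide_left_mono mult_pos_pos) auto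
      qed
    qed auto
    hence *: "\<bar>(fdiff ^^ r) (gaussian c s p) (real n)\<bar> \<le> s ^ r * (B / (1 + (s * real n)\<^sup>2))" by (simp add: F_def W_def)
    have "s\<^sup>2 * \<bar>(fdiff ^^ r) (gaussian c s p) (real n)\<bar> \<le> s\<^sup>2 * (s ^ r * (B / (1 + (s * real n)\<^sup>2)))"
      using * by (intro mult_left_mono) auto
    also have "\<dots> = s ^ r * (B * (s\<^sup>2 / (1 + (s * real n)\<^sup>2)))" by (simp add: mult_ac)
    also have "s\<^sup>2 / (1 + (s * real n)\<^sup>2) \<le> 2 / real ((Suc n)\<^sup>2)"
    proof -
      have p: "1 + (s * real n)\<^sup>2 > 0" by (rule add_pos_nonneg) auto
      have "s\<^sup>2 \<le> 1" using s by (simp add: power_le_one)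
      have "s\<^sup>2 * real ((Suc n)\<^sup>2) \<le> s\<^sup>2 * (2 + 2 * (real n)\<^sup>2)"
        using zero_le_power2[of "real n - 1"] by (intro mult_left_mono) (auto simp: power2_eq_square algebra_simps)
      also have "\<dots> \<le> 2 * (1 + (s * real n)\<^sup>2)" using \<open>s\<^sup>2 \<le> 1\<close> by (simp add: power_mult_distrib algebra_simps)
      finally show ?thesis using p by (subst frac_le_eq) (auto simp: divide_le_0_iff field_simps simp del: of_nat_power)
    qed
    hence "s ^ r * (B * (s\<^sup>2 / (1 + (s * real n)\<^sup>2))) \<le> s ^ r * (B * (2 / real ((Suc n)\<^sup>2)))" using s B by (intro mult_left_mono) auto
    finally show "s\<^sup>2 * \<bar>(fdiff ^^ r) (gaussian c s p) (real n)\<bar> \<le> s ^ r * (2 * B / real ((Suc n)\<^sup>2))" by (simp add: mult_ac)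
  qed
qed

section \<open>The asymptotic expansion of the partial theta function\<close>

definition binom_term :: "real \<Rightarrow> real \<Rightarrow> nat \<Rightarrow> real \<Rightarrow> real" where
  "binom_term a b N x = x * (((x\<^sup>2 - a\<^sup>2) / b) gchoose N)"

lemma gbinomial_Suc_eq: "(y::real) gchoose Suc N = (y gchoose N) * (y - real N) / real (Suc N)"
  using gbinomial_mult_1[of y N] by (simp add: field_simps)

text \<open>
  The degree bound says after how many summations by parts the regularised sum over \<open>binom_term\<close>
  has no further terms.
\<close>
lemma binom_term_poly: "\<exists>p. Polynomial.degree p \<le> 2 * N + 1 \<and> binom_term a b N = poly p"
proof (induction N)
  case 0
  have "binom_term a b 0 = poly [:0, 1:]" by (rule ext) (simp add: binom_term_def)
  thus ?case by (intro exI[of _ "[:0, 1:]"]) simp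
next
  case (Suc N)
  then obtain p where p: "Polynomial.degree p \<le> 2 * N + 1" "binom_term a b N = poly p" by blast
  let ?q = "p * [:(- a\<^sup>2 / b - real N) / real (Suc N), 0, 1 / (b * real (Suc N)):]"
  have "binom_term a b (Suc N) x = poly ?q x" for x
  proof -
    have "binom_term a b (Suc N) x = binom_term a b N x * (((x\<^sup>2 - a\<^sup>2) / b - real N) / real (Suc N))"
      unfolding binom_term_def gbinomial_Suc_eq by simp
    also have "((x\<^sup>2 - a\<^sup>2) / b - real N) / real (Suc N)
        = (- a\<^sup>2 / b - real N) / real (Suc N) + x * (x * (1 / (b * real (Suc N))))"
      by (simp add: diff_divide_distrib add_divide_distrib power2_eq_square)
    finally have "binom_term a b (Suc N) x = poly p x * ((- a\<^sup>2 / b - real N) / real (Suc N) + x * (x * (1 / (b * real (Suc N)))))"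
      unfolding p(2) .
    moreover have "poly [:u, 0, v:] x = u + x * (x * v)" for u v :: real by simp
    ultimately show ?thesis unfolding poly_mult by metis
  qed
  moreover have "Polynomial.degree ?q \<le> 2 * Suc N + 1"
  proof -
    have "Polynomial.degree ?q \<le> Polynomial.degree p + Polynomial.degree [:(- a\<^sup>2 / b - real N) / real (Suc N), 0, 1 / (b * real (Suc N)):]"
      by (rule degree_mult_le)
    also have "Polynomial.degree [:(- a\<^sup>2 / b - real N) / real (Suc N), 0, 1 / (b * real (Suc N)):] \<le> 2"
      by (simp add: degree_pCons_eq_if)
    finally show ?thesis using p(1) by simp
  qed
  ultimately show ?case by (intro exI[of _ ?q]) auto
qed

text \<open>
  The regularised value of the divergent series that is the formal coefficient of \<open>(1 - q)^N\<close>. The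
  range of \<open>i\<close> stops at the degree of the polynomial.
\<close>
definition reg_coeff :: "nat \<Rightarrow> (nat \<Rightarrow> real) \<Rightarrow> real \<Rightarrow> real \<Rightarrow> nat \<Rightarrow> real" where
  "reg_coeff M c a b N = (-1) ^ N * (\<Sum>i<2 * N + 2. abel_coeff M c i * (fdiff ^^ i) (binom_term a b N) 0)"

lemma reg_coeff_truncate:
  assumes "r \<ge> 2 * N + 2"
  shows "reg_coeff M c a b N = (-1) ^ N * (\<Sum>i<r. abel_coeff M c i * (fdiff ^^ i) (binom_term a b N) 0)"
proof -
  obtain p where p: "Polynomial.degree p \<le> 2 * N + 1" "binom_term a b N = poly p" using binom_term_poly by blast
  have "(\<Sum>i<2 * N + 2. abel_coeff M c i * (fdiff ^^ i) (binom_term a b N) 0)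
      = (\<Sum>i<r. abel_coeff M c i * (fdiff ^^ i) (binom_term a b N) 0)"
  proof (rule sum.mono_neutral_left)
    show "\<forall>i\<in>{..<r} - {..<2 * N + 2}. abel_coeff M c i * (fdiff ^^ i) (binom_term a b N) 0 = 0"
      using p(1) by (auto simp: p(2) fdiff_pow_poly_eq_0)
  qed (use assms in auto)
  thus ?thesis by (simp add: reg_coeff_def)
qed

text \<open>
  With \<open>w = 1 - exp (- t)\<close> this is the binomial series of \<open>(1 - w) powr y\<close>; its tail is compared with
  the series at \<open>w = 1/2\<close>.
\<close>
lemma powr_expansion:
  "(\<lambda>t. exp (- t * y) - (\<Sum>N<K. (y gchoose N) * (- (1 - exp (- t))) ^ N)) \<in> O[at_right 0](\<lambda>t. (1 - exp (- t :: real)) ^ K)"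
proof -
  define S where "S = (\<Sum>n. norm ((y gchoose n) * (1/2) ^ n))"
  \<comment> \<open>Convergence at \<open>3/4\<close> gives absolute convergence at \<open>1/2\<close>.\<close>
  have "summable (\<lambda>n. (y gchoose n) * (3/4) ^ n)" using gen_binomial_real[of "3/4" y] by (auto simp: sums_iff)
  hence sS: "summable (\<lambda>n. norm ((y gchoose n) * (1/2) ^ n))" by (rule powser_insidea) simp
  have "\<forall>\<^sub>F t::real in at_right 0. 0 < t \<and> t < ln 2" using eventually_at_right_real[of 0 "ln 2"] by simp
  hence "\<forall>\<^sub>F t in at_right 0. norm (exp (- t * y) - (\<Sum>N<K. (y gchoose N) * (- (1 - exp (- t))) ^ N)) \<le> (2 ^ K * S) * norm ((1 - exp (- t)) ^ K)"
  proof eventually_elim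
    case (elim t)
    define w where "w = 1 - exp (- t)"
    have "exp (- t) > exp (- ln 2)" using elim by simp
    moreover have "exp (- ln 2) = (1 / 2 :: real)" by (simp add: exp_minus)
    ultimately have w: "w < 1 / 2" by (simp add: w_def)
    have w0: "0 < w" using elim by (simp add: w_def)
    note w = w0 w
    have "(1 + (- w)) powr y = exp (- t * y)" by (simp add: w_def powr_def mult.commute)
    hence sums: "(\<lambda>n. (y gchoose n) * (- w) ^ n) sums exp (- t * y)" using gen_binomial_real[of "- w" y] w by simp
    have tail: "norm ((y gchoose (n + K)) * (- w) ^ (n + K)) \<le> 2 ^ K * w ^ K * norm ((y gchoose (n + K)) * (1/2) ^ (n + K))" for n
    proof -
      have "w ^ n \<le> (1/2) ^ n" using w by (intro power_mono) auto
      hence "w ^ (n + K) \<le> w ^ K * (1/2) ^ n" using w by (simp add: power_add mult.commute mult_left_mono)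
      also have "\<dots> = 2 ^ K * w ^ K * (1/2) ^ (n + K)" by (simp add: power_add power_divide)
      finally have "\<bar>y gchoose (n + K)\<bar> * w ^ (n + K) \<le> \<bar>y gchoose (n + K)\<bar> * (2 ^ K * w ^ K * (1/2) ^ (n + K))" by (intro mult_left_mono) auto
      thus ?thesis using w by (simp add: abs_mult power_abs mult_ac)
    qed
    have "exp (- t * y) - (\<Sum>N<K. (y gchoose N) * (- w) ^ N) = (\<Sum>n. (y gchoose (n + K)) * (- w) ^ (n + K))"
      using sums suminf_minus_initial_segment[of "\<lambda>n. (y gchoose n) * (- w) ^ n" K] by (simp add: sums_iff)
    also have "norm \<dots> \<le> (\<Sum>n. 2 ^ K * w ^ K * norm ((y gchoose (n + K)) * (1/2) ^ (n + K)))"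
      using summable_ignore_initial_segment[OF sS, of K] by (intro norm_suminf_le tail summable_mult) auto
    also have "\<dots> = 2 ^ K * w ^ K * (\<Sum>n. norm ((y gchoose (n + K)) * (1/2) ^ (n + K)))"
      using summable_ignore_initial_segment[OF sS, of K] by (intro suminf_mult) auto
    also have "\<dots> \<le> 2 ^ K * w ^ K * S"
    proof (rule mult_left_mono)
      have "0 \<le> (\<Sum>i<K. norm ((y gchoose i) * (1/2) ^ i))" by (intro sum_nonneg) auto
      thus "(\<Sum>n. norm ((y gchoose (n + K)) * (1/2) ^ (n + K))) \<le> S"
        unfolding S_def using suminf_split_initial_segment[OF sS, of K] by linarith
    qed (use w in auto)
    finally show ?case using w by (simp add: w_def mult_ac)
  qed
  thus ?thesis by (rule bigoI)
qed

text \<open>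
  With \<open>s = sqrt t\<close> the summand is a Gaussian function of \<open>s x\<close>, up to a factor of order \<open>1 / s\<close>.
\<close>
lemma exp_term_eq_gaussian:
  assumes "t > 0" "b > 0"
  shows "x * exp (- t * ((x\<^sup>2 - a\<^sup>2) / b)) = (exp (t * a\<^sup>2 / b) / sqrt t) * gaussian (1 / b) (sqrt t) [:0, 1:] x"
proof -
  have "exp (- t * ((x\<^sup>2 - a\<^sup>2) / b)) = exp (t * a\<^sup>2 / b) * exp (- (1 / b) * (sqrt t * x)\<^sup>2)"
    unfolding exp_add[symmetric] using assms by (simp add: power_mult_distrib field_simps)
  thus ?thesis using assms by (simp add: gaussian_def)
qed

lemma exp_term_fdiff_bound:
  fixes a b :: real
  assumes b: "b > 0"
  obtains C where "C \<ge> 0" "\<And>t n. 0 < t \<Longrightarrow> t \<le> 1 \<Longrightarrow>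
    \<bar>(fdiff ^^ r) (\<lambda>x. x * exp (- t * ((x\<^sup>2 - a\<^sup>2) / b))) (real n)\<bar> \<le> (sqrt t ^ r / sqrt t ^ 3) * (C / real ((Suc n)\<^sup>2))"
proof -
  have "1 / b > 0" using b by simp
  from fdiff_pow_gaussian_bound[OF this] obtain B where B: "B \<ge> 0" "\<And>s n. 0 < s \<Longrightarrow> s \<le> 1 \<Longrightarrow>
     s\<^sup>2 * \<bar>(fdiff ^^ r) (gaussian (1 / b) s [:0, 1:]) (real n)\<bar> \<le> s ^ r * (B / real ((Suc n)\<^sup>2))" by metis
  show ?thesis
  proof (rule that[of "exp (a\<^sup>2 / b) * B"])
    show "exp (a\<^sup>2 / b) * B \<ge> 0" using B by simp
    fix t :: real and n :: nat assume t: "0 < t" "t \<le> 1"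
    let ?s = "sqrt t"
    have s: "0 < ?s" "?s \<le> 1" using t by auto
    have e: "exp (t * a\<^sup>2 / b) \<le> exp (a\<^sup>2 / b)" using t b by (simp add: divide_right_mono mult_left_le_one_le)
    have "\<bar>(fdiff ^^ r) (\<lambda>x. x * exp (- t * ((x\<^sup>2 - a\<^sup>2) / b))) (real n)\<bar>
        = (exp (t * a\<^sup>2 / b) / ?s) * \<bar>(fdiff ^^ r) (gaussian (1 / b) ?s [:0, 1:]) (real n)\<bar>"
      unfolding exp_term_eq_gaussian[OF t(1) b] fdiff_pow_cmult using s by (simp add: abs_mult)
    also have "\<dots> \<le> (exp (a\<^sup>2 / b) / ?s) * ((?s ^ r * (B / real ((Suc n)\<^sup>2))) / ?s\<^sup>2)"
    proof (intro mult_mono divide_right_mono e)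
      show "\<bar>(fdiff ^^ r) (gaussian (1 / b) ?s [:0, 1:]) (real n)\<bar> \<le> (?s ^ r * (B / real ((Suc n)\<^sup>2))) / ?s\<^sup>2"
        using B(2)[OF s, of n] s by (subst pos_le_divide_eq) (simp_all add: mult.commute del: real_sqrt_pow2)
    qed (use s in auto)
    also have "\<dots> = (?s ^ r / ?s ^ 3) * (exp (a\<^sup>2 / b) * B / real ((Suc n)\<^sup>2))"
      by (simp add: power2_eq_square power3_eq_cube mult_ac)
    finally show "\<bar>(fdiff ^^ r) (\<lambda>x. x * exp (- t * ((x\<^sup>2 - a\<^sup>2) / b))) (real n)\<bar> \<le> (?s ^ r / ?s ^ 3) * (exp (a\<^sup>2 / b) * B / real ((Suc n)\<^sup>2))" .
  qed
qed

lemma summable_inverse_Suc_squares: "summable (\<lambda>n. C / real ((Suc n)\<^sup>2))"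
proof -
  have "summable (\<lambda>n. C * (1 / real (Suc n) ^ 2))"
    using inverse_power_summable[of 2, where ?'a = real] summable_Suc_iff[of "\<lambda>n. inverse (real n ^ 2)"]
    by (intro summable_mult) (simp add: inverse_eq_divide)
  thus ?thesis by simp
qed

lemma exp_term_fdiff_summable:
  fixes a b :: real
  assumes "b > 0" "0 < t" "t \<le> 1"
  shows "summable (\<lambda>n. \<bar>(fdiff ^^ r) (\<lambda>x. x * exp (- t * ((x\<^sup>2 - a\<^sup>2) / b))) (real n)\<bar>)"
proof -
  obtain C where C: "C \<ge> 0" "\<And>t n. 0 < t \<Longrightarrow> t \<le> 1 \<Longrightarrow>
    \<bar>(fdiff ^^ r) (\<lambda>x. x * exp (- t * ((x\<^sup>2 - a\<^sup>2) / b))) (real n)\<bar> \<le> (sqrt t ^ r / sqrt t ^ 3) * (C / real ((Suc n)\<^sup>2))"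
    by (rule exp_term_fdiff_bound[OF assms(1), where r = r and a = a]) (rule that)
  show ?thesis
  proof (rule summable_comparison_test'[of "\<lambda>n. (sqrt t ^ r / sqrt t ^ 3) * (C / real ((Suc n)\<^sup>2))" 0])
    show "summable (\<lambda>n. (sqrt t ^ r / sqrt t ^ 3) * (C / real ((Suc n)\<^sup>2)))"
      by (intro summable_mult summable_inverse_Suc_squares)
    show "norm \<bar>(fdiff ^^ r) (\<lambda>x. x * exp (- t * ((x\<^sup>2 - a\<^sup>2) / b))) (real n)\<bar> \<le> (sqrt t ^ r / sqrt t ^ 3) * (C / real ((Suc n)\<^sup>2))" for n
      using C(2)[OF assms(2,3), of n] by (simp only: real_norm_def abs_abs)
  qed
qed

text \<open>
  Every difference gains a factor \<open>sqrt t\<close>. Three of them are spent on the factor \<open>1 / sqrt t\<close> of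
  \<open>exp_term_eq_gaussian\<close> and on the sum over \<open>n\<close>, the others make up \<open>t ^ K\<close>.
\<close>
lemma abel_remainder_bigo:
  fixes a b :: real
  assumes b: "b > 0" and \<phi>: "mean_zero_periodic M \<phi>"
  shows "(\<lambda>t. \<Sum>n. \<phi> n * (fdiff ^^ (2 * K + 3)) (\<lambda>x. x * exp (- t * ((x\<^sup>2 - a\<^sup>2) / b))) (real n)) \<in> O[at_right 0](\<lambda>t. t ^ K)"
proof -
  let ?r = "2 * K + 3"
  obtain C where C: "C \<ge> 0" "\<And>t n. 0 < t \<Longrightarrow> t \<le> 1 \<Longrightarrow>
    \<bar>(fdiff ^^ ?r) (\<lambda>x. x * exp (- t * ((x\<^sup>2 - a\<^sup>2) / b))) (real n)\<bar> \<le> (sqrt t ^ ?r / sqrt t ^ 3) * (C / real ((Suc n)\<^sup>2))"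
    by (rule exp_term_fdiff_bound[OF b, where r = "2 * K + 3" and a = a]) (rule that)
  obtain B where B: "B \<ge> 0" "\<And>n. \<bar>\<phi> n\<bar> \<le> B" using mean_zero_periodic_bounded[OF \<phi>] by auto
  define Z where "Z = (\<Sum>n. C / real ((Suc n)\<^sup>2))"
  have "\<forall>\<^sub>F t::real in at_right 0. 0 < t \<and> t < 1" using eventually_at_right_real[of 0 1] by simp
  hence "\<forall>\<^sub>F t in at_right 0. norm (\<Sum>n. \<phi> n * (fdiff ^^ ?r) (\<lambda>x. x * exp (- t * ((x\<^sup>2 - a\<^sup>2) / b))) (real n)) \<le> (B * Z) * norm (t ^ K)"
  proof eventually_elim
    case (elim t)
    have s: "sqrt t > 0" using elim by simp
    have "sqrt t ^ ?r / sqrt t ^ 3 = (sqrt t)\<^sup>2 ^ K" using s by (simp add: power_add power_mult)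
    hence st: "sqrt t ^ ?r / sqrt t ^ 3 = t ^ K" using elim by simp
    have "norm (\<Sum>n. \<phi> n * (fdiff ^^ ?r) (\<lambda>x. x * exp (- t * ((x\<^sup>2 - a\<^sup>2) / b))) (real n)) \<le> (\<Sum>n. (B * t ^ K) * (C / real ((Suc n)\<^sup>2)))"
    proof (rule norm_suminf_le)
      fix n
      have "\<bar>\<phi> n\<bar> * \<bar>(fdiff ^^ ?r) (\<lambda>x. x * exp (- t * ((x\<^sup>2 - a\<^sup>2) / b))) (real n)\<bar> \<le> B * (t ^ K * (C / real ((Suc n)\<^sup>2)))"
        using C(2)[of t n] elim B unfolding st by (intro mult_mono) auto
      thus "norm (\<phi> n * (fdiff ^^ ?r) (\<lambda>x. x * exp (- t * ((x\<^sup>2 - a\<^sup>2) / b))) (real n)) \<le> (B * t ^ K) * (C / real ((Suc n)\<^sup>2))"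
        by (simp only: real_norm_def abs_mult mult.assoc)
    qed (intro summable_mult summable_inverse_Suc_squares)
    also have "\<dots> = (B * t ^ K) * Z" unfolding Z_def by (intro suminf_mult summable_inverse_Suc_squares)
    finally show ?case using elim by (simp add: mult_ac)
  qed
  thus ?thesis by (rule bigoI)
qed

lemma bigo_cmult: "f \<in> O[F](g) \<Longrightarrow> (\<lambda>t. c * f t) \<in> O[F](g)" for c :: real
  by (cases "c = 0") auto

lemma fdiff_pow_bigo:
  assumes "\<And>x. (\<lambda>t. \<rho> t x) \<in> O[F](g)"
  shows "(\<lambda>t. (fdiff ^^ i) (\<rho> t) x) \<in> O[F](g)"
  using assms by (induction i arbitrary: x) (auto simp: fdiff_def intro!: sum_in_bigo)

text \<open>
  Only the values of the summand near \<open>0\<close> enter the main terms of the iterated summation by parts, and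
  there the binomial series may be inserted with an error of order \<open>(1 - exp (- t)) ^ K\<close>. Its
  coefficients are polynomials in the summation variable, and their regularised sums are
  \<open>reg_coeff\<close>.
\<close>
theorem theta_expansion:
  fixes a b :: real
  assumes b: "b > 0" and c: "mean_zero_periodic M c"
  shows "asymp_expansion (\<lambda>t. \<Sum>n. c n * (real n * exp (- t * (((real n)\<^sup>2 - a\<^sup>2) / b)))) (\<lambda>t. 1 - exp (- t)) (reg_coeff M c a b)"
  unfolding asymp_expansion_def
proof
  fix K :: nat
  \<comment> \<open>\<open>2 * K\<close> differences for the factor \<open>t ^ K\<close> and three more for the loss in the remainder.\<close>
  define r where "r = 2 * K + 3"
  define w where "w = (\<lambda>t::real. 1 - exp (- t))"
  define g where "g = (\<lambda>t x::real. x * exp (- t * ((x\<^sup>2 - a\<^sup>2) / b)))"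
  define \<rho> where "\<rho> = (\<lambda>t x. x * (exp (- t * ((x\<^sup>2 - a\<^sup>2) / b)) - (\<Sum>N<K. (((x\<^sup>2 - a\<^sup>2) / b) gchoose N) * (- w t) ^ N)))"
  define R where "R = (\<lambda>t. \<Sum>n. (abel_step M ^^ r) c n * (fdiff ^^ r) (g t) (real n))"
  have \<rho>: "(\<lambda>t. \<rho> t x) \<in> O[at_right 0](\<lambda>t. w t ^ K)" for x
    unfolding \<rho>_def w_def by (rule bigo_cmult[OF powr_expansion])
  have tw: "(\<lambda>t. t ^ K) \<in> O[at_right 0](\<lambda>t. w t ^ K)"
  proof -
    have "(\<lambda>t. t) \<in> O[at_right 0](w)" unfolding w_def by real_asymp
    thus ?thesis by (rule landau_o.big_power)
  qed
  have R: "R \<in> O[at_right 0](\<lambda>t. w t ^ K)"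
    unfolding R_def g_def r_def
    by (rule landau_o.big_trans[OF abel_remainder_bigo[OF b mean_zero_periodic_pow[OF c]] tw])
  have E: "(\<lambda>t. (\<Sum>i<r. abel_coeff M c i * (fdiff ^^ i) (\<rho> t) 0) + R t) \<in> O[at_right 0](\<lambda>t. w t ^ K)"
    by (intro sum_in_bigo big_sum_in_bigo R bigo_cmult fdiff_pow_bigo \<rho>)
  have "\<forall>\<^sub>F t in at_right 0. (\<Sum>n. c n * (real n * exp (- t * (((real n)\<^sup>2 - a\<^sup>2) / b)))) - (\<Sum>N<K. reg_coeff M c a b N * w t ^ N)
      = (\<Sum>i<r. abel_coeff M c i * (fdiff ^^ i) (\<rho> t) 0) + R t"
  proof -
    have "\<forall>\<^sub>F t::real in at_right 0. 0 < t \<and> t < 1" using eventually_at_right_real[of 0 1] by simp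
    thus ?thesis
    proof eventually_elim
      case (elim t)
      have "(\<Sum>n. c n * g t (real n)) = (\<Sum>i<r. abel_coeff M c i * (fdiff ^^ i) (g t) 0) + R t"
        unfolding R_def by (rule abel_iterate[OF c]) (unfold g_def, rule exp_term_fdiff_summable, use b elim in auto)
      moreover have "(fdiff ^^ i) (g t) 0 = (\<Sum>N<K. (- w t) ^ N * (fdiff ^^ i) (binom_term a b N) 0) + (fdiff ^^ i) (\<rho> t) 0" for i
      proof -
        have "g t = (\<lambda>x. (\<Sum>N<K. (- w t) ^ N * binom_term a b N x) + \<rho> t x)"
          by (rule ext) (simp add: g_def \<rho>_def binom_term_def sum_distrib_left algebra_simps)
        thus ?thesis by (simp only: fdiff_pow_add fdiff_pow_sum fdiff_pow_cmult)
      qed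
      moreover have "(\<Sum>i<r. abel_coeff M c i * (\<Sum>N<K. (- w t) ^ N * (fdiff ^^ i) (binom_term a b N) 0)) = (\<Sum>N<K. reg_coeff M c a b N * w t ^ N)"
      proof -
        have "(\<Sum>i<r. abel_coeff M c i * (\<Sum>N<K. (- w t) ^ N * (fdiff ^^ i) (binom_term a b N) 0))
            = (\<Sum>N<K. \<Sum>i<r. abel_coeff M c i * ((- w t) ^ N * (fdiff ^^ i) (binom_term a b N) 0))"
          unfolding sum_distrib_left by (rule sum.swap)
        also have "\<dots> = (\<Sum>N<K. reg_coeff M c a b N * w t ^ N)"
        proof (rule sum.cong)
          fix N assume "N \<in> {..<K}"
          hence "r \<ge> 2 * N + 2" by (simp add: r_def)
          from reg_coeff_truncate[OF this] show "(\<Sum>i<r. abel_coeff M c i * ((- w t) ^ N * (fdiff ^^ i) (binom_term a b N) 0)) = reg_coeff M c a b N * w t ^ N"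
            by (simp add: power_minus[of "w t"] sum_distrib_left sum_distrib_right mult_ac)
        qed simp
        finally show ?thesis .
      qed
      ultimately show ?case by (simp add: g_def distrib_left sum.distrib)
    qed
  qed
  from landau_o.big.in_cong[OF this] E
  show "(\<lambda>t. (\<Sum>n. c n * (real n * exp (- t * (((real n)\<^sup>2 - a\<^sup>2) / b)))) - (\<Sum>N<K. reg_coeff M c a b N * (1 - exp (- t)) ^ N)) \<in> O[at_right 0](\<lambda>t. (1 - exp (- t)) ^ K)"
    unfolding w_def by blast
qed

theorem H_eq_reg_coeff:
  assumes b: "b > 0" and c: "mean_zero_periodic M (\<lambda>n. of_int (chi (int n)))"
  shows "H a b chi = reg_coeff M (\<lambda>n. of_int (chi (int n))) (of_int a) (of_int b)"
proof (rule H_eqI)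
  have "P a b chi (exp (- t)) = (\<Sum>n. of_int (chi (int n)) * (real n * exp (- t * (((real n)\<^sup>2 - (of_int a)\<^sup>2) / of_int b))))" for t
    unfolding P_def by (intro suminf_cong) (simp add: powr_def mult_ac)
  thus "asymp_expansion (\<lambda>t. P a b chi (exp (- t))) (\<lambda>t. 1 - exp (- t)) (reg_coeff M (\<lambda>n. of_int (chi (int n))) (of_int a) (of_int b))"
    using theta_expansion[OF _ c, of "of_int b" "of_int a"] b by simp
qed

section \<open>Numbers integral at a prime\<close>

text \<open>
  Membership in the localisation of the integers at \<open>p\<close>.
\<close>
definition p_integral :: "nat \<Rightarrow> real \<Rightarrow> bool" where
  "p_integral p r \<longleftrightarrow> (\<exists>x y :: int. \<not> int p dvd y \<and> r = of_int x / of_int y)"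

lemma cong_zero_mod_iff: "cong_zero_mod p r \<longleftrightarrow> (\<exists>z. p_integral p z \<and> r = real p * z)"
  unfolding cong_zero_mod_def p_integral_def by blast

context
  fixes p :: nat assumes p: "prime p"
begin

lemma p_integral_of_int [simp]: "p_integral p (of_int z)"
  unfolding p_integral_def using p by (intro exI[of _ z] exI[of _ 1]) auto

lemma p_integral_frac: "\<not> int p dvd y \<Longrightarrow> p_integral p (of_int x / of_int y)"
  unfolding p_integral_def by blast

lemma p_integral_add:
  assumes "p_integral p r" "p_integral p s" shows "p_integral p (r + s)"
proof -
  obtain x y x' y' where *: "\<not> int p dvd y" "r = of_int x / of_int y" "\<not> int p dvd y'" "s = of_int x' / of_int y'"
    using assms unfolding p_integral_def by metis
  have "y \<noteq> 0" "y' \<noteq> 0" using * by auto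
  hence "r + s = of_int (x * y' + x' * y) / of_int (y * y')" by (simp add: * add_frac_eq)
  moreover have "\<not> int p dvd y * y'" using * p by (simp add: prime_dvd_mult_iff)
  ultimately show ?thesis using p_integral_frac by metis
qed

lemma p_integral_mult:
  assumes "p_integral p r" "p_integral p s" shows "p_integral p (r * s)"
proof -
  obtain x y x' y' where *: "\<not> int p dvd y" "r = of_int x / of_int y" "\<not> int p dvd y'" "s = of_int x' / of_int y'"
    using assms unfolding p_integral_def by metis
  have "r * s = of_int (x * x') / of_int (y * y')" by (simp add: *)
  moreover have "\<not> int p dvd y * y'" using * p by (simp add: prime_dvd_mult_iff)
  ultimately show ?thesis using p_integral_frac by metis
qed

lemma p_integral_uminus: "p_integral p r \<Longrightarrow> p_integral p (- r)"
  using p_integral_mult[OF p_integral_of_int[of "-1"]] by simp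

lemma p_integral_diff: "p_integral p r \<Longrightarrow> p_integral p s \<Longrightarrow> p_integral p (r - s)"
  using p_integral_add[of r "- s"] p_integral_uminus by simp

lemma p_integral_sum: "(\<And>i. i \<in> A \<Longrightarrow> p_integral p (f i)) \<Longrightarrow> p_integral p (\<Sum>i\<in>A. f i)"
  using p_integral_of_int[of 0] by (induction A rule: infinite_finite_induct) (auto intro: p_integral_add)

text \<open>
  Only the \<open>p\<close>-part of \<open>k!\<close> matters. Modulo that power of \<open>p\<close> the fraction \<open>y\<close> agrees with a natural
  number \<open>z\<close>, and the numerator of \<open>z choose k\<close> is divisible by \<open>k!\<close>.
\<close>
lemma p_integral_gbinomial:
  assumes "p_integral p y" shows "p_integral p (y gchoose k)"
proof -
  obtain u v where uv: "\<not> int p dvd v" "y = of_int u / of_int v" using assms unfolding p_integral_def by metis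
  have v0: "v \<noteq> 0" using uv by auto
  have f0: "(fact k :: nat) \<noteq> 0" by simp
  obtain f' where f': "fact k = p ^ multiplicity p (fact k) * f'" "\<not> p dvd f'"
    using multiplicity_decompose'[OF f0, of p] p by (metis not_prime_unit)
  define m where "m = multiplicity p (fact k :: nat)"
  have "coprime v (int p)" using p uv(1) by (metis coprime_commute prime_imp_coprime prime_nat_int_transfer)
  hence "coprime v (int p ^ m)" by simp
  then obtain v' where v': "[v * v' = 1] (mod int p ^ m)" using cong_solve_coprime_int by blast
  \<comment> \<open>The natural number to which \<open>y = u / v\<close> is congruent modulo \<open>p ^ m\<close>.\<close>
  define z where "z = nat ((u * v') mod int p ^ m)"
  have z: "[int z = u * v'] (mod int p ^ m)" using p by (simp add: z_def cong_def prime_gt_0_nat)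
  define W where "W = (\<Prod>i<k. u - int i * v)"
  have "[W = (\<Prod>i<k. v * (int z - int i))] (mod int p ^ m)"
    unfolding W_def
  proof (rule cong_prod)
    fix i
    have "[v * int z = v * (u * v')] (mod int p ^ m)" by (rule cong_scalar_left[OF z])
    also have "v * (u * v') = u * (v * v')" by simp
    also have "[u * (v * v') = u * 1] (mod int p ^ m)" by (rule cong_scalar_left[OF v'])
    finally have "[v * int z = u] (mod int p ^ m)" by simp
    from cong_diff[OF this cong_refl[of "int i * v"]]
    show "[u - int i * v = v * (int z - int i)] (mod int p ^ m)" by (simp add: cong_sym algebra_simps)
  qed
  moreover have "int p ^ m dvd (\<Prod>i<k. v * (int z - int i))"
  proof -
    have "real_of_int (\<Prod>i<k. int z - int i) = fact k * (real z gchoose k)"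
      by (simp add: gbinomial_prod_rev lessThan_atLeast0)
    also have "\<dots> = real_of_int (fact k * int (z choose k))" by (simp add: binomial_gbinomial)
    finally have e: "(\<Prod>i<k. int z - int i) = fact k * int (z choose k)" by (simp only: of_int_eq_iff)
    have "p ^ m dvd (fact k :: nat)" unfolding m_def by (rule multiplicity_dvd)
    hence "int (p ^ m) dvd int (fact k)" by (simp only: of_nat_dvd_iff)
    hence "int p ^ m dvd fact k" by simp
    thus ?thesis by (simp add: prod.distrib e)
  qed
  ultimately have "int p ^ m dvd W" by (simp add: cong_dvd_iff)
  then obtain X where X: "W = int p ^ m * X" by (elim dvdE)
  have "y gchoose k = (\<Prod>i<k. y - real i) / fact k" by (simp add: gbinomial_prod_rev lessThan_atLeast0)
  also have "(\<Prod>i<k. y - real i) = (\<Prod>i<k. of_int (u - int i * v) / of_int v)"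
    using v0 by (intro prod.cong refl) (simp add: uv field_simps)
  also have "\<dots> = of_int W / of_int v ^ k" by (simp add: W_def prod_dividef)
  also have "fact k = real (fact k)" by simp
  also have "fact k = p ^ m * f'" using f'(1) by (simp add: m_def)
  also have "of_int W / of_int v ^ k / real (p ^ m * f') = of_int X / of_int (v ^ k * int f')"
    using p prime_gt_0_nat by (simp add: X field_simps)
  finally have "y gchoose k = of_int X / of_int (v ^ k * int f')" .
  moreover have "\<not> int p dvd v ^ k * int f'"
    using uv(1) f'(2) p prime_dvd_power[of "int p" v k] by (auto simp: prime_dvd_mult_iff)
  ultimately show ?thesis using p_integral_frac by metis
qed

lemma cong_zero_mod_add: "cong_zero_mod p r \<Longrightarrow> cong_zero_mod p s \<Longrightarrow> cong_zero_mod p (r + s)"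
  unfolding cong_zero_mod_iff by (metis distrib_left p_integral_add)

lemma cong_zero_mod_mult: "p_integral p z \<Longrightarrow> cong_zero_mod p r \<Longrightarrow> cong_zero_mod p (z * r)"
  unfolding cong_zero_mod_iff by (metis mult.left_commute p_integral_mult)

lemma cong_zero_mod_0: "cong_zero_mod p 0"
  unfolding cong_zero_mod_iff using p_integral_of_int[of 0] by (intro exI[of _ 0]) simp

lemma cong_zero_mod_diff: "cong_zero_mod p r \<Longrightarrow> cong_zero_mod p s \<Longrightarrow> cong_zero_mod p (r - s)"
  unfolding cong_zero_mod_iff by (metis right_diff_distrib p_integral_diff)

lemma cong_zero_mod_sum: "(\<And>i. i \<in> A \<Longrightarrow> cong_zero_mod p (f i)) \<Longrightarrow> cong_zero_mod p (\<Sum>i\<in>A. f i)"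
  by (induction A rule: infinite_finite_induct) (auto intro: cong_zero_mod_add cong_zero_mod_0)

lemma cong_zero_mod_fdiff_pow:
  assumes "\<And>n::nat. cong_zero_mod p (f (real n))"
  shows "cong_zero_mod p ((fdiff ^^ i) f (real n))"
proof (induction i arbitrary: n)
  case (Suc i)
  have "cong_zero_mod p ((fdiff ^^ i) f (real (Suc n)) - (fdiff ^^ i) f (real n))"
    by (intro cong_zero_mod_diff Suc)
  moreover have "(fdiff ^^ Suc i) f (real n) = (fdiff ^^ i) f (real (Suc n)) - (fdiff ^^ i) f (real n)"
    by (simp add: fdiff_def add.commute)
  ultimately show ?case by (simp only:)
qed (use assms in auto)

lemma p_integral_mean_partial:
  assumes "\<And>n. p_integral p (\<phi> n)" "\<not> p dvd M" shows "p_integral p (mean_partial M \<phi>)"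
proof -
  have "p_integral p (of_int 1 / of_int (int M))" using assms(2) by (intro p_integral_frac) simp
  hence "p_integral p ((\<Sum>j<M. \<Sum>k<j. \<phi> k) * (of_int 1 / of_int (int M)))"
    by (intro p_integral_mult p_integral_sum assms)
  thus ?thesis by (simp add: mean_partial_def)
qed

text \<open>
  The only division in the construction of the antiderivatives is by the period.
\<close>
lemma p_integral_abel_coeff:
  assumes "\<And>n. p_integral p (\<phi> n)" "\<not> p dvd M" shows "p_integral p (abel_coeff M \<phi> i)"
proof -
  have "p_integral p ((abel_step M ^^ i) \<phi> n)" for n
  proof (induction i arbitrary: n)
    case (Suc i)
    have "p_integral p (mean_partial M ((abel_step M ^^ i) \<phi>) - (\<Sum>k<Suc n. (abel_step M ^^ i) \<phi> k))"
      by (intro p_integral_diff p_integral_sum p_integral_mean_partial assms(2) Suc)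
    thus ?case by (simp add: abel_step_def[of M "(abel_step M ^^ i) \<phi>"])
  qed (use assms in auto)
  thus ?thesis unfolding abel_coeff_def by (rule p_integral_mean_partial[OF _ assms(2)])
qed

text \<open>
  With \<open>y = (m\<^sup>2 - a\<^sup>2) / b\<close> the absorption identity expresses \<open>y gchoose (p n - 1)\<close> as
  \<open>p n / (y + 1)\<close> times a \<open>p\<close>-integral number, and the non-residue condition makes \<open>y + 1\<close> a unit.
\<close>
lemma cong_zero_mod_binom_term:
  fixes a b :: int
  assumes b: "\<not> int p dvd b" and n: "n \<ge> 1" and nonres: "\<And>x::int. \<not> [x\<^sup>2 = a\<^sup>2 - b] (mod int p)"
  shows "cong_zero_mod p (binom_term (of_int a) (of_int b) (p * n - 1) (real m))"
proof -
  define y where "y = ((real m)\<^sup>2 - (of_int a)\<^sup>2) / of_int b"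
  define u where "u = (int m)\<^sup>2 - (a\<^sup>2 - b)"
  have b0: "b \<noteq> 0" using b by auto
  have y1: "y + 1 = of_int u / of_int b" using b0 by (simp add: y_def u_def field_simps)
  have u: "\<not> int p dvd u" using nonres[of "int m"] by (simp add: u_def cong_iff_dvd_diff)
  have u0: "u \<noteq> 0" using u by auto
  have pn: "p * n > 0" using p n prime_gt_0_nat by simp
  have "real (p * n) * ((y + 1) gchoose (p * n)) = (y + 1) * (y gchoose (p * n - 1))"
    using gbinomial_absorption'[OF pn, of "y + 1"] pn by (simp add: mult.commute)
  hence "(y gchoose (p * n - 1)) = (real (p * n) * ((y + 1) gchoose (p * n))) / (y + 1)"
    using u0 b0 by (simp add: y1)
  also have "\<dots> = real p * (of_int (int n) * ((y + 1) gchoose (p * n)) * (of_int b / of_int u))"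
    using u0 b0 by (simp add: y1)
  finally have "binom_term (of_int a) (of_int b) (p * n - 1) (real m)
     = real p * (of_int (int m) * (of_int (int n) * ((y + 1) gchoose (p * n)) * (of_int b / of_int u)))"
    by (simp add: binom_term_def y_def[symmetric])
  moreover have "p_integral p (of_int (int m) * (of_int (int n) * ((y + 1) gchoose (p * n)) * (of_int b / of_int u)))"
    by (intro p_integral_mult p_integral_of_int p_integral_gbinomial p_integral_frac u) (unfold y1, rule p_integral_frac[OF b])
  ultimately show ?thesis unfolding cong_zero_mod_iff by blast
qed

lemma reg_coeff_congruence:
  fixes a b :: int
  assumes M: "\<not> p dvd M" and b: "\<not> int p dvd b" and n: "n \<ge> 1" and nonres: "\<And>x::int. \<not> [x\<^sup>2 = a\<^sup>2 - b] (mod int p)"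
    and c: "\<And>n. p_integral p (c n)"
  shows "cong_zero_mod p (reg_coeff M c (of_int a) (of_int b) (p * n - 1))"
proof -
  have "cong_zero_mod p ((fdiff ^^ i) (binom_term (of_int a) (of_int b) (p * n - 1)) (real 0))" for i
    by (intro cong_zero_mod_fdiff_pow cong_zero_mod_binom_term b n nonres)
  hence "cong_zero_mod p (of_int ((-1) ^ (p * n - 1)) * (\<Sum>i<2 * (p * n - 1) + 2. abel_coeff M c i * (fdiff ^^ i) (binom_term (of_int a) (of_int b) (p * n - 1)) (real 0)))"
    by (intro cong_zero_mod_mult cong_zero_mod_sum p_integral_of_int p_integral_abel_coeff c M)
  thus ?thesis by (simp add: reg_coeff_def)
qed

end

section \<open>The congruence at primes for which the discriminant is a non-residue\<close>

lemma linear_congruence_nonresidue: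
  fixes a b :: int
  assumes b: "b > 0" and M: "M > 0" and per: "\<And>x. chi (x + int M) = chi x" and sum0: "(\<Sum>j<M. chi (int j)) = 0"
    and p: "prime p" "\<not> p dvd M" "\<not> int p dvd b" and nonres: "\<And>x::int. \<not> [x\<^sup>2 = a\<^sup>2 - b] (mod int p)"
  shows "linear_congruence (H a b chi) p"
proof -
  define c where "c = (\<lambda>n. real_of_int (chi (int n)))"
  have "(\<Sum>j<M. c j) = of_int (\<Sum>j<M. chi (int j))" by (simp add: c_def)
  hence "mean_zero_periodic M c" using M per sum0 by (simp add: mean_zero_periodic_def c_def)
  hence H: "H a b chi = reg_coeff M c (of_int a) (of_int b)" unfolding c_def by (rule H_eq_reg_coeff[OF b])
  have "cong_zero_mod p (H a b chi (p * n - 1))" if "n \<ge> 1" for n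
    unfolding H using reg_coeff_congruence[OF p that nonres] p_integral_of_int[OF p(1)] by (simp add: c_def)
  thus ?thesis unfolding linear_congruence_def using prime_gt_1_nat[OF p(1)] by (intro exI[of _ 1]) auto
qed

text \<open>
  If \<open>chi(n)\<close> were nonzero, then by periodicity so would be \<open>chi(k)\<close> at some \<open>k\<close> larger than \<open>\<bar>a\<bar>\<close>,
  where the exponent of \<open>q\<close> is negative.
\<close>
lemma chi_eq_0_if_b_neg:
  assumes P: "P_in_int_power_series a b chi" and b: "b < 0" and M: "M > 0" and per: "\<And>x. chi (x + int M) = chi x"
    and n: "n \<ge> 1"
  shows "chi (int n) = 0"
proof (rule ccontr)
  assume nz: "chi (int n) \<noteq> 0"
  define k where "k = n + nat \<bar>a\<bar> * M"
  have shift: "chi (int n + int j * int M) = chi (int n)" for j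
  proof (induction j)
    case (Suc j)
    have "int n + int (Suc j) * int M = int n + int j * int M + int M" by (simp add: algebra_simps)
    thus ?case using Suc per by metis
  qed simp
  have "int k = int n + int (nat \<bar>a\<bar>) * int M" by (simp only: k_def of_nat_add of_nat_mult)
  hence ck: "chi (int k) \<noteq> 0" using nz shift by (simp only: not_False_eq_True)
  have "nat \<bar>a\<bar> \<le> nat \<bar>a\<bar> * M" using M by simp
  hence k: "int k > \<bar>a\<bar>" using n unfolding k_def by linarith
  define e :: rat where "e = ((of_nat k)\<^sup>2 - (of_int a)\<^sup>2) / of_int b"
  have "m = k" if "((of_nat m)\<^sup>2 - (of_int a)\<^sup>2) / of_int b = e" for m :: nat
  proof -
    have "(of_nat m)\<^sup>2 = (of_nat k :: rat)\<^sup>2" using that b by (simp add: e_def)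
    hence "of_nat (m\<^sup>2) = (of_nat (k\<^sup>2) :: rat)" by (simp only: of_nat_power)
    hence "m\<^sup>2 = k\<^sup>2" by (simp only: of_nat_eq_iff)
    thus "m = k" by simp
  qed
  hence "{m::nat. ((of_nat m)\<^sup>2 - (of_int a)\<^sup>2) / of_int b = e} = {k}"
    by (auto simp: e_def)
  hence "P_coeff a b chi e = int k * chi (int k)" by (simp add: P_coeff_def)
  hence "P_coeff a b chi e \<noteq> 0" using ck k by simp
  hence "e \<in> \<nat>" using P by (simp add: P_in_int_power_series_def)
  hence "e \<ge> 0" by (auto simp: Nats_def)
  moreover have "(of_int a)\<^sup>2 < (of_nat k :: rat)\<^sup>2"
  proof -
    have "\<bar>a\<bar>\<^sup>2 < (int k)\<^sup>2" using k by (intro power_strict_mono) auto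
    hence "of_int (a\<^sup>2) < (of_int ((int k)\<^sup>2) :: rat)" by (simp only: of_int_less_iff power2_abs)
    thus ?thesis by simp
  qed
  hence "e < 0" unfolding e_def using b by (intro divide_pos_neg) auto
  ultimately show False by simp
qed

lemma H_eq_0_if_b_neg:
  assumes "P_in_int_power_series a b chi" "b < 0" "M > 0" "\<And>x. chi (x + int M) = chi x"
  shows "H a b chi = (\<lambda>_. 0)"
proof (rule H_eqI)
  have zero: "real n * of_int (chi (int n)) = 0" for n
    using chi_eq_0_if_b_neg[OF assms, of n] by (cases "n = 0") auto
  hence "P a b chi q = 0" for q by (simp only: P_def zero mult_zero_left suminf_zero)
  thus "asymp_expansion (\<lambda>t. P a b chi (exp (- t))) (\<lambda>t. 1 - exp (- t)) (\<lambda>_. 0)"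
    by (simp add: asymp_expansion_def)
qed

section \<open>Powers of integers and series on a half-plane\<close>

lemma segment_Suc:
  assumes "z \<in> closed_segment (of_nat n :: complex) (of_nat (Suc n))"
  obtains x where "z = of_real x" "real n \<le> x" "x \<le> real n + 1"
proof -
  from assms obtain u where u: "0 \<le> u" "u \<le> 1"
    "z = (1 - u) *\<^sub>R of_nat n + u *\<^sub>R of_nat (Suc n)" by (auto simp: closed_segment_def)
  have "z = of_real (real n + u)" using u(3) by (simp add: scaleR_conv_of_real algebra_simps)
  with u show ?thesis by (intro that[of "real n + u"]) auto
qed

lemma DERIV_powr_segment:
  assumes "z \<in> closed_segment (of_nat n :: complex) (of_nat (Suc n))" "n \<ge> 1"
  shows "((\<lambda>z. z powr s) has_field_derivative s * z powr (s - 1)) (at z within S)"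
proof -
  from segment_Suc[OF assms(1)] obtain x where x: "z = of_real x" "real n \<le> x" by metis
  have "z \<notin> \<real>\<^sub>\<le>\<^sub>0" using x assms(2) by (auto simp: complex_nonpos_Reals_iff)
  thus ?thesis by (rule has_field_derivative_at_within[OF has_field_derivative_powr])
qed

lemma norm_powr_segment:
  assumes "z \<in> closed_segment (of_nat n :: complex) (of_nat (Suc n))" "n \<ge> 1" "Re s \<le> 0"
  shows "norm (z powr s) \<le> real n powr Re s"
proof -
  from segment_Suc[OF assms(1)] obtain x where x: "z = of_real x" "real n \<le> x" by metis
  have "norm (z powr s) = x powr Re s" using x assms(2) by (simp add: norm_powr_real_powr)
  also have "\<dots> \<le> real n powr Re s"
    using powr_mono2'[of "Re s" "real n" x] x assms by auto
  finally show ?thesis .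
qed

lemma norm_nat_powr: "norm (of_nat n powr s :: complex) = real n powr Re s"
  by (cases "n = 0") (auto simp: norm_powr_real_powr)

lemma nat_powr_diff_bound:
  assumes "n \<ge> 1" "Re s \<ge> -1"
  shows "norm (of_nat n powr (-s) - of_nat (Suc n) powr (-s) :: complex)
           \<le> norm s * real n powr (- Re s - 1)"
proof -
  let ?S = "closed_segment (of_nat n :: complex) (of_nat (Suc n))"
  have "norm (of_nat n powr (-s) - of_nat (Suc n) powr (-s) :: complex)
          \<le> (norm s * real n powr (- Re s - 1)) * norm (of_nat n - of_nat (Suc n) :: complex)"
  proof (rule field_differentiable_bound[of ?S _ "\<lambda>z. (-s) * z powr (-s - 1)"])
    fix z assume z: "z \<in> ?S"
    have "norm (z powr (-s - 1)) \<le> real n powr (- Re s - 1)"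
      using norm_powr_segment[OF z assms(1), of "-s - 1"] assms by simp
    thus "norm (- s * z powr (- s - 1)) \<le> norm s * real n powr (- Re s - 1)"
      by (simp add: norm_mult mult_left_mono)
    show "((\<lambda>z. z powr (-s)) has_field_derivative (-s) * z powr (-s - 1)) (at z within ?S)"
      using DERIV_powr_segment[OF z assms(1)] .
  qed auto
  thus ?thesis by simp
qed

text \<open>
  The error in replacing the difference of two consecutive terms \<open>n powr - s\<close> by the derivative. It
  serves both to continue the zeta function and to compare sums over \<open>E n / n\<close> with sums over
  increments of \<open>E\<close>.
\<close>
definition powr_rem :: "nat \<Rightarrow> complex \<Rightarrow> complex" where
  "powr_rem n s = of_nat n powr (-s) - of_nat (Suc n) powr (-s) - s * of_nat n powr (-s - 1)"

lemma powr_rem_bound: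
  assumes "n \<ge> 1" "Re s \<ge> -2"
  shows "norm (powr_rem n s) \<le> norm s * norm (s + 1) * real n powr (- Re s - 2)"
proof -
  let ?S = "closed_segment (of_nat n :: complex) (of_nat (Suc n))"
  define f where "f = (\<lambda>i::nat. \<lambda>z::complex. if i = 0 then z powr (-s) else
     if i = 1 then (-s) * z powr (-s-1) else s * (s + 1) * z powr (-s - 2))"
  have "norm (f 0 (of_nat (Suc n)) -
      (\<Sum>i\<le>1. f i (of_nat n) * (of_nat (Suc n) - of_nat n) ^ i / fact i))
      \<le> (norm s * norm (s + 1) * real n powr (- Re s - 2)) *
         norm (of_nat (Suc n) - of_nat n :: complex) ^ Suc 1 / fact 1"
  proof (rule complex_Taylor[of ?S])
    fix i z assume z: "z \<in> ?S" and i: "i \<le> (1::nat)"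
    have eq: "- s * ((- s - 1) * z powr (- s - 1 - 1)) = s * (s + 1) * z powr (-s - 2)"
      by (simp add: algebra_simps)
    show "(f i has_field_derivative f (Suc i) z) (at z within ?S)"
    proof (cases "i = 0")
      case True
      thus ?thesis using DERIV_powr_segment[OF z assms(1), of "-s"] by (simp add: f_def)
    next
      case False
      hence i1: "i = 1" using i by simp
      have "((\<lambda>z. -s * z powr (-s - 1)) has_field_derivative
              -s * ((-s - 1) * z powr (-s - 1 - 1))) (at z within ?S)"
        by (intro DERIV_cmult DERIV_powr_segment[OF z assms(1)])
      thus ?thesis unfolding eq by (simp add: f_def i1)
    qed
  next
    fix z assume z: "z \<in> ?S"
    have "norm (z powr (-s - 2)) \<le> real n powr (- Re s - 2)"
      using norm_powr_segment[OF z assms(1), of "-s - 2"] assms by simp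
    thus "norm (f (Suc 1) z) \<le> norm s * norm (s + 1) * real n powr (- Re s - 2)"
      by (simp add: f_def norm_mult mult_left_mono)
  qed auto
  hence "norm (of_nat (Suc n) powr (-s) - (of_nat n powr (-s) - s * of_nat n powr (-s-1)))
     \<le> norm s * norm (s + 1) * real n powr (- Re s - 2)"
    by (simp add: f_def)
  thus ?thesis unfolding powr_rem_def
    by (subst norm_minus_commute) (simp add: algebra_simps)
qed

lemma holomorphic_nat_powr [holomorphic_intros]:
  "f holomorphic_on S \<Longrightarrow> (\<lambda>s. of_nat n powr f s :: complex) holomorphic_on S"
proof (cases "n = 0")
  case False
  hence eq: "(\<lambda>s. of_nat n powr f s :: complex) = (\<lambda>s. exp (f s * of_real (ln (real n))))"
    by (auto simp: powr_def Ln_of_nat)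
  assume "f holomorphic_on S"
  thus ?thesis unfolding eq by (intro holomorphic_intros)
qed auto

lemma powr_rem_holomorphic [holomorphic_intros]:
  "f holomorphic_on S \<Longrightarrow> (\<lambda>s. powr_rem n (f s)) holomorphic_on S"
  unfolding powr_rem_def by (intro holomorphic_intros)

lemma open_Re_gt: "open {s::complex. Re s > c}" by (simp add: open_halfspace_Re_gt)

lemma summable_Suc_powr: "d > 0 \<Longrightarrow> summable (\<lambda>n. real (Suc n) powr (-1 - d))"
  by (subst summable_Suc_iff) (simp add: summable_real_powr_iff)

text \<open>
  On a small disc around \<open>s\<close> the real parts stay above \<open>Re s / 2\<close>, so the terms are dominated by
  a convergent series.
\<close>
lemma series_holomorphic_halfplane:
  fixes f :: "nat \<Rightarrow> complex \<Rightarrow> complex"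
  assumes hol: "\<And>n. f n holomorphic_on {s. Re s > 0}"
    and C: "C \<ge> 0" and bound: "\<And>n s. Re s > 0 \<Longrightarrow>
      norm (f n s) \<le> C * (1 + norm s) ^ 2 * real (Suc n) powr (-1 - Re s)"
  shows "(\<lambda>s. \<Sum>n. f n s) holomorphic_on {s. Re s > 0}"
    and "\<And>s. Re s > 0 \<Longrightarrow> summable (\<lambda>n. f n s)"
proof -
  let ?S = "{s::complex. Re s > 0}"
  have A: "\<exists>d h. 0 < d \<and> summable h \<and> range h \<subseteq> \<real>\<^sub>\<ge>\<^sub>0 \<and>
      (\<forall>\<^sub>F n in sequentially. \<forall>y\<in>ball x d \<inter> ?S. cmod (f n y) \<le> cmod (h n))"
    if x: "x \<in> ?S" for x
  proof -
    define d where "d = Re x / 2"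
    define h where "h = (\<lambda>n. C * (1 + norm x + d) ^ 2 * real (Suc n) powr (-1 - d))"
    have d: "d > 0" using x by (simp add: d_def)
    have hn: "h n \<ge> 0" for n using C by (simp add: h_def)
    have b: "norm (f n y) \<le> h n" if y: "y \<in> ball x d \<inter> ?S" for n y
    proof -
      have "norm (y - x) < d" using y by (simp add: dist_norm norm_minus_commute)
      hence ny: "norm y \<le> norm x + d" using norm_triangle_sub[of y x] by linarith
      have "\<bar>Re (y - x)\<bar> \<le> norm (y - x)" by (rule abs_Re_le_cmod)
      with \<open>norm (y - x) < d\<close> have "Re y \<ge> d" by (simp add: d_def)
      have "norm (f n y) \<le> C * (1 + norm y) ^ 2 * real (Suc n) powr (-1 - Re y)"
        using y by (intro bound) auto
      also have "\<dots> \<le> h n" unfolding h_def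
        using ny \<open>Re y \<ge> d\<close> C by (intro mult_mono power_mono powr_mono) auto
      finally show ?thesis .
    qed
    have "summable h" unfolding h_def by (intro summable_mult summable_Suc_powr d)
    hence "summable (\<lambda>n. complex_of_real (h n))" by (simp add: summable_of_real)
    moreover have "range (\<lambda>n. complex_of_real (h n)) \<subseteq> \<real>\<^sub>\<ge>\<^sub>0" using hn by auto
    ultimately show ?thesis using d b hn
      by (intro exI[of _ d] exI[of _ "\<lambda>n. complex_of_real (h n)"]) auto
  qed
  have "open ?S" by (rule open_Re_gt)
  then obtain g where g: "\<forall>x\<in>?S. (\<lambda>n. f n x) sums g x \<and> g field_differentiable at x"
  proof (rule series_differentiable_comparison_complex[OF _ _ A])
    fix n x assume "x \<in> ?S"
    thus "f n field_differentiable at x" using hol open_Re_gt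
      by (metis holomorphic_on_imp_differentiable_at)
  qed auto
  show "summable (\<lambda>n. f n s)" if "Re s > 0" for s using g that by (auto simp: sums_iff)
  have "g holomorphic_on ?S" using g \<open>open ?S\<close> by (simp add: holomorphic_on_open field_differentiable_def)
  moreover have "g s = (\<Sum>n. f n s)" if "s \<in> ?S" for s using g that by (simp add: sums_iff)
  ultimately show "(\<lambda>s. \<Sum>n. f n s) holomorphic_on ?S"
    using holomorphic_cong[of ?S ?S g "\<lambda>s. \<Sum>n. f n s"] by blast
qed

section \<open>Newman's contour argument\<close>

lemma powr_mvt:
  fixes u y :: real assumes "u > 0"
  obtains \<xi> where "u < \<xi>" "\<xi> < u + 1" "(u + 1) powr y - u powr y = y * \<xi> powr (y - 1)"
proof -
  have "\<exists>z>u. z < u + 1 \<and> (u + 1) powr y - u powr y = (u + 1 - u) * (y * z powr (y - 1))"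
    by (rule MVT2) (use assms in \<open>auto intro!: derivative_eq_intros\<close>)
  thus ?thesis using that by auto
qed

text \<open>
  Comparison with the integral of \<open>u powr (y - 1)\<close>, which is increasing or decreasing according to
  the sign of \<open>y - 1\<close>; the last summand covers the increasing case.
\<close>
lemma sum_powr_le:
  fixes y :: real assumes "y > 0" "N \<ge> 1"
  shows "(\<Sum>n=1..N. real n powr (y - 1)) \<le> real N powr y / y + real N powr (y - 1)"
proof (cases "y \<le> 1")
  case True
  have "(\<Sum>n=1..N. real n powr (y - 1)) \<le> real N powr y / y" using assms(2)
  proof (induction N rule: nat_induct_at_least)
    case base thus ?case using True assms by simp
  next
    case (Suc n)
    obtain \<xi> where \<xi>: "real n < \<xi>" "\<xi> < real n + 1"
      "(real n + 1) powr y - real n powr y = y * \<xi> powr (y - 1)"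
      using powr_mvt[of "real n" y] Suc.hyps by (metis less_le_trans of_nat_0_less_iff zero_less_one)
    have "real (Suc n) powr (y - 1) \<le> \<xi> powr (y - 1)"
      using powr_mono2'[of "y - 1" \<xi> "real (Suc n)"] True \<xi> by simp
    also have "\<dots> = (real (Suc n) powr y - real n powr y) / y"
      using \<xi>(3) assms by (simp add: add.commute)
    finally show ?case using Suc.IH by (simp add: diff_divide_distrib)
  qed
  thus ?thesis by (smt (verit) powr_ge_zero)
next
  case False
  have "(\<Sum>n=1..N. real n powr (y - 1)) - real N powr (y - 1) \<le> real N powr y / y" using assms(2)
  proof (induction N rule: nat_induct_at_least)
    case base thus ?case using assms by simp
  next
    case (Suc n)
    obtain \<xi> where \<xi>: "real n < \<xi>" "\<xi> < real n + 1"
      "(real n + 1) powr y - real n powr y = y * \<xi> powr (y - 1)"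
      using powr_mvt[of "real n" y] Suc.hyps by (metis less_le_trans of_nat_0_less_iff zero_less_one)
    have "real n powr (y - 1) \<le> \<xi> powr (y - 1)"
      using powr_mono2[of "y - 1" "real n" \<xi>] False \<xi> by simp
    also have "\<dots> = (real (Suc n) powr y - real n powr y) / y"
      using \<xi>(3) assms by (simp add: add.commute)
    finally show ?case using Suc.IH by (simp add: diff_divide_distrib)
  qed
  thus ?thesis by simp
qed

lemma sum_powr_tail_le:
  fixes x :: real assumes "x > 0" "N \<ge> 1" "M \<ge> N"
  shows "(\<Sum>n=Suc N..M. real n powr (-1 - x)) \<le> real N powr (-x) / x"
proof -
  have "(\<Sum>n=Suc N..M. real n powr (-1 - x)) \<le> real N powr (-x) / x - real M powr (-x) / x"
    using assms(3)
  proof (induction M rule: nat_induct_at_least)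
    case base thus ?case by simp
  next
    case (Suc n)
    obtain \<xi> where \<xi>: "real n < \<xi>" "\<xi> < real n + 1"
      "(real n + 1) powr (-x) - real n powr (-x) = (-x) * \<xi> powr (-1 - x)"
      using powr_mvt[of "real n" "-x"] Suc.hyps assms
      by (metis diff_conv_add_uminus add.commute le_trans less_le_trans of_nat_0_less_iff zero_less_one)
    have "real (Suc n) powr (-1-x) \<le> \<xi> powr (-1 - x)"
      using powr_mono2'[of "-1-x" \<xi> "real (Suc n)"] assms \<xi> by simp
    also have "\<dots> = (real n powr (-x) - real (Suc n) powr (-x)) / x"
      using \<xi>(3) assms by (simp add: add.commute field_simps)
    finally show ?case using Suc by (simp add: diff_divide_distrib)
  qed
  thus ?thesis using assms by (smt (verit) divide_nonneg_pos powr_ge_zero)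
qed

text \<open>
  A pointwise bound alone would not give decay along a segment that starts on the imaginary axis;
  the exponential has to be integrated.
\<close>
lemma contour_integral_linepath_exp_bound:
  assumes int: "f contour_integrable_on linepath a b" and c: "c > 0"
    and bd: "\<And>t. 0 \<le> t \<Longrightarrow> t \<le> 1 \<Longrightarrow> norm (f (linepath a b t)) \<le> B * exp (- c * t)"
  shows "norm (contour_integral (linepath a b) f) \<le> B * norm (b - a) / c"
proof -
  have B: "B \<ge> 0" using order_trans[OF norm_ge_zero bd[of 0]] by simp
  define F where "F = (\<lambda>t. - (B * norm (b - a) / c) * exp (- c * t))"
  have FI: "((\<lambda>t. B * exp (- c * t) * norm (b - a)) has_integral (F 1 - F 0)) {0..1}"
    by (rule fundamental_theorem_of_calculus)
       (use c in \<open>auto simp: F_def has_real_derivative_iff_has_vector_derivative[symmetric]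
          intro!: derivative_eq_intros\<close>)
  have "norm (contour_integral (linepath a b) f)
          = norm (integral {0..1} (\<lambda>x. f (linepath a b x) * (b - a)))"
    by (simp add: contour_integral_integral)
  also have "\<dots> \<le> integral {0..1} (\<lambda>t. B * exp (- c * t) * norm (b - a))"
  proof (rule integral_norm_bound_integral)
    show "(\<lambda>x. f (linepath a b x) * (b - a)) integrable_on {0..1}"
      using int by (simp add: contour_integrable_on)
    show "(\<lambda>t. B * exp (- c * t) * norm (b - a)) integrable_on {0..1}" using FI by blast
    fix t :: real assume "t \<in> {0..1}"
    thus "norm (f (linepath a b t) * (b - a)) \<le> B * exp (- c * t) * norm (b - a)"
      using bd[of t] by (simp add: norm_mult mult_right_mono)
  qed
  also have "\<dots> = F 1 - F 0" using FI by (rule integral_unique)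
  also have "\<dots> \<le> B * norm (b - a) / c"
    using B c by (simp add: F_def)
  finally show ?thesis .
qed

text \<open>
  The contour of Newman's argument is cut where it meets the imaginary axis: \<open>rsemi\<close> is the right half
  of the circle, run upwards, and \<open>lsemi\<close> the left half, run downwards.
\<close>
definition rsemi :: "real \<Rightarrow> real \<Rightarrow> complex" where "rsemi R = part_circlepath 0 R (-pi/2) (pi/2)"
definition lsemi :: "real \<Rightarrow> real \<Rightarrow> complex" where "lsemi R = part_circlepath 0 R (pi/2) (3*pi/2)"

lemma rsemi_simps:
  assumes "R > 0"
  shows "valid_path (rsemi R)" "pathstart (rsemi R) = - (\<i> * of_real R)"
    "pathfinish (rsemi R) = \<i> * of_real R"
    "\<And>z. z \<in> path_image (rsemi R) \<Longrightarrow> norm z = R \<and> Re z \<ge> 0"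
proof -
  show "valid_path (rsemi R)" by (simp add: rsemi_def valid_path_part_circlepath)
  show "pathstart (rsemi R) = - (\<i> * of_real R)" "pathfinish (rsemi R) = \<i> * of_real R"
    by (auto simp: rsemi_def exp_Euler complex_eq_iff cos_of_real sin_of_real Re_exp Im_exp)
  fix z assume "z \<in> path_image (rsemi R)"
  then obtain t where t: "-pi/2 \<le> t" "t \<le> pi/2" "z = of_real R * exp (\<i> * of_real t)"
    by (auto simp: rsemi_def path_image_part_circlepath)
  have "cos t \<ge> 0" using t by (intro cos_ge_zero) auto
  thus "norm z = R \<and> Re z \<ge> 0" using t assms by (auto simp: norm_mult Re_exp)
qed

lemma lsemi_simps:
  assumes "R > 0"
  shows "valid_path (lsemi R)" "pathstart (lsemi R) = \<i> * of_real R"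
    "pathfinish (lsemi R) = - (\<i> * of_real R)"
    "\<And>z. z \<in> path_image (lsemi R) \<Longrightarrow> norm z = R \<and> Re z \<le> 0"
proof -
  show "valid_path (lsemi R)" by (simp add: lsemi_def valid_path_part_circlepath)
  have c: "cos (3*pi/2) = 0" "sin (3*pi/2) = -1"
    using cos_periodic_pi[of "pi/2"] sin_periodic_pi[of "pi/2"] by (simp_all add: field_simps)
  show "pathstart (lsemi R) = \<i> * of_real R" "pathfinish (lsemi R) = - (\<i> * of_real R)"
    using c by (auto simp: lsemi_def complex_eq_iff Re_exp Im_exp)
  fix z assume "z \<in> path_image (lsemi R)"
  then obtain t where t: "pi/2 \<le> t" "t \<le> 3*pi/2" "z = of_real R * exp (\<i> * of_real t)"
    by (auto simp: lsemi_def path_image_part_circlepath)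
  have "cos (t - pi) \<ge> 0" using t by (intro cos_ge_zero) auto
  hence "cos t \<le> 0" by simp
  thus "norm z = R \<and> Re z \<le> 0" using t assms by (auto simp: norm_mult Re_exp mult_nonneg_nonpos)
qed

lemma Ln_i_times:
  assumes "R > 0"
  shows "Ln (\<i> * of_real R) = of_real (ln R) + \<i> * of_real pi / 2"
        "Ln (-(\<i> * of_real R)) = of_real (ln R) - \<i> * of_real pi / 2"
  using Ln_times_of_real[OF assms, of \<i>] Ln_times_of_real[OF assms, of "-\<i>"]
  using assms by (simp_all add: mult_ac Ln_of_real)

text \<open>
  The integral of \<open>1 / w\<close> has the primitive \<open>Ln w\<close> on the right half and \<open>Ln (- w)\<close> on any path that
  avoids the nonnegative reals; each half contributes \<open>\<pi> \<i>\<close>.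
\<close>
lemma winding_rsemi_join:
  assumes R: "R > 0" and g: "valid_path \<gamma>" "pathstart \<gamma> = \<i> * of_real R"
    "pathfinish \<gamma> = - (\<i> * of_real R)"
    and im: "\<And>z. z \<in> path_image \<gamma> \<Longrightarrow> \<not> (Re z \<ge> 0 \<and> Im z = 0)"
  shows "winding_number (rsemi R +++ \<gamma>) 0 = 1"
proof -
  note r = rsemi_simps[OF R]
  have r0: "z \<notin> \<real>\<^sub>\<le>\<^sub>0" if "z \<in> path_image (rsemi R)" for z
    using r(4)[OF that] R by (auto simp: complex_nonpos_Reals_iff cmod_def)
  have v: "valid_path (rsemi R +++ \<gamma>)" using r g by (intro valid_path_join) auto
  have i1: "((\<lambda>w. 1 / w) has_contour_integral (Ln (pathfinish (rsemi R)) - Ln (pathstart (rsemi R)))) (rsemi R)"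
    by (rule contour_integral_primitive[of "- \<real>\<^sub>\<le>\<^sub>0"])
       (use r r0 in \<open>auto intro!: derivative_eq_intros simp: field_simps\<close>)
  have i2: "((\<lambda>w. 1 / w) has_contour_integral (Ln (-pathfinish \<gamma>) - Ln (-pathstart \<gamma>))) \<gamma>"
    by (rule contour_integral_primitive[of "{z. -z \<notin> \<real>\<^sub>\<le>\<^sub>0}"])
       (use g im in \<open>auto intro!: derivative_eq_intros simp: field_simps complex_nonpos_Reals_iff\<close>)
  have "((\<lambda>w. 1 / w) has_contour_integral (2 * of_real pi * \<i>)) (rsemi R +++ \<gamma>)"
    using has_contour_integral_join[OF i1 i2 r(1) g(1)] R
    by (simp add: r g Ln_i_times algebra_simps)
  hence "contour_integral (rsemi R +++ \<gamma>) (\<lambda>w. 1 / (w - 0)) = 2 * of_real pi * \<i>"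
    by (simp add: contour_integral_unique)
  moreover have "0 \<notin> path_image (rsemi R +++ \<gamma>)"
    using im[of 0] r0[of 0] by (auto simp: path_image_join r g)
  ultimately show ?thesis using v by (simp add: winding_number_valid_path)
qed

lemma cauchy_rsemi_join:
  assumes R: "R > 0" and g: "valid_path \<gamma>" "pathstart \<gamma> = \<i> * of_real R"
    "pathfinish \<gamma> = - (\<i> * of_real R)"
    and im: "\<And>z. z \<in> path_image \<gamma> \<Longrightarrow> \<not> (Re z \<ge> 0 \<and> Im z = 0)"
    and V: "open V" "convex V" "0 \<in> V" "path_image (rsemi R) \<subseteq> V" "path_image \<gamma> \<subseteq> V"
    and h: "h holomorphic_on V"
  shows "contour_integral (rsemi R) (\<lambda>w. h w / w) + contour_integral \<gamma> (\<lambda>w. h w / w)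
           = 2 * of_real pi * \<i> * h 0"
    and "(\<lambda>w. h w / w) contour_integrable_on rsemi R"
    and "(\<lambda>w. h w / w) contour_integrable_on \<gamma>"
proof -
  note r = rsemi_simps[OF R]
  have v: "valid_path (rsemi R +++ \<gamma>)" using r g by (intro valid_path_join) auto
  have "0 \<notin> path_image \<gamma>" using im[of 0] by auto
  moreover have "0 \<notin> path_image (rsemi R)" using r(4)[of 0] R by auto
  ultimately have "((\<lambda>w. h w / (w - 0)) has_contour_integral
      complex_of_real (2 * pi) * \<i> * winding_number (rsemi R +++ \<gamma>) 0 * h 0) (rsemi R +++ \<gamma>)"
    using V h r g v interior_open[of V]
    by (intro Cauchy_integral_formula_convex_simple[of V]) (auto simp: path_image_join)
  hence *: "((\<lambda>w. h w / w) has_contour_integral (2 * of_real pi * \<i> * h 0)) (rsemi R +++ \<gamma>)"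
    using winding_rsemi_join[OF R g im] by simp
  hence ci: "(\<lambda>w. h w / w) contour_integrable_on (rsemi R +++ \<gamma>)"
    by (auto simp: contour_integrable_on_def)
  show 1: "(\<lambda>w. h w / w) contour_integrable_on rsemi R"
    using contour_integrable_joinD1[OF ci r(1)] .
  show 2: "(\<lambda>w. h w / w) contour_integrable_on \<gamma>"
    using contour_integrable_joinD2[OF ci g(1)] .
  show "contour_integral (rsemi R) (\<lambda>w. h w / w) + contour_integral \<gamma> (\<lambda>w. h w / w)
           = 2 * of_real pi * \<i> * h 0"
    using contour_integral_unique[OF *] contour_integral_join[OF 1 2 r(1) g(1)] by simp
qed

text \<open>
  On the circle \<open>1 / z = cnj z / R\<^sup>2\<close>, which makes Newman's kernel vanish to first order at the
  imaginary axis. This cancels the factor \<open>1 / \<bar>Re z\<bar>\<close> in the bounds for the partial sums and the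
  tails.
\<close>
lemma kernel_norm:
  assumes "norm z = R" "R > 0"
  shows "norm ((1 + z\<^sup>2 / of_real (R\<^sup>2)) / z) = 2 * \<bar>Re z\<bar> / R\<^sup>2"
proof -
  have z0: "z \<noteq> 0" using assms by auto
  have "z * cnj z = of_real (R\<^sup>2)" using assms by (simp add: complex_norm_square[symmetric])
  hence "(1 + z\<^sup>2 / of_real (R\<^sup>2)) / z = (cnj z + z) / of_real (R\<^sup>2)"
    using z0 assms by (simp add: field_simps power2_eq_square)
  also have "cnj z + z = of_real (2 * Re z)" by (simp add: complex_eq_iff)
  finally have "norm ((1 + z\<^sup>2 / of_real (R\<^sup>2)) / z) = norm (complex_of_real (2 * Re z / R\<^sup>2))"
    by simp
  also have "\<dots> = 2 * \<bar>Re z\<bar> / R\<^sup>2" by (simp only: norm_of_real) (simp add: abs_mult)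
  finally show ?thesis .
qed


lemma newman_right_bound:
  fixes c :: "nat \<Rightarrow> complex"
  assumes K: "\<And>n. n \<ge> 1 \<Longrightarrow> norm (c n) \<le> K / real n" "K \<ge> 0"
    and g: "(\<lambda>n. c n * of_nat n powr (-z)) sums g" and z: "Re z > 0" and N: "N \<ge> 1"
  shows "norm (g - (\<Sum>n\<le>N. c n * of_nat n powr (-z))) \<le> K * (real N powr (- Re z) / Re z)"
proof -
  let ?S = "\<lambda>M. \<Sum>n\<le>M. c n * of_nat n powr (-z)"
  have "?S \<longlonglongrightarrow> g" using g by (simp add: sums_def_le)
  hence "(\<lambda>M. ?S M - ?S N) \<longlonglongrightarrow> g - ?S N" by (intro tendsto_intros)
  moreover have "eventually (\<lambda>M. norm (?S M - ?S N) \<le> K * (real N powr (- Re z) / Re z)) sequentially"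
    using eventually_ge_at_top[of N]
  proof eventually_elim
    case (elim M)
    have "?S M - ?S N = (\<Sum>n=Suc N..M. c n * of_nat n powr (-z))"
    proof -
      have "{..M} = {..N} \<union> {Suc N..M}" using elim by auto
      hence "?S M = ?S N + (\<Sum>n=Suc N..M. c n * of_nat n powr (-z))"
        by (simp only:) (rule sum.union_disjoint, auto)
      thus ?thesis by simp
    qed
    also have "norm \<dots> \<le> (\<Sum>n=Suc N..M. K * real n powr (-1 - Re z))"
    proof (rule sum_norm_le)
      fix n assume n: "n \<in> {Suc N..M}"
      have "norm (c n * of_nat n powr (-z)) \<le> (K / real n) * real n powr (-Re z)"
        unfolding norm_mult norm_nat_powr using K(1)[of n] K(2) n by (intro mult_mono) auto
      also have "\<dots> = K * real n powr (-1 - Re z)"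
        using n by (simp add: powr_diff powr_minus field_simps)
      finally show "norm (c n * of_nat n powr (-z)) \<le> \<dots>" .
    qed
    also have "\<dots> = K * (\<Sum>n=Suc N..M. real n powr (-1 - Re z))" by (simp add: sum_distrib_left)
    also have "\<dots> \<le> K * (real N powr (- Re z) / Re z)"
      using z N elim K by (intro mult_left_mono sum_powr_tail_le) auto
    finally show ?case .
  qed
  ultimately show ?thesis by (rule Lim_norm_ubound[OF sequentially_bot])
qed

lemma newman_left_bound:
  fixes c :: "nat \<Rightarrow> complex"
  assumes K: "\<And>n. n \<ge> 1 \<Longrightarrow> norm (c n) \<le> K / real n" "K \<ge> 0"
    and z: "Re z < 0" and N: "N \<ge> 1"
  shows "norm (\<Sum>n\<le>N. c n * of_nat n powr (-z)) \<le> K * (real N powr (-Re z) * (1 / \<bar>Re z\<bar> + 1 / real N))"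
proof -
  have "(\<Sum>n\<le>N. c n * of_nat n powr (-z)) = (\<Sum>n=1..N. c n * of_nat n powr (-z))"
    by (rule sum.mono_neutral_right) (auto simp: not_le)
  also have "norm \<dots> \<le> (\<Sum>n=1..N. K * real n powr (-Re z - 1))"
  proof (rule sum_norm_le)
    fix n assume n: "n \<in> {1..N}"
    have "norm (c n * of_nat n powr (-z)) \<le> (K / real n) * real n powr (-Re z)"
      unfolding norm_mult norm_nat_powr using K(1)[of n] K(2) n by (intro mult_mono) auto
    also have "\<dots> = K * real n powr (-Re z - 1)"
      using n by (simp add: powr_diff)
    finally show "norm (c n * of_nat n powr (-z)) \<le> \<dots>" .
  qed
  also have "\<dots> = K * (\<Sum>n=1..N. real n powr (-Re z - 1))" by (simp add: sum_distrib_left)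
  also have "\<dots> \<le> K * (real N powr (-Re z) / (-Re z) + real N powr (-Re z - 1))"
    using z N K by (intro mult_left_mono sum_powr_le) auto
  also have "real N powr (-Re z) / (-Re z) + real N powr (-Re z - 1)
               = real N powr (-Re z) * (1 / \<bar>Re z\<bar> + 1 / real N)"
    using z N by (simp add: powr_diff algebra_simps)
  finally show ?thesis .
qed

text \<open>
  The left half of the contour for the continued function may be any path on which the function is
  holomorphic; two sides of a triangle with vertex \<open>- d\<close> suffice. On them \<open>N powr z\<close> decays
  exponentially away from the imaginary axis, with a rate proportional to \<open>ln N\<close>.
\<close>
lemma newman_triangle_bound:
  assumes R: "R > 0" and d: "d > 0" and V: "open V" "convex V"
    "closed_segment (\<i> * of_real R) (- of_real d) \<subseteq> V" "closed_segment (- of_real d) (- (\<i> * of_real R)) \<subseteq> V"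
    and h: "h holomorphic_on V"
  obtains C where "C \<ge> 0" "\<And>N. N \<ge> 2 \<Longrightarrow> norm (contour_integral
     (linepath (\<i> * of_real R) (- of_real d) +++ linepath (- of_real d) (- (\<i> * of_real R)))
     (\<lambda>z. h z * of_nat N powr z / z)) \<le> C / ln (real N)"
proof -
  let ?a = "\<i> * complex_of_real R" and ?m = "- complex_of_real d"
  define T where "T = closed_segment ?a ?m \<union> closed_segment ?m (- ?a)"
  have Re: "Re (linepath ?a ?m t) = - d * t" "Re (linepath ?m (-?a) t) = - d * (1 - t)" for t
    by (auto simp: linepath_def algebra_simps)
  have nz: "0 \<notin> T"
  proof
    assume "0 \<in> T"
    then obtain t where "linepath ?a ?m t = 0 \<or> linepath ?m (-?a) t = 0"
      unfolding T_def linepath_image_01[symmetric] by (metis UnE imageE)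
    thus False using R d by (auto simp: linepath_def complex_eq_iff)
  qed
  have "continuous_on T (\<lambda>z. h z / z)"
    using nz V by (intro continuous_intros holomorphic_on_imp_continuous_on holomorphic_on_subset[OF h])
      (auto simp: T_def)
  moreover have "compact T" by (auto simp: T_def)
  ultimately have "bounded ((\<lambda>z. h z / z) ` T)"
    by (intro compact_imp_bounded compact_continuous_image)
  then obtain B where B: "B > 0" "\<And>z. z \<in> T \<Longrightarrow> norm (h z / z) \<le> B"
    by (auto simp: bounded_pos)
  define L where "L = norm (?m - ?a)"
  have L: "norm (- ?a - ?m) = L" unfolding L_def by (simp add: cmod_def)
  show ?thesis
  proof (rule that[of "2 * B * L / d"])
    show "2 * B * L / d \<ge> 0" using B d by (simp add: L_def)
    fix N :: nat assume N: "N \<ge> 2"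
    let ?f = "\<lambda>z. h z * of_nat N powr z / z"
    have lnN: "ln (real N) > 0" using N by simp
    have ex: "exp (- (d * ln (real N)) * t) = real N powr (- d * t)" for t
      using N by (simp add: powr_def mult_ac)
    have cont: "continuous_on T ?f"
      using nz V by (intro continuous_intros holomorphic_on_imp_continuous_on
          holomorphic_on_subset[OF h] holomorphic_intros) (auto simp: T_def)
    have bd: "norm (?f z) \<le> B * real N powr Re z" if "z \<in> T" for z
    proof -
      have "norm (?f z) = norm (h z / z) * real N powr Re z"
        by (simp add: norm_mult norm_divide norm_nat_powr)
      thus ?thesis using B(2)[OF that] by (simp add: mult_right_mono)
    qed
    have i1: "?f contour_integrable_on linepath ?a ?m"
      by (intro contour_integrable_continuous_linepath continuous_on_subset[OF cont]) (auto simp: T_def)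
    have i2: "?f contour_integrable_on linepath ?m (-?a)"
      by (intro contour_integrable_continuous_linepath continuous_on_subset[OF cont]) (auto simp: T_def)
    have i3: "?f contour_integrable_on linepath (-?a) ?m"
      by (intro contour_integrable_continuous_linepath continuous_on_subset[OF cont])
         (auto simp: T_def closed_segment_commute)
    have b1: "norm (contour_integral (linepath ?a ?m) ?f) \<le> B * norm (?m - ?a) / (d * ln (real N))"
    proof (rule contour_integral_linepath_exp_bound[OF i1])
      fix t :: real assume t: "0 \<le> t" "t \<le> 1"
      have "linepath ?a ?m t \<in> T" using t by (auto simp: T_def linepath_in_path)
      from bd[OF this] show "norm (?f (linepath ?a ?m t)) \<le> B * exp (- (d * ln (real N)) * t)"
        unfolding ex Re .
    qed (use d lnN in auto)
    have b2: "norm (contour_integral (linepath (-?a) ?m) ?f) \<le> B * norm (?m - (-?a)) / (d * ln (real N))"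
    proof (rule contour_integral_linepath_exp_bound[OF i3])
      fix t :: real assume t: "0 \<le> t" "t \<le> 1"
      have e: "linepath (-?a) ?m t = linepath ?m (-?a) (1 - t)" by (simp add: linepath_def algebra_simps)
      have "linepath ?m (-?a) (1 - t) \<in> T" using t by (auto simp: T_def linepath_in_path)
      from bd[OF this] show "norm (?f (linepath (-?a) ?m t)) \<le> B * exp (- (d * ln (real N)) * t)"
        unfolding ex Re e by simp
    qed (use d lnN in auto)
    have "contour_integral (linepath ?m (-?a)) ?f = - contour_integral (linepath (-?a) ?m) ?f"
      by (rule contour_integral_reverse_linepath) (auto intro!: continuous_on_subset[OF cont] simp: T_def)
    moreover have "contour_integral (linepath ?a ?m +++ linepath ?m (-?a)) ?f
       = contour_integral (linepath ?a ?m) ?f + contour_integral (linepath ?m (-?a)) ?f"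
      using i1 i2 by (intro contour_integral_join) auto
    ultimately have "norm (contour_integral (linepath ?a ?m +++ linepath ?m (-?a)) ?f)
       \<le> B * norm (?m - ?a) / (d * ln (real N)) + B * norm (?m - (-?a)) / (d * ln (real N))"
      using b1 b2 by (smt (verit) norm_minus_cancel norm_triangle_ineq)
    also have "norm (?m - (-?a)) = L" using L by (simp add: norm_minus_commute)
    also have "norm (?m - ?a) = L" by (simp add: L_def)
    also have "B * L / (d * ln (real N)) + B * L / (d * ln (real N)) = 2 * B * L / d / ln (real N)"
      using d lnN by (simp add: field_simps)
    finally show "norm (contour_integral (linepath ?a ?m +++ linepath ?m (-?a)) ?f) \<le> 2 * B * L / d / ln (real N)" .
  qed
qed


text \<open>
  Newman's theorem. Let \<open>S\<close> be the partial sum up to \<open>N\<close>. Cauchy's formula with the kernel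
  \<open>N powr z * (1 / z + z / R\<^sup>2)\<close> represents \<open>g 0\<close> by a contour of which the left part is the triangle,
  and \<open>S 0\<close> by the full circle, as \<open>S\<close> is entire. The difference of the two consists of an integral
  of \<open>g - S\<close> over the right half circle, of size \<open>O(1 / R)\<close>, one of \<open>S\<close> over the left half circle,
  of size \<open>O(1 / R + 1 / N)\<close>, and one over the triangle that tends to \<open>0\<close> as \<open>N\<close> grows.
\<close>
theorem newman_at_0:
  fixes c :: "nat \<Rightarrow> complex"
  assumes K: "\<And>n. n \<ge> 1 \<Longrightarrow> norm (c n) \<le> K / real n" "K \<ge> 0"
    and U: "open U" "{z. Re z \<ge> 0} \<subseteq> U" and g: "g holomorphic_on U"
    and sums: "\<And>z. Re z > 0 \<Longrightarrow> (\<lambda>n. c n * of_nat n powr (-z)) sums g z"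
  shows "(\<lambda>N. \<Sum>n=1..N. c n) \<longlonglongrightarrow> g 0"
proof (rule LIMSEQ_I)
  fix \<epsilon> :: real assume \<epsilon>: "\<epsilon> > 0"
  \<comment> \<open>The two half circles together contribute \<open>2 * K / R\<close>, which has to be below \<open>\<epsilon> / 2\<close>.\<close>
  define R where "R = 8 * (K + 1) / \<epsilon>"
  have R: "R > 0" using K \<epsilon> by (simp add: R_def)
  let ?a = "\<i> * complex_of_real R"
  define A where "A = closed_segment (\<i> * complex_of_real (-(R + 1))) (\<i> * complex_of_real (R + 1))"
  have A_iff: "\<i> * of_real y \<in> A" if "\<bar>y\<bar> \<le> R + 1" for y
  proof -
    define q where "q = (y + R + 1) / (2 * (R + 1))"
    have q: "q * (2 * (R + 1)) = y + R + 1" using R by (simp add: q_def)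
    have q01: "q \<in> {0..1}" using that R by (auto simp: q_def divide_simps)
    have "\<i> * complex_of_real y = linepath (\<i> * complex_of_real (-(R + 1))) (\<i> * complex_of_real (R + 1)) q"
      using q by (simp add: linepath_def complex_eq_iff algebra_simps)
    also have "\<dots> \<in> A" unfolding A_def using q01 by (intro linepath_in_path)
    finally show ?thesis .
  qed
  have "A \<subseteq> U"
  proof
    fix z assume "z \<in> A"
    then obtain t where "z = linepath (\<i> * complex_of_real (-(R + 1))) (\<i> * complex_of_real (R + 1)) t"
      unfolding A_def linepath_image_01[symmetric] by blast
    hence "Re z = 0" by (simp add: linepath_def)
    thus "z \<in> U" using U by auto
  qed
  moreover have "compact A" by (simp add: A_def)
  ultimately obtain e where e: "e > 0" "(\<Union>x\<in>A. ball x e) \<subseteq> U"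
    using compact_subset_open_imp_ball_epsilon_subset[of A U] U by metis
  \<comment> \<open>A convex neighbourhood of the whole contour on which \<open>g\<close> is holomorphic: to the left of the
      imaginary axis it stays within \<open>e\<close> of the compact segment \<open>A\<close>.\<close>
  define V where "V = {z. Re z > -e} \<inter> ({z. Im z < R + 1} \<inter> {z. Im z > -(R + 1)})"
  have V: "open V" "convex V" "0 \<in> V"
    using e R unfolding V_def
    by (auto intro!: open_Int convex_Int open_halfspace_Re_gt open_halfspace_Im_lt open_halfspace_Im_gt
         convex_halfspace_Re_gt convex_halfspace_Im_lt convex_halfspace_Im_gt)
  have VU: "V \<subseteq> U"
  proof
    fix z assume z: "z \<in> V"
    show "z \<in> U"
    proof (cases "Re z \<ge> 0")
      case False
      have "\<i> * of_real (Im z) \<in> A" using z by (intro A_iff) (auto simp: V_def)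
      moreover have "dist (\<i> * of_real (Im z)) z = \<bar>Re z\<bar>" by (simp add: dist_norm cmod_def)
      ultimately have "z \<in> (\<Union>x\<in>A. ball x e)" using z False by (auto simp: V_def intro!: bexI[of _ "\<i> * of_real (Im z)"])
      thus ?thesis using e by blast
    qed (use U in auto)
  qed
  define d where "d = e / 2"
  have d: "d > 0" "d < e" using e by (auto simp: d_def)
  let ?m = "- complex_of_real d"
  have pts: "?a \<in> V" "-?a \<in> V" "?m \<in> V" using d e R by (auto simp: V_def)
  have seg: "closed_segment ?a ?m \<subseteq> V" "closed_segment ?m (-?a) \<subseteq> V"
    using pts V by (auto intro: closed_segment_subset[THEN subsetD])
  let ?tri = "linepath ?a ?m +++ linepath ?m (-?a)"
  define w where "w = (\<lambda>z. 1 + z\<^sup>2 / complex_of_real (R\<^sup>2))"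
  have w: "w holomorphic_on X" for X unfolding w_def using R by (intro holomorphic_intros) auto
  have gV: "g holomorphic_on V" using g VU holomorphic_on_subset by blast
  have gw: "(\<lambda>z. g z * w z) holomorphic_on V" by (intro holomorphic_intros gV w)
  obtain C where C: "C \<ge> 0" "\<And>N. N \<ge> 2 \<Longrightarrow> norm (contour_integral ?tri
     (\<lambda>z. g z * w z * of_nat N powr z / z)) \<le> C / ln (real N)"
    using newman_triangle_bound[OF R d(1) V(1,2) seg gw] by blast
  have tri_im: "\<not> (Re z \<ge> 0 \<and> Im z = 0)" if "z \<in> path_image ?tri" for z
  proof -
    have "z \<in> closed_segment ?a ?m \<or> z \<in> closed_segment ?m (-?a)" using that by (auto simp: path_image_join)
    then obtain t where t: "0 \<le> t" "t \<le> 1" "z = linepath ?a ?m t \<or> z = linepath ?m (-?a) t"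
      unfolding linepath_image_01[symmetric] by auto
    have "t = 1" if "z = linepath ?a ?m t" "Im z = 0" using that R by (auto simp: linepath_def)
    moreover have "t = 0" if "z = linepath ?m (-?a) t" "Im z = 0" using that R by (auto simp: linepath_def)
    ultimately show ?thesis using t d by (auto simp: linepath_def)
  qed
  have tri: "valid_path ?tri" "pathstart ?tri = ?a" "pathfinish ?tri = -?a" "path_image ?tri \<subseteq> V"
    using seg by (auto intro!: valid_path_join simp: path_image_join)
  note r = rsemi_simps[OF R] and l = lsemi_simps[OF R]
  have rV: "path_image (rsemi R) \<subseteq> V"
  proof
    fix z assume "z \<in> path_image (rsemi R)"
    from r(4)[OF this] have "norm z = R" "Re z \<ge> 0" by auto
    thus "z \<in> V" using abs_Im_le_cmod[of z] e by (auto simp: V_def)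
  qed
  have l_im: "\<not> (Re z \<ge> 0 \<and> Im z = 0)" if "z \<in> path_image (lsemi R)" for z
    using l(4)[OF that] R by (auto simp: cmod_def)
  let ?S = "\<lambda>N z. \<Sum>n\<le>N. c n * of_nat n powr (-z)"
  have key: "norm ((\<Sum>n=1..N. c n) - g 0) \<le> 2 * K / R + K / real N + C / (2 * pi * ln (real N))"
    if N: "N \<ge> 2" for N
  proof -
    define h1 where "h1 = (\<lambda>z. g z * w z * of_nat N powr z)"
    define h2 where "h2 = (\<lambda>z. ?S N z * w z * of_nat N powr z)"
    have h1: "h1 holomorphic_on V" unfolding h1_def by (intro holomorphic_intros gV w)
    have h2: "h2 holomorphic_on UNIV" unfolding h2_def by (intro holomorphic_intros w)
    note c1 = cauchy_rsemi_join[OF R tri(1-3) tri_im V rV tri(4) h1]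
    note c2 = cauchy_rsemi_join[OF R l(1-3) l_im open_UNIV convex_UNIV UNIV_I subset_UNIV subset_UNIV h2]
    have S0: "?S N 0 = (\<Sum>n=1..N. c n)"
    proof -
      have "?S N 0 = (\<Sum>n=1..N. c n * of_nat n powr 0)"
        by (rule sum.mono_neutral_cong_right) (auto simp: not_le)
      also have "\<dots> = (\<Sum>n=1..N. c n)" by (rule sum.cong) auto
      finally show ?thesis .
    qed
    have h0: "h1 0 = g 0" "h2 0 = (\<Sum>n=1..N. c n)"
      using N S0 by (simp_all add: h1_def h2_def w_def)
    define I1 where "I1 = contour_integral (rsemi R) (\<lambda>z. h1 z / z - h2 z / z)"
    define I2 where "I2 = contour_integral ?tri (\<lambda>z. h1 z / z)"
    define I3 where "I3 = contour_integral (lsemi R) (\<lambda>z. h2 z / z)"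
    have ci: "(\<lambda>z. h1 z / z - h2 z / z) contour_integrable_on rsemi R"
      by (intro contour_integrable_diff c1 c2)
    have "I1 = contour_integral (rsemi R) (\<lambda>z. h1 z / z) - contour_integral (rsemi R) (\<lambda>z. h2 z / z)"
      unfolding I1_def by (intro contour_integral_diff c1 c2)
    moreover have "2 * of_real pi * \<i> * g 0 = contour_integral (rsemi R) (\<lambda>z. h1 z / z) + I2"
      using c1(1) by (simp only: I2_def h0)
    moreover have "2 * of_real pi * \<i> * (\<Sum>n=1..N. c n) = contour_integral (rsemi R) (\<lambda>z. h2 z / z) + I3"
      using c2(1) by (simp only: I3_def h0)
    ultimately have eq: "2 * of_real pi * \<i> * (g 0 - (\<Sum>n=1..N. c n)) = I1 + I2 - I3"
      by (simp only: right_diff_distrib) (simp only: algebra_simps)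
    have kn: "norm (w z / z) = 2 * \<bar>Re z\<bar> / R\<^sup>2" if "norm z = R" for z
      using kernel_norm[OF that R] by (simp add: w_def)
    have b1: "norm I1 \<le> (2 * K / R\<^sup>2) * R * (pi / 2 - (- pi / 2))"
      unfolding I1_def rsemi_def
    proof (rule contour_integral_bound_part_circlepath_strong[where k = "{\<i> * of_real R, - (\<i> * of_real R)}"])
      show "(\<lambda>z. h1 z / z - h2 z / z) contour_integrable_on part_circlepath 0 R (- pi / 2) (pi / 2)"
        using ci by (simp add: rsemi_def)
      fix z assume z: "z \<in> path_image (part_circlepath 0 R (- pi / 2) (pi / 2)) - {\<i> * of_real R, - (\<i> * of_real R)}"
      hence zz: "norm z = R" "Re z \<ge> 0" using r(4)[of z] by (auto simp: rsemi_def)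
      have "Re z \<noteq> 0"
      proof
        assume 0: "Re z = 0"
        hence "\<bar>Im z\<bar> = R" using zz by (simp add: cmod_def)
        hence "z = \<i> * of_real R \<or> z = - (\<i> * of_real R)" using 0 by (auto simp: complex_eq_iff abs_if split: if_splits)
        thus False using z by auto
      qed
      hence x: "Re z > 0" using zz by simp
      have "norm (h1 z / z - h2 z / z) = norm (g z - ?S N z) * real N powr Re z * norm (w z / z)"
        unfolding norm_nat_powr[symmetric] norm_mult[symmetric] h1_def h2_def
        by (simp add: algebra_simps diff_divide_distrib)
      also have "\<dots> \<le> (K * (real N powr (- Re z) / Re z)) * real N powr Re z * (2 * \<bar>Re z\<bar> / R\<^sup>2)"
        unfolding kn[OF zz(1)] using N x
        by (intro mult_right_mono newman_right_bound[OF K sums]) auto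
      also have "\<dots> = 2 * K / R\<^sup>2" using x N by (simp add: powr_minus field_simps)
      finally show "norm (h1 z / z - h2 z / z) \<le> 2 * K / R\<^sup>2" .
    qed (use R K in auto)
    have b3: "norm I3 \<le> (2 * K / R\<^sup>2 + 2 * K / (R * real N)) * R * (3 * pi / 2 - pi / 2)"
      unfolding I3_def lsemi_def
    proof (rule contour_integral_bound_part_circlepath_strong[where k = "{\<i> * of_real R, - (\<i> * of_real R)}"])
      show "(\<lambda>z. h2 z / z) contour_integrable_on part_circlepath 0 R (pi / 2) (3 * pi / 2)"
        using c2(3) by (simp add: lsemi_def)
      fix z assume z: "z \<in> path_image (part_circlepath 0 R (pi / 2) (3 * pi / 2)) - {\<i> * of_real R, - (\<i> * of_real R)}"
      hence zz: "norm z = R" "Re z \<le> 0" using l(4)[of z] by (auto simp: lsemi_def)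
      have "Re z \<noteq> 0"
      proof
        assume 0: "Re z = 0"
        hence "\<bar>Im z\<bar> = R" using zz by (simp add: cmod_def)
        hence "z = \<i> * of_real R \<or> z = - (\<i> * of_real R)" using 0 by (auto simp: complex_eq_iff abs_if split: if_splits)
        thus False using z by auto
      qed
      hence x: "Re z < 0" using zz by simp
      define y where "y = \<bar>Re z\<bar>"
      have y: "y > 0" "y \<le> R" using x zz abs_Re_le_cmod[of z] by (auto simp: y_def)
      have "norm (h2 z / z) = norm (?S N z) * real N powr Re z * norm (w z / z)"
        unfolding norm_nat_powr[symmetric] norm_mult[symmetric] h1_def h2_def
        by (simp add: algebra_simps)
      also have "\<dots> \<le> (K * (real N powr (- Re z) * (1 / \<bar>Re z\<bar> + 1 / real N))) * real N powr Re z * (2 * \<bar>Re z\<bar> / R\<^sup>2)"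
        unfolding kn[OF zz(1)] using N x
        by (intro mult_right_mono newman_left_bound[OF K]) (auto simp: divide_le_0_iff)
      also have "\<dots> = K * (1 / y + 1 / real N) * (2 * y / R\<^sup>2)"
        using N by (simp add: powr_minus y_def)
      also have "\<dots> = 2 * K / R\<^sup>2 + (2 * K / (R\<^sup>2 * real N)) * y" using y N R by (simp add: field_simps)
      also have "\<dots> \<le> 2 * K / R\<^sup>2 + (2 * K / (R\<^sup>2 * real N)) * R" using y K N by (intro add_left_mono mult_left_mono) auto
      also have "\<dots> = 2 * K / R\<^sup>2 + 2 * K / (R * real N)" using R by (simp add: power2_eq_square)
      finally show "norm (h2 z / z) \<le> 2 * K / R\<^sup>2 + 2 * K / (R * real N)" .
    qed (use R K in auto)
    have b2: "norm I2 \<le> C / ln (real N)" unfolding I2_def h1_def using C(2)[OF N] by simp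
    have "2 * pi * norm ((\<Sum>n=1..N. c n) - g 0) = norm (2 * of_real pi * \<i> * (g 0 - (\<Sum>n=1..N. c n)))"
      by (simp add: norm_mult norm_minus_commute)
    also have "\<dots> \<le> norm I1 + norm I2 + norm I3" unfolding eq
      by (smt (verit) norm_triangle_ineq norm_triangle_ineq4)
    also have "\<dots> \<le> 2 * K / R * pi + C / ln (real N) + (2 * K / R + 2 * K / real N) * pi"
    proof -
      have "(2 * K / R\<^sup>2) * R * (pi / 2 - (- pi / 2)) = 2 * K / R * pi"
        using R by (simp add: power2_eq_square)
      moreover have "(2 * K / R\<^sup>2 + 2 * K / (R * real N)) * R * (3 * pi / 2 - pi / 2)
                       = (2 * K / R + 2 * K / real N) * pi"
        using R N by (simp add: power2_eq_square field_simps)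
      ultimately show ?thesis using b1 b2 b3 by linarith
    qed
    also have "\<dots> = 2 * pi * (2 * K / R + K / real N + C / (2 * pi * ln (real N)))"
      by (simp add: field_simps)
    finally show ?thesis by simp
  qed
  have "(\<lambda>N. 2 * K / R + K / real N + C / (2 * pi * ln (real N))) \<longlonglongrightarrow> 2 * K / R + 0 + 0"
    by (intro tendsto_add tendsto_const) real_asymp+
  moreover have "2 * K / R < \<epsilon>"
    using K(2) \<epsilon> by (simp add: R_def divide_simps)
  ultimately have "eventually (\<lambda>N. 2 * K / R + K / real N + C / (2 * pi * ln (real N)) < \<epsilon>) sequentially"
    by (intro order_tendstoD) auto
  hence "eventually (\<lambda>N. norm ((\<Sum>n=1..N. c n) - g 0) < \<epsilon>) sequentially"
    using eventually_ge_at_top[of 2] by eventually_elim (use key in force)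
  thus "\<exists>no. \<forall>n\<ge>no. norm ((\<Sum>n=1..n. c n) - g 0) < \<epsilon>"
    by (simp add: eventually_sequentially)
qed

section \<open>A Tauberian theorem for Dirichlet series\<close>

corollary newman_at_1:
  fixes b :: "nat \<Rightarrow> complex"
  assumes K: "\<And>n. norm (b n) \<le> K"
    and U: "open U" "{s. Re s \<ge> 1} \<subseteq> U" and f: "f holomorphic_on U"
    and sums: "\<And>s. Re s > 1 \<Longrightarrow> (\<lambda>n. b n * of_nat n powr (-s)) sums f s"
  shows "(\<lambda>N. \<Sum>n=1..N. b n / of_nat n) \<longlonglongrightarrow> f 1"
proof -
  let ?V = "(\<lambda>z. 1 + z) -` U"
  have K0: "K \<ge> 0" using norm_ge_zero K by (rule order_trans)
  have "(\<lambda>N. \<Sum>n=1..N. b n / of_nat n) \<longlonglongrightarrow> (f \<circ> (\<lambda>z. 1 + z)) 0"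
  proof (rule newman_at_0[OF _ K0, of _ ?V])
    show "norm (b n / of_nat n) \<le> K / real n" for n
      using K[of n] by (simp add: norm_divide divide_right_mono)
    show "open ?V" using U(1) by (intro continuous_open_vimage continuous_intros) auto
    show "{z. Re z \<ge> 0} \<subseteq> ?V" by (auto intro!: subsetD[OF U(2)])
    show "(f \<circ> (\<lambda>z. 1 + z)) holomorphic_on ?V"
      by (intro holomorphic_on_compose_gen[OF _ f] holomorphic_intros) auto
    fix z :: complex assume z: "Re z > 0"
    have "(\<lambda>n. b n * of_nat n powr (-(1 + z))) sums f (1 + z)" using z by (intro sums) auto
    also have "(\<lambda>n. b n * of_nat n powr (-(1 + z))) = (\<lambda>n. b n / of_nat n * of_nat n powr (-z))"
    proof
      fix n show "b n * of_nat n powr (-(1 + z)) = b n / of_nat n * of_nat n powr (-z)"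
        by (cases "n = 0") (simp_all add: powr_diff powr_minus field_simps powr_add)
    qed
    finally show "(\<lambda>n. b n / of_nat n * of_nat n powr (-z)) sums (f \<circ> (\<lambda>z. 1 + z)) z" by simp
  qed
  thus ?thesis by simp
qed

text \<open>
  If \<open>E N \<ge> \<epsilon> N\<close> for some large \<open>N\<close>, then \<open>E\<close>, which decreases at most with slope \<open>c\<close>, stays above
  \<open>\<epsilon> N / 2\<close> on an interval of length \<open>\<delta> N\<close> to the right of \<open>N\<close>. There the sum of \<open>E n / n\<^sup>2\<close> grows by a
  fixed amount, against the Cauchy criterion. For \<open>E N \<le> - \<epsilon> N\<close> the interval lies to the left.
\<close>
lemma tauberian_monotone_step:
  fixes E :: "nat \<Rightarrow> real"
  assumes mono: "\<And>m n. m \<le> n \<Longrightarrow> E n \<ge> E m - c * real (n - m)" and c: "c \<ge> 0"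
    and conv: "convergent (\<lambda>N. \<Sum>n=1..N. E n / (real n)\<^sup>2)"
  shows "(\<lambda>n. E n / real n) \<longlonglongrightarrow> 0"
proof (rule LIMSEQ_I)
  fix \<epsilon> :: real assume \<epsilon>: "\<epsilon> > 0"
  \<comment> \<open>Over a stretch of length \<open>\<delta> * N\<close> the function \<open>E\<close> can lose at most \<open>c * \<delta> * N \<le> \<epsilon> / 2 * N\<close>; the
      bound \<open>1/2\<close> keeps the stretch between \<open>N / 2\<close> and \<open>2 * N\<close>.\<close>
  define \<delta> where "\<delta> = min (1/2) (\<epsilon> / (2 * (c + 1)))"
  have \<delta>: "\<delta> > 0" "\<delta> \<le> 1/2" "c * \<delta> \<le> \<epsilon> / 2"
  proof -
    show "\<delta> > 0" using \<epsilon> c by (auto simp: \<delta>_def)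
    show "\<delta> \<le> 1/2" unfolding \<delta>_def by (rule min.cobounded1)
    have "c * \<delta> \<le> (c + 1) * (\<epsilon> / (2 * (c + 1)))"
      using c \<epsilon> by (intro mult_mono) (auto simp: \<delta>_def)
    also have "\<dots> = \<epsilon> / 2" using c by (simp add: divide_simps)
    finally show "c * \<delta> \<le> \<epsilon> / 2" .
  qed
  let ?T = "\<lambda>N. \<Sum>n=1..N. E n / (real n)\<^sup>2"
  have "Cauchy ?T" using conv by (simp add: Cauchy_convergent_iff)
  moreover have "\<epsilon> * \<delta> / 16 > 0" using \<epsilon> \<delta> by simp
  ultimately obtain M where M: "\<And>m n. m \<ge> M \<Longrightarrow> n \<ge> M \<Longrightarrow> \<bar>?T m - ?T n\<bar> < \<epsilon> * \<delta> / 16"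
    unfolding Cauchy_def dist_real_def by metis
  have Tdiff: "?T n - ?T m = (\<Sum>k\<in>{m<..n}. E k / (real k)\<^sup>2)" if "m \<le> n" for m n
  proof -
    have "{1..n} = {1..m} \<union> {m<..n}" using that by auto
    hence "?T n = ?T m + (\<Sum>k\<in>{m<..n}. E k / (real k)\<^sup>2)"
      by (simp only:) (rule sum.union_disjoint, auto)
    thus ?thesis by simp
  qed
  define N0 where "N0 = max (2 * M + 2) (nat \<lceil>2 / \<delta>\<rceil>)"
  have main: "\<bar>E N\<bar> < \<epsilon> * real N" if N: "N \<ge> N0" for N
  proof -
    have N1: "N \<ge> 2 * M + 2" "real N \<ge> 2 / \<delta>" using N by (auto simp: N0_def)
    define m where "m = nat \<lfloor>\<delta> * real N\<rfloor>"
    have dN: "\<delta> * real N \<ge> 2" using N1 \<delta> by (simp add: field_simps)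
    have m: "real m \<le> \<delta> * real N" "real m \<ge> \<delta> * real N / 2"
      using dN by (simp_all add: m_def) linarith
    have mN: "real m \<le> real N / 2" using m(1) \<delta>(2) mult_right_mono[of \<delta> "1/2" "real N"] by linarith
    have cm: "c * real m \<le> \<epsilon> / 2 * real N"
    proof -
      have "c * real m \<le> c * (\<delta> * real N)" using m c by (intro mult_left_mono)
      also have "\<dots> \<le> \<epsilon> / 2 * real N" using mult_right_mono[OF \<delta>(3), of "real N"] by (simp add: mult.assoc)
      finally show ?thesis .
    qed
    have Np: "real N > 0" using N1 by simp
    have A: "E N < \<epsilon> * real N"
    proof (rule ccontr)
      assume "\<not> E N < \<epsilon> * real N"
      hence EN: "E N \<ge> \<epsilon> * real N" by simp
      have "?T (N + m) - ?T N \<ge> (\<Sum>k\<in>{N<..N+m}. \<epsilon> / (8 * real N))"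
        unfolding Tdiff[OF le_add1]
      proof (rule sum_mono)
        fix k assume k: "k \<in> {N<..N+m}"
        have "c * real (k - N) \<le> c * real m" using k c by (intro mult_left_mono) auto
        hence Ek: "E k \<ge> \<epsilon> / 2 * real N" using mono[of N k] k EN cm by simp
        have k2: "real k \<le> 2 * real N" using k mN by simp
        have kp: "real k > 0" using k by simp
        have "(real k)\<^sup>2 \<le> (2 * real N)\<^sup>2" using k2 by (intro power_mono) auto
        hence "\<epsilon> / (8 * real N) \<le> (\<epsilon> / 2 * real N) / (real k)\<^sup>2"
          using kp Np \<epsilon> by (simp add: field_simps power2_eq_square)
        also have "\<dots> \<le> E k / (real k)\<^sup>2" using Ek by (intro divide_right_mono) auto
        finally show "\<epsilon> / (8 * real N) \<le> E k / (real k)\<^sup>2" .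
      qed
      also have "(\<Sum>k\<in>{N<..N+m}. \<epsilon> / (8 * real N)) = real m * \<epsilon> / (8 * real N)" by simp
      also have "real m * \<epsilon> / (8 * real N) \<ge> (\<delta> * real N / 2) * \<epsilon> / (8 * real N)"
        using m Np \<epsilon> by (intro divide_right_mono mult_right_mono) auto
      finally have "?T (N + m) - ?T N \<ge> \<epsilon> * \<delta> / 16" using Np by (simp add: mult_ac)
      moreover have "\<bar>?T (N + m) - ?T N\<bar> < \<epsilon> * \<delta> / 16" using N1 by (intro M) auto
      ultimately show False by linarith
    qed
    have B: "E N > - (\<epsilon> * real N)"
    proof (rule ccontr)
      assume "\<not> E N > - (\<epsilon> * real N)"
      hence EN: "E N \<le> - (\<epsilon> * real N)" by simp
      have mN': "m \<le> N" using mN Np by linarith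
      have "?T N - ?T (N - m) \<le> (\<Sum>k\<in>{N-m<..N}. - (\<epsilon> / (8 * real N)))"
        unfolding Tdiff[OF diff_le_self]
      proof (rule sum_mono)
        fix k assume k: "k \<in> {N-m<..N}"
        have "c * real (N - k) \<le> c * real m" using k c by (intro mult_left_mono) auto
        hence Ek: "E k \<le> - (\<epsilon> / 2 * real N)" using mono[of k N] k EN cm by simp
        have kp: "real k > 0" using k by simp
        have "(real k)\<^sup>2 \<le> (2 * real N)\<^sup>2" using k by (intro power_mono) auto
        hence "\<epsilon> / (8 * real N) \<le> (\<epsilon> / 2 * real N) / (real k)\<^sup>2"
          using kp Np \<epsilon> by (simp add: field_simps power2_eq_square)
        also have "\<dots> \<le> - E k / (real k)\<^sup>2" using Ek by (intro divide_right_mono) auto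
        finally show "E k / (real k)\<^sup>2 \<le> - (\<epsilon> / (8 * real N))" by simp
      qed
      also have "(\<Sum>k\<in>{N-m<..N}. - (\<epsilon> / (8 * real N))) = - (real m * \<epsilon> / (8 * real N))"
        using mN' by simp
      finally have "real m * \<epsilon> / (8 * real N) \<le> ?T (N - m) - ?T N" by simp
      moreover have "real m * \<epsilon> / (8 * real N) \<ge> (\<delta> * real N / 2) * \<epsilon> / (8 * real N)"
        using m Np \<epsilon> by (intro divide_right_mono mult_right_mono) auto
      moreover have "(\<delta> * real N / 2) * \<epsilon> / (8 * real N) = \<epsilon> * \<delta> / 16" using Np by simp
      moreover have "real (N - m) \<ge> real M" using mN mN' N1 by (simp add: of_nat_diff)
      hence "\<bar>?T (N - m) - ?T N\<bar> < \<epsilon> * \<delta> / 16" using N1 by (intro M) auto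
      ultimately show False by linarith
    qed
    show ?thesis using A B by linarith
  qed
  show "\<exists>no. \<forall>n\<ge>no. norm (E n / real n - 0) < \<epsilon>"
  proof (intro exI[of _ "N0"] allI impI)
    fix n assume n: "n \<ge> N0"
    hence "n > 0" by (simp add: N0_def)
    thus "norm (E n / real n - 0) < \<epsilon>" using main[OF n] by (simp add: abs_divide field_simps)
  qed
qed

lemma abel_powr:
  fixes e :: "nat \<Rightarrow> complex"
  defines "S \<equiv> (\<lambda>n. \<Sum>k=1..n. e k)"
  shows "(\<Sum>n=1..N. e n * of_nat n powr (-s))
    = (\<Sum>n=1..N. S n * (of_nat n powr (-s) - of_nat (Suc n) powr (-s))) + S N * of_nat (Suc N) powr (-s)"
  by (induction N) (simp_all add: S_def algebra_simps)

lemma sums_Suc_from_atLeast1: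
  fixes f :: "nat \<Rightarrow> 'a::real_normed_vector"
  shows "(\<lambda>n. f (Suc n)) sums x \<longleftrightarrow> (\<lambda>N. \<Sum>n=1..N. f n) \<longlonglongrightarrow> x"
proof -
  have "(\<Sum>n<N. f (Suc n)) = (\<Sum>n=1..N. f n)" for N
    by (induction N) auto
  thus ?thesis by (simp add: sums_def)
qed

lemma sums_from_atLeast1:
  fixes f :: "nat \<Rightarrow> 'a::real_normed_vector"
  assumes "f 0 = 0"
  shows "f sums x \<longleftrightarrow> (\<lambda>N. \<Sum>n=1..N. f n) \<longlonglongrightarrow> x"
  using sums_Suc_iff[of f x] assms by (simp add: sums_Suc_from_atLeast1)

text \<open>
  Let \<open>D(s)\<close> be the Dirichlet series with the bounded coefficients \<open>E n / n\<close>. Summation by parts gives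
  \<open>J(s) = \<Sum>n. E n * (n powr - s - (n + 1) powr - s)\<close>, and replacing the differences by derivatives
  turns the right-hand side into \<open>s * D(s) + R(s)\<close> with \<open>R\<close> holomorphic for \<open>Re s > 0\<close>. Hence \<open>D\<close>
  continues as far as \<open>J\<close> does, Newman's theorem makes \<open>\<Sum>n. E n / n\<^sup>2\<close> converge, and the
  nonnegativity of \<open>a\<close> gives \<open>E n = o(n)\<close>.
\<close>
theorem tauberian:
  fixes a :: "nat \<Rightarrow> real" and c K :: real
  defines "E \<equiv> (\<lambda>n. \<Sum>k=1..n. a k - c)"
  assumes a: "\<And>n. a n \<ge> 0" and c: "c \<ge> 0" and K: "\<And>n. \<bar>E n\<bar> \<le> K * real n"
    and U: "open U" "{s. Re s \<ge> 1} \<subseteq> U" and J: "J holomorphic_on U"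
    and sums: "\<And>s. Re s > 1 \<Longrightarrow> (\<lambda>n. of_real (a n - c) * of_nat n powr (-s)) sums J s"
  shows "(\<lambda>n. E n / real n) \<longlonglongrightarrow> 0"
proof (rule tauberian_monotone_step[OF _ c])
  show "E n \<ge> E m - c * real (n - m)" if "m \<le> n" for m n
  proof -
    have "{1..n} = {1..m} \<union> {m<..n}" using that by auto
    hence "E n = E m + (\<Sum>k\<in>{m<..n}. a k - c)"
      unfolding E_def by (simp only:) (rule sum.union_disjoint, auto)
    moreover have "(\<Sum>k\<in>{m<..n}. a k - c) \<ge> (\<Sum>k\<in>{m<..n}. - c)" using a by (intro sum_mono) auto
    ultimately show ?thesis by (simp add: mult.commute)
  qed
  have K0: "K \<ge> 0" using K[of 1] by simp
  define R where "R = (\<lambda>s. \<Sum>n. of_real (E (Suc n)) * powr_rem (Suc n) s)"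
  have bd: "norm (of_real (E (Suc n)) * powr_rem (Suc n) s) \<le> K * (1 + norm s)\<^sup>2 * real (Suc n) powr (-1 - Re s)"
    if s: "Re s > 0" for n s
  proof -
    have "norm (of_real (E (Suc n)) * powr_rem (Suc n) s)
            \<le> (K * real (Suc n)) * (norm s * norm (s + 1) * real (Suc n) powr (- Re s - 2))"
      unfolding norm_mult norm_of_real using s by (intro mult_mono K powr_rem_bound) (auto intro: mult_nonneg_nonneg K0)
    also have "\<dots> = K * (norm s * norm (s + 1)) * (real (Suc n) * real (Suc n) powr (- Re s - 2))" by (simp only: mult_ac)
    also have "real (Suc n) * real (Suc n) powr (- Re s - 2) = real (Suc n) powr (-1 - Re s)"
      using powr_mult_base[of "real (Suc n)" "- Re s - 2"] by simp
    also have "K * (norm s * norm (s + 1)) * real (Suc n) powr (-1 - Re s) \<le> K * ((1 + norm s) * (1 + norm s)) * real (Suc n) powr (-1 - Re s)"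
      using norm_triangle_ineq[of s 1] K0 by (intro mult_right_mono mult_left_mono mult_mono) auto
    finally show ?thesis by (simp add: power2_eq_square)
  qed
  have th: "(\<lambda>s. of_real (E (Suc n)) * powr_rem (Suc n) s) holomorphic_on {s. Re s > 0}" for n
    by (intro holomorphic_intros)
  have R: "R holomorphic_on {s. Re s > 0}"
    and Rsum: "\<And>s. Re s > 0 \<Longrightarrow> summable (\<lambda>n. of_real (E (Suc n)) * powr_rem (Suc n) s)"
    using series_holomorphic_halfplane[OF th K0 bd] by (simp_all add: R_def)
  define f where "f = (\<lambda>s. (J s - R s) / s)"
  have fhol: "f holomorphic_on (U \<inter> {s. Re s > 0})"
    unfolding f_def by (intro holomorphic_intros holomorphic_on_subset[OF J] holomorphic_on_subset[OF R]) auto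
  define b where "b = (\<lambda>n. complex_of_real (E n / real n))"
  have fsums: "(\<lambda>n. b n * of_nat n powr (-s)) sums f s" if s: "Re s > 1" for s
  proof -
    have s0: "s \<noteq> 0" "Re s > 0" using s by auto
    have E_of: "(\<Sum>k=1..n. complex_of_real (a k - c)) = of_real (E n)" for n by (simp add: E_def)
    have "(\<lambda>N. \<Sum>n=1..N. of_real (a n - c) * of_nat n powr (-s)) \<longlonglongrightarrow> J s"
      using sums[OF s] by (subst (asm) sums_from_atLeast1) auto
    moreover have "(\<lambda>N. of_real (E N) * of_nat (Suc N) powr (-s)) \<longlonglongrightarrow> 0"
    proof (rule Lim_null_comparison)
      have "norm (of_real (E N) * of_nat (Suc N) powr (-s)) \<le> K * real (Suc N) powr (1 - Re s)" for N
      proof -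
        have "norm (of_real (E N) * of_nat (Suc N) powr (-s)) \<le> (K * real N) * real (Suc N) powr (- Re s)"
          unfolding norm_mult norm_nat_powr norm_of_real using K[of N] by (intro mult_mono) auto
        also have "\<dots> \<le> (K * real (Suc N)) * real (Suc N) powr (- Re s)"
          using K0 by (intro mult_right_mono mult_left_mono) auto
        also have "\<dots> = K * real (Suc N) powr (1 - Re s)"
          using powr_mult_base[of "real (Suc N)" "- Re s"] by simp
        finally show ?thesis .
      qed
      thus "\<forall>\<^sub>F N in sequentially. norm (of_real (E N) * of_nat (Suc N) powr (-s)) \<le> K * real (Suc N) powr (1 - Re s)"
        by simp
      show "(\<lambda>N. K * real (Suc N) powr (1 - Re s)) \<longlonglongrightarrow> 0" using s by real_asymp
    qed
    ultimately have "(\<lambda>N. (\<Sum>n=1..N. of_real (a n - c) * of_nat n powr (-s)) - of_real (E N) * of_nat (Suc N) powr (-s)) \<longlonglongrightarrow> J s - 0"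
      by (rule tendsto_diff)
    hence "(\<lambda>N. (\<Sum>n=1..N. of_real (E n) * (of_nat n powr (-s) - of_nat (Suc n) powr (-s)))) \<longlonglongrightarrow> J s"
      unfolding abel_powr E_of by simp
    hence 1: "(\<lambda>n. of_real (E (Suc n)) * (of_nat (Suc n) powr (-s) - of_nat (Suc (Suc n)) powr (-s))) sums J s"
      by (subst sums_Suc_from_atLeast1)
    have "(\<lambda>n. of_real (E (Suc n)) * powr_rem (Suc n) s) sums R s"
      using Rsum[OF s0(2)] by (simp add: R_def summable_sums)
    from sums_diff[OF 1 this] have "(\<lambda>n. of_real (E (Suc n)) * (s * of_nat (Suc n) powr (-s - 1))) sums (J s - R s)"
      by (simp add: powr_rem_def algebra_simps)
    from sums_divide[OF this, of s] have "(\<lambda>n. of_real (E (Suc n)) * of_nat (Suc n) powr (-s - 1)) sums f s"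
      using s0 by (simp add: f_def)
    also have "(\<lambda>n. of_real (E (Suc n)) * of_nat (Suc n) powr (-s - 1)) = (\<lambda>n. b (Suc n) * of_nat (Suc n) powr (-s))"
      by (auto simp: b_def powr_diff simp del: of_nat_Suc)
    finally have "(\<lambda>n. b (Suc n) * of_nat (Suc n) powr (-s)) sums f s" .
    thus ?thesis using sums_Suc_iff[of "\<lambda>n. b n * of_nat n powr (-s)" "f s"] by simp
  qed
  have "(\<lambda>N. \<Sum>n=1..N. b n / of_nat n) \<longlonglongrightarrow> f 1"
  proof (rule newman_at_1[of b K "U \<inter> {s. Re s > 0}"])
    show "norm (b n) \<le> K" for n
      using K[of n] K0 by (cases "n = 0") (auto simp: b_def norm_divide abs_divide field_simps)
    show "open (U \<inter> {s. Re s > 0})" using U open_Re_gt by blast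
    show "{s. Re s \<ge> 1} \<subseteq> U \<inter> {s. Re s > 0}" using U by auto
  qed (use fhol fsums in auto)
  hence "(\<lambda>N. Re (\<Sum>n=1..N. b n / of_nat n)) \<longlonglongrightarrow> Re (f 1)" by (rule tendsto_Re)
  also have "(\<lambda>N. Re (\<Sum>n=1..N. b n / of_nat n)) = (\<lambda>N. \<Sum>n=1..N. E n / (real n)\<^sup>2)"
    by (auto simp: b_def power2_eq_square)
  finally show "convergent (\<lambda>N. \<Sum>n=1..N. E n / (real n)\<^sup>2)" by (auto simp: convergent_def)
qed

section \<open>Dirichlet series\<close>

text \<open>
  Growth slower than every positive power, which is what absolute convergence for \<open>Re s > 1\<close> needs. All
  Dirichlet series below are summed from \<open>0\<close>, where the term vanishes since \<open>0 powr s = 0\<close>.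
\<close>
definition subpoly :: "(nat \<Rightarrow> real) \<Rightarrow> bool" where
  "subpoly f \<longleftrightarrow> (\<forall>d>0. \<exists>C\<ge>0. \<forall>n\<ge>1. \<bar>f n\<bar> \<le> C * real n powr d)"

definition dser :: "(nat \<Rightarrow> real) \<Rightarrow> complex \<Rightarrow> complex" where
  "dser f s = (\<Sum>n. of_real (f n) * of_nat n powr (-s))"

lemma subpolyE:
  assumes "subpoly f" "d > 0"
  obtains C where "C \<ge> 0" "\<And>n. n \<ge> 1 \<Longrightarrow> \<bar>f n\<bar> \<le> C * real n powr d"
  using assms unfolding subpoly_def by metis

lemma subpoly_bounded: "(\<And>n. \<bar>f n\<bar> \<le> 1) \<Longrightarrow> subpoly f"
  unfolding subpoly_def
proof (intro allI impI exI[of _ 1] conjI)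
  fix d :: real and n :: nat assume f: "\<And>n. \<bar>f n\<bar> \<le> 1" and "d > 0" "n \<ge> 1"
  hence "1 \<le> real n powr d" by (simp add: ge_one_powr_ge_zero)
  thus "\<bar>f n\<bar> \<le> 1 * real n powr d" using f[of n] by simp
qed auto

lemma ln_le_powr:
  assumes "d > 0" "n \<ge> 1" shows "ln (real n) \<le> (1 / d) * real n powr d"
proof -
  have "d * ln (real n) = ln (real n powr d)" using assms by (simp add: ln_powr)
  also have "\<dots> \<le> real n powr d" using ln_le_minus_one[of "real n powr d"] assms by simp
  finally show ?thesis using assms by (simp add: field_simps)
qed

lemma subpoly_mult_le_ln:
  assumes f: "subpoly f" and g: "\<And>n. n \<ge> 1 \<Longrightarrow> \<bar>g n\<bar> \<le> ln (real n)"
  shows "subpoly (\<lambda>n. f n * g n)"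
  unfolding subpoly_def
proof (intro allI impI)
  fix d :: real assume d: "d > 0"
  obtain C where C: "C \<ge> 0" "\<And>n. n \<ge> 1 \<Longrightarrow> \<bar>f n\<bar> \<le> C * real n powr (d/2)"
    using subpolyE[OF f, of "d/2"] d by auto
  have "\<bar>f n * g n\<bar> \<le> (C * (2 / d)) * real n powr d" if n: "n \<ge> 1" for n
  proof -
    have "\<bar>g n\<bar> \<le> (1 / (d/2)) * real n powr (d/2)" using g[OF n] ln_le_powr[of "d/2" n] d n by simp
    hence "\<bar>f n * g n\<bar> \<le> (C * real n powr (d/2)) * ((1 / (d/2)) * real n powr (d/2))"
      unfolding abs_mult using C n by (intro mult_mono) auto
    also have "\<dots> = (C * (2 / d)) * (real n powr (d/2) * real n powr (d/2))" by simp
    also have "real n powr (d/2) * real n powr (d/2) = real n powr d" by (simp add: powr_add[symmetric])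
    finally show ?thesis .
  qed
  thus "\<exists>C\<ge>0. \<forall>n\<ge>1. \<bar>f n * g n\<bar> \<le> C * real n powr d"
    using C d by (intro exI[of _ "C * (2/d)"]) auto
qed

lemma summable_powr: "d > 0 \<Longrightarrow> summable (\<lambda>n. real n powr (-1 - d))"
  by (simp add: summable_real_powr_iff)

lemma dser_term_bound:
  assumes "\<And>n. n \<ge> 1 \<Longrightarrow> \<bar>f n\<bar> \<le> C * real n powr d" "C \<ge> 0" "Re s \<ge> 1 + 2 * d"
  shows "norm (of_real (f n) * of_nat n powr (-s) :: complex) \<le> C * real n powr (-1 - d)"
proof (cases "n = 0")
  case False
  hence n: "n \<ge> 1" by simp
  have "norm (of_real (f n) * of_nat n powr (-s) :: complex) \<le> (C * real n powr d) * real n powr (- (1 + 2 * d))"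
    unfolding norm_mult norm_of_real norm_nat_powr using assms n by (intro mult_mono powr_mono) auto
  also have "\<dots> = C * (real n powr d * real n powr (- (1 + 2 * d)))" by simp
  also have "real n powr d * real n powr (- (1 + 2 * d)) = real n powr (-1 - d)"
    by (simp add: powr_add[symmetric] algebra_simps)
  finally show ?thesis .
qed auto

lemma dser_abs_summable:
  assumes "subpoly f" "Re s > 1"
  shows "summable (\<lambda>n. norm (of_real (f n) * of_nat n powr (-s) :: complex))"
proof -
  define d where "d = (Re s - 1) / 2"
  have d: "d > 0" "Re s \<ge> 1 + 2 * d" using assms by (simp_all add: d_def field_simps)
  obtain C where C: "C \<ge> 0" "\<And>n. n \<ge> 1 \<Longrightarrow> \<bar>f n\<bar> \<le> C * real n powr d" using subpolyE[OF assms(1) d(1)] by auto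
  show ?thesis
    by (rule summable_comparison_test'[of "\<lambda>n. C * real n powr (-1 - d)" 0])
       (use dser_term_bound[OF C(2,1) d(2)] summable_powr[OF d(1)] in auto)
qed

lemma dser_sums:
  assumes "subpoly f" "Re s > 1"
  shows "(\<lambda>n. of_real (f n) * of_nat n powr (-s)) sums dser f s"
  using summable_norm_cancel[OF dser_abs_summable[OF assms]] by (simp add: dser_def summable_sums)

lemma dser_has_field_derivative:
  assumes f: "subpoly f" and s: "Re s > 1"
  shows "(dser f has_field_derivative - dser (\<lambda>n. f n * ln (real n)) s) (at s)"
proof -
  let ?S = "{s::complex. Re s > 1}"
  have "\<exists>g g'. \<forall>x\<in>?S. ((\<lambda>n. of_real (f n) * of_nat n powr (-x)) sums g x) \<and>
      ((\<lambda>n. - (of_real (f n * ln (real n)) * of_nat n powr (-x))) sums g' x) \<and>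
      (g has_field_derivative g' x) (at x)"
  proof (rule series_and_derivative_comparison_complex)
    show "open ?S" by (rule open_Re_gt)
    fix n and x :: complex assume "x \<in> ?S"
    show "((\<lambda>x. of_real (f n) * of_nat n powr (-x)) has_field_derivative
             - (of_real (f n * ln (real n)) * of_nat n powr (-x))) (at x)"
    proof (cases "n = 0")
      case False
      have "((\<lambda>x. of_real (f n) * exp (- x * of_real (ln (real n)))) has_field_derivative
             - (of_real (f n * ln (real n)) * exp (- x * of_real (ln (real n))))) (at x)"
        by (auto intro!: derivative_eq_intros)
      thus ?thesis using False by (simp add: powr_def Ln_of_nat)
    qed auto
  next
    fix x :: complex assume x: "x \<in> ?S"
    define d where "d = (Re x - 1) / 4"
    have d: "d > 0" using x by (auto simp: d_def)
    obtain C where C: "C \<ge> 0" "\<And>n. n \<ge> 1 \<Longrightarrow> \<bar>f n\<bar> \<le> C * real n powr d" using subpolyE[OF f d(1)] by auto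
    define h where "h = (\<lambda>n. complex_of_real (C * real n powr (-1 - d)))"
    have "summable h" unfolding h_def using summable_powr[OF d] by (intro summable_of_real summable_mult)
    moreover have "range h \<subseteq> \<real>\<^sub>\<ge>\<^sub>0" using C by (auto simp: h_def)
    moreover have "cmod (of_real (f n) * of_nat n powr (-y)) \<le> cmod (h n)" if "y \<in> ball x (2 * d)" for n y
    proof -
      have "\<bar>Re (x - y)\<bar> < 2 * d" using that abs_Re_le_cmod[of "x - y"] by (simp add: dist_norm)
      moreover have "Re x = 1 + 4 * d" by (simp add: d_def field_simps)
      ultimately have "Re y \<ge> 1 + 2 * d" by (auto simp: abs_less_iff)
      hence "cmod (of_real (f n) * of_nat n powr (-y)) \<le> C * real n powr (-1 - d)" using dser_term_bound[OF C(2,1)] by simp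
      also have "\<dots> = cmod (h n)" using C by (simp only: h_def norm_of_real) simp
      finally show ?thesis .
    qed
    ultimately show "\<exists>d h. 0 < d \<and> summable h \<and> range h \<subseteq> \<real>\<^sub>\<ge>\<^sub>0 \<and>
      (\<forall>\<^sub>F n in sequentially. \<forall>y\<in>ball x d \<inter> ?S. cmod (of_real (f n) * of_nat n powr (-y)) \<le> cmod (h n))"
      using d by (intro exI[of _ "2 * d"] exI[of _ h]) auto
  qed
  then obtain g g' where g: "\<And>x. Re x > 1 \<Longrightarrow> (\<lambda>n. of_real (f n) * of_nat n powr (-x)) sums g x"
      "\<And>x. Re x > 1 \<Longrightarrow> (\<lambda>n. - (of_real (f n * ln (real n)) * of_nat n powr (-x))) sums g' x"
      "\<And>x. Re x > 1 \<Longrightarrow> (g has_field_derivative g' x) (at x)" by auto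
  have "subpoly (\<lambda>n. f n * ln (real n))" by (rule subpoly_mult_le_ln[OF f]) auto
  from sums_minus[OF dser_sums[OF this s]] have "g' s = - dser (\<lambda>n. f n * ln (real n)) s"
    using sums_unique2 g(2)[OF s] by blast
  hence "(g has_field_derivative - dser (\<lambda>n. f n * ln (real n)) s) (at s)" using g(3)[OF s] by simp
  thus ?thesis
  proof (rule has_field_derivative_transform_within_open[of _ _ _ ?S])
    show "g x = dser f x" if "x \<in> ?S" for x
      using sums_unique2[OF g(1) dser_sums[OF f]] that by simp
  qed (use s open_Re_gt in auto)
qed

lemma dser_holomorphic: "subpoly f \<Longrightarrow> dser f holomorphic_on {s. Re s > 1}"
  unfolding holomorphic_on_open[OF open_Re_gt] using dser_has_field_derivative by blast

text \<open>
  The double series over pairs of positive integers is rearranged along \<open>(d, e) \<mapsto> (d * e, d)\<close>. At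
  \<open>n = 0\<close> the sum over the infinite set of divisors is \<open>0\<close> by convention, as it has to be.
\<close>
lemma dirichlet_convolution_sums:
  fixes u v :: "nat \<Rightarrow> complex"
  assumes u: "summable (\<lambda>n. norm (u n))" "u sums U" "u 0 = 0"
    and v: "summable (\<lambda>n. norm (v n))" "v sums V" "v 0 = 0"
  shows "(\<lambda>n. \<Sum>d | d dvd n. u d * v (n div d)) sums (U * V)"
proof -
  note hu = norm_summable_imp_has_sum[OF u(1,2)] and hv = norm_summable_imp_has_sum[OF v(1,2)]
  have hnu: "((\<lambda>n. norm (u n)) has_sum (\<Sum>n. norm (u n))) UNIV"
    using u(1) by (intro norm_summable_imp_has_sum) (auto simp: summable_sums)
  have hnv: "((\<lambda>n. norm (v n)) has_sum (\<Sum>n. norm (v n))) UNIV"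
    using v(1) by (intro norm_summable_imp_has_sum) (auto simp: summable_sums)
  let ?f = "\<lambda>(m, n). u m * v n"
  have "(\<lambda>p. norm (?f p)) summable_on (UNIV \<times> UNIV)"
  proof (rule summable_on_SigmaI)
    show "((\<lambda>n. norm (?f (m, n))) has_sum (norm (u m) * (\<Sum>n. norm (v n)))) UNIV" for m
      using has_sum_cmult_right[OF hnv, of "norm (u m)"] by (simp add: norm_mult)
    show "(\<lambda>m. norm (u m) * (\<Sum>n. norm (v n))) summable_on UNIV"
      using has_sum_cmult_left[OF hnu] by (auto simp: summable_on_def)
  qed auto
  hence summ: "?f summable_on (UNIV \<times> UNIV)" by (rule abs_summable_summable)
  have "(?f has_sum (U * V)) (UNIV \<times> UNIV)"
  proof (rule has_sum_SigmaI[OF _ _ summ])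
    show "((\<lambda>n. ?f (m, n)) has_sum (u m * V)) UNIV" for m
      using has_sum_cmult_right[OF hv, of "u m"] by simp
    show "((\<lambda>m. u m * V) has_sum (U * V)) UNIV" by (rule has_sum_cmult_left[OF hu])
  qed
  also have "(?f has_sum (U * V)) (UNIV \<times> UNIV) \<longleftrightarrow> (?f has_sum (U * V)) ({1..} \<times> {1..})"
    using u(3) v(3) by (intro has_sum_cong_neutral) (auto simp: Suc_le_eq intro!: Nat.gr0I)
  also have "\<dots> \<longleftrightarrow> ((\<lambda>(n, d). u d * v (n div d)) has_sum (U * V)) (Sigma {1..} (\<lambda>n. {d. d dvd n}))"
  proof (rule has_sum_reindex_bij_witness[of _ "\<lambda>(n, d). (d, n div d)" "\<lambda>(d, e). (d * e, d)"])
    fix p :: "nat \<times> nat" assume "p \<in> Sigma {1..} (\<lambda>n. {d. d dvd n})"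
    thus "(case case p of (n, d) \<Rightarrow> (d, n div d) of (d, e) \<Rightarrow> (d * e, d)) = p"
      "(case p of (n, d) \<Rightarrow> (d, n div d)) \<in> {1..} \<times> {1..}"
      by (auto simp: dvd_div_eq_0_iff Suc_le_eq intro!: Nat.gr0I)
  qed (auto simp: Suc_le_eq)
  finally have "((\<lambda>n. \<Sum>d | d dvd n. u d * v (n div d)) has_sum (U * V)) {1..}"
  proof (rule has_sum_SigmaD)
    fix n :: nat assume "n \<in> {1..}"
    hence "finite {d. d dvd n}" by auto
    thus "((\<lambda>d. case (n, d) of (n, d) \<Rightarrow> u d * v (n div d)) has_sum (\<Sum>d | d dvd n. u d * v (n div d))) {d. d dvd n}"
      by (simp add: has_sum_finite)
  qed
  also have "?this \<longleftrightarrow> ((\<lambda>n. \<Sum>d | d dvd n. u d * v (n div d)) has_sum (U * V)) UNIV"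
    by (intro has_sum_cong_neutral) (auto simp: not_le)
  finally show ?thesis by (rule has_sum_imp_sums)
qed

text \<open>
  Completely multiplicative functions with values \<open>0\<close>, \<open>1\<close> and \<open>-1\<close>: the constant \<open>1\<close>, which gives
  the zeta function, and all real Dirichlet characters.
\<close>
definition unit_char :: "(nat \<Rightarrow> real) \<Rightarrow> bool" where
  "unit_char f \<longleftrightarrow> f 1 = 1 \<and> (\<forall>m n. f (m * n) = f m * f n) \<and> (\<forall>n. f n \<in> {-1, 0, 1})"

lemma unit_charD:
  assumes "unit_char f"
  shows "f 1 = 1" "f (m * n) = f m * f n" "f n \<in> {-1, 0, 1}" "\<bar>f n\<bar> \<le> 1"
proof -
  show "f 1 = 1" "f (m * n) = f m * f n" and *: "f n \<in> {-1, 0, 1}" using assms by (auto simp: unit_char_def)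
  show "\<bar>f n\<bar> \<le> 1" using * by auto
qed

lemma subpoly_unit_char: "unit_char f \<Longrightarrow> subpoly f"
  using unit_charD subpoly_bounded by metis

lemma subpoly_mangoldt: "unit_char f \<Longrightarrow> subpoly (\<lambda>n. f n * mangoldt n)"
  by (rule subpoly_mult_le_ln[OF subpoly_unit_char]) (auto intro: mangoldt_le)

text \<open>
  The von Mangoldt function satisfies \<open>\<Lambda> * 1 = ln\<close> under Dirichlet convolution; multiplying by a
  completely multiplicative \<open>f\<close> keeps this identity.
\<close>
lemma dser_logderiv:
  assumes f: "unit_char f" and s: "Re s > 1"
  shows "(dser f has_field_derivative - (dser f s * dser (\<lambda>n. f n * mangoldt n) s)) (at s)"
proof -
  let ?u = "\<lambda>n. of_real (f n * mangoldt n) * of_nat n powr (-s) :: complex"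
  let ?v = "\<lambda>n. of_real (f n) * of_nat n powr (-s) :: complex"
  have "(\<lambda>n. \<Sum>d | d dvd n. ?u d * ?v (n div d)) sums (dser (\<lambda>n. f n * mangoldt n) s * dser f s)"
    using subpoly_mangoldt[OF f] subpoly_unit_char[OF f] s
    by (intro dirichlet_convolution_sums dser_abs_summable dser_sums) simp_all
  also have "(\<lambda>n. \<Sum>d | d dvd n. ?u d * ?v (n div d)) = (\<lambda>n. of_real (f n * ln (real n)) * of_nat n powr (-s))"
  proof
    fix n :: nat
    show "(\<Sum>d | d dvd n. ?u d * ?v (n div d)) = of_real (f n * ln (real n)) * of_nat n powr (-s)"
    proof (cases "n = 0")
      case False
      have "(\<Sum>d | d dvd n. ?u d * ?v (n div d)) = (\<Sum>d | d dvd n. (of_real (f n) * of_nat n powr (-s)) * mangoldt d)"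
      proof (rule sum.cong)
        fix d assume "d \<in> {d. d dvd n}"
        then obtain e where e: "n = d * e" by auto
        hence d0: "d > 0" "e > 0" using False by auto
        have "of_nat n powr (-s) = (of_nat d powr (-s) * of_nat e powr (-s) :: complex)"
          using powr_times_real[of "of_nat d" "of_nat e" "-s"] by (simp add: e)
        thus "?u d * ?v (n div d) = (of_real (f n) * of_nat n powr (-s)) * mangoldt d"
          using d0 by (simp add: e unit_charD(2)[OF f])
      qed auto
      also have "\<dots> = (of_real (f n) * of_nat n powr (-s)) * (\<Sum>d | d dvd n. mangoldt d)"
        by (simp add: sum_distrib_left)
      also have "\<dots> = of_real (f n * ln (real n)) * of_nat n powr (-s)"
        using False by (subst mangoldt_sum) auto
      finally show ?thesis .
    qed auto
  qed
  finally have "(\<lambda>n. of_real (f n * ln (real n)) * of_nat n powr (-s)) sums (dser (\<lambda>n. f n * mangoldt n) s * dser f s)" .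
  moreover have "subpoly (\<lambda>n. f n * ln (real n))" by (rule subpoly_mult_le_ln[OF subpoly_unit_char[OF f]]) auto
  ultimately have "dser (\<lambda>n. f n * ln (real n)) s = dser f s * dser (\<lambda>n. f n * mangoldt n) s"
    using dser_sums[OF _ s] sums_unique2 by (metis mult.commute)
  thus ?thesis using dser_has_field_derivative[OF subpoly_unit_char[OF f] s] by simp
qed

text \<open>
  At \<open>s = 3\<close> the first term dominates the others, by comparison with a telescoping series.
\<close>
lemma dser_nonzero_3:
  assumes f: "unit_char f"
  shows "dser f 3 \<noteq> 0"
proof
  assume 0: "dser f 3 = 0"
  let ?t = "\<lambda>n. of_real (f n) * of_nat n powr (-3) :: complex"
  have "?t sums 0" using dser_sums[OF subpoly_unit_char[OF f], of 3] 0 by simp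
  hence "(\<lambda>n. ?t (Suc n)) sums 0" by (subst sums_Suc_iff) simp
  hence "(\<lambda>n. ?t (Suc (Suc n))) sums (- 1)" 
    by (subst sums_Suc_iff) (use unit_charD(1)[OF f] in simp)
  moreover have "norm (?t (Suc (Suc n))) \<le> (1/2) * (1 / real (Suc n) - 1 / real (Suc (Suc n)))" for n
  proof -
    have "norm (?t (Suc (Suc n))) \<le> 1 * real (Suc (Suc n)) powr (-3)"
      unfolding norm_mult norm_nat_powr norm_of_real using unit_charD(4)[OF f] by (intro mult_mono) auto
    also have "\<dots> = 1 / real (n + 2) ^ 3" by (simp add: powr_minus powr_numeral field_simps)
    also have "\<dots> \<le> (1/2) * (1 / real (Suc n) - 1 / real (Suc (Suc n)))"
      by (simp add: divide_simps power3_eq_cube) (simp add: algebra_simps)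
    finally show ?thesis .
  qed
  moreover have "(\<lambda>n. (1/2) * (1 / real (Suc n) - 1 / real (Suc (Suc n)))) sums ((1/2) * (1 / real (Suc 0) - 0))"
    by (intro sums_mult telescope_sums') real_asymp
  ultimately have "norm (-1 :: complex) \<le> (1/2) * (1 / real (Suc 0) - 0)"
    by (metis (no_types, lifting) norm_suminf_le sums_iff)
  thus False by simp
qed

section \<open>Continuation of the zeta function and its zeros\<close>

text \<open>
  The entire function \<open>(s - 1) \<zeta>(s)\<close>, here on \<open>Re s > 0\<close>. Working with it instead of the zeta function
  avoids the pole; the factor shows up as the \<open>1\<close> in \<open>zeta1_order\<close>.
\<close>
definition zeta1 :: "complex \<Rightarrow> complex" where
  "zeta1 s = 1 - (\<Sum>n. powr_rem (Suc n) (s - 1))"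

lemma zeta1_bound:
  assumes "Re s > 0"
  shows "norm (powr_rem (Suc n) (s - 1)) \<le> 1 * (1 + norm s)\<^sup>2 * real (Suc n) powr (-1 - Re s)"
proof -
  have "norm (powr_rem (Suc n) (s - 1)) \<le> norm (s - 1) * norm (s - 1 + 1) * real (Suc n) powr (- Re (s - 1) - 2)"
    using assms by (intro powr_rem_bound) auto
  also have "\<dots> \<le> ((1 + norm s) * (1 + norm s)) * real (Suc n) powr (- Re (s - 1) - 2)"
    using norm_triangle_ineq4[of s 1] by (intro mult_right_mono mult_mono) auto
  also have "- Re (s - 1) - 2 = -1 - Re s" by simp
  finally show ?thesis by (simp add: power2_eq_square)
qed

lemma zeta1_holomorphic: "zeta1 holomorphic_on {s. Re s > 0}"
proof -
  have "(\<lambda>s. powr_rem (Suc n) (s - 1)) holomorphic_on {s. Re s > 0}" for n by (intro holomorphic_intros)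
  from series_holomorphic_halfplane(1)[OF this _ zeta1_bound]
  have "(\<lambda>s. \<Sum>n. powr_rem (Suc n) (s - 1)) holomorphic_on {s. Re s > 0}" by simp
  thus ?thesis unfolding zeta1_def by (intro holomorphic_intros)
qed

lemma zeta1_1 [simp]: "zeta1 1 = 1"
  by (simp add: zeta1_def powr_rem_def del: of_nat_Suc)

lemma isCont_holomorphic: "f holomorphic_on S \<Longrightarrow> open S \<Longrightarrow> x \<in> S \<Longrightarrow> isCont f x"
  by (metis continuous_on_eq_continuous_at holomorphic_on_imp_continuous_on)

lemma unit_char_1 [simp]: "unit_char (\<lambda>_. 1)" by (simp add: unit_char_def)

text \<open>
  The two leading parts of \<open>powr_rem (Suc n) (s - 1)\<close> telescope to \<open>1\<close>, the third is
  \<open>(s - 1) * (Suc n) powr - s\<close>.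
\<close>
lemma zeta1_eq:
  assumes s: "Re s > 1"
  shows "zeta1 s = (s - 1) * dser (\<lambda>_. 1) s"
proof -
  have "(\<lambda>n. of_nat n powr (-s)) sums dser (\<lambda>_. 1) s"
    using dser_sums[OF subpoly_unit_char[OF unit_char_1] s] by simp
  hence "(\<lambda>n. of_nat (Suc n) powr (-s)) sums dser (\<lambda>_. 1) s" by (subst sums_Suc_iff) simp
  hence 1: "(\<lambda>n. (s - 1) * of_nat (Suc n) powr (-s)) sums ((s - 1) * dser (\<lambda>_. 1) s)" by (rule sums_mult)
  have "(\<lambda>n. of_nat (Suc n) powr (1 - s) :: complex) \<longlonglongrightarrow> 0"
  proof (rule Lim_null_comparison)
    show "\<forall>\<^sub>F n in sequentially. norm (of_nat (Suc n) powr (1 - s) :: complex) \<le> real (Suc n) powr (1 - Re s)"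
      by (simp only: norm_nat_powr) simp
    show "(\<lambda>n. real (Suc n) powr (1 - Re s)) \<longlonglongrightarrow> 0" using s by real_asymp
  qed
  from telescope_sums'[OF this]
  have 2: "(\<lambda>n. of_nat (Suc n) powr (1 - s) - of_nat (Suc (Suc n)) powr (1 - s)) sums (1 :: complex)" by simp
  have "(\<lambda>n. powr_rem (Suc n) (s - 1)) sums (1 - (s - 1) * dser (\<lambda>_. 1) s)"
    using sums_diff[OF 2 1] by (simp add: powr_rem_def)
  thus ?thesis unfolding zeta1_def by (simp add: sums_iff)
qed

text \<open>
  Near \<open>s0\<close> the function is \<open>(s - s0)^k\<close> times a function without zeros, hence \<open>F' / F\<close> has residue \<open>k\<close>.
  The limit is taken along the horizontal half-line to the right, where the Dirichlet series
  converge.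
\<close>
lemma logderiv_order:
  assumes F: "F holomorphic_on S" and S: "open S" "connected S" "s0 \<in> S" and z: "z \<in> S" "F z \<noteq> 0"
  obtains k :: nat where "((\<lambda>e::real. of_real e * (deriv F (s0 + of_real e) / F (s0 + of_real e))) \<longlongrightarrow> of_nat k) (at_right 0)"
    "F s0 = 0 \<longleftrightarrow> k > 0"
proof -
  have lim: "((\<lambda>e::real. s0 + of_real e) \<longlongrightarrow> s0) (at_right 0)"
    by (auto intro!: tendsto_eq_intros)
  show ?thesis
  proof (cases "F s0 = 0")
    case False
    have "isCont F s0" "isCont (deriv F) s0"
      using isCont_holomorphic[OF F S(1,3)] isCont_holomorphic[OF holomorphic_deriv[OF F S(1)] S(1,3)] by auto
    hence "((\<lambda>e::real. of_real e * (deriv F (s0 + of_real e) / F (s0 + of_real e))) \<longlongrightarrow> of_real 0 * (deriv F s0 / F s0)) (at_right 0)"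
      using False by (intro tendsto_intros isCont_tendsto_compose[of s0 F] isCont_tendsto_compose[of s0 "deriv F"] lim) auto
    thus ?thesis using False by (intro that[of 0]) auto
  next
    case True
    have "\<not> F constant_on S" using True z S by (metis constant_on_def)
    then obtain g r k where k: "0 < k" "0 < r" "ball s0 r \<subseteq> S" and g: "g holomorphic_on ball s0 r"
      "\<And>w. w \<in> ball s0 r \<Longrightarrow> F w = (w - s0) ^ k * g w" "\<And>w. w \<in> ball s0 r \<Longrightarrow> g w \<noteq> 0"
      using holomorphic_factor_zero_nonconstant[OF F S True] by metis
    have cg: "isCont g s0" "isCont (deriv g) s0"
      using isCont_holomorphic[OF g(1)] isCont_holomorphic[OF holomorphic_deriv[OF g(1)]] k(2) by auto
    have dF: "deriv F w = of_nat k * (w - s0) ^ (k - 1) * g w + (w - s0) ^ k * deriv g w" if w: "w \<in> ball s0 r" for w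
    proof (rule DERIV_imp_deriv)
      have "(g has_field_derivative deriv g w) (at w)" using g(1) w by (simp add: holomorphic_derivI)
      hence "((\<lambda>w. (w - s0) ^ k * g w) has_field_derivative (of_nat k * (w - s0) ^ (k - 1) * g w + (w - s0) ^ k * deriv g w)) (at w)"
        by (auto intro!: derivative_eq_intros)
      thus "(F has_field_derivative (of_nat k * (w - s0) ^ (k - 1) * g w + (w - s0) ^ k * deriv g w)) (at w)"
        by (rule has_field_derivative_transform_within_open[OF _ open_ball w]) (use g(2) in auto)
    qed
    have "((\<lambda>e::real. of_nat k + of_real e * (deriv g (s0 + of_real e) / g (s0 + of_real e))) \<longlongrightarrow> of_nat k + of_real 0 * (deriv g s0 / g s0)) (at_right 0)"
      using g(3)[of s0] k by (intro tendsto_intros isCont_tendsto_compose[of s0 g] isCont_tendsto_compose[of s0 "deriv g"] lim cg) auto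
    moreover have "\<forall>\<^sub>F e::real in at_right 0. of_nat k + of_real e * (deriv g (s0 + of_real e) / g (s0 + of_real e))
        = of_real e * (deriv F (s0 + of_real e) / F (s0 + of_real e))"
      using eventually_at_right_real[OF k(2)]
    proof eventually_elim
      case (elim e)
      have w: "s0 + of_real e \<in> ball s0 r" using elim by (simp add: dist_norm)
      have "of_real e ^ k = of_real e * (of_real e ^ (k - 1) :: complex)"
        using k(1) by (metis Suc_diff_1 power_Suc)
      thus ?case using g(3)[OF w] elim by (simp add: dF[OF w] g(2)[OF w] field_simps)
    qed
    ultimately have "((\<lambda>e::real. of_real e * (deriv F (s0 + of_real e) / F (s0 + of_real e))) \<longlongrightarrow> of_nat k) (at_right 0)"
      by (subst (asm) tendsto_cong) auto
    thus ?thesis using True k by (intro that[of k]) auto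
  qed
qed

text \<open>
  By \<open>dser_logderiv\<close> the quotient \<open>F' / F\<close> equals a holomorphic function wherever \<open>F\<close> is nonzero, so
  its residue at \<open>s\<close> is \<open>0\<close>.
\<close>
lemma dser_nonzero:
  assumes f: "unit_char f" and s: "Re s > 1"
  shows "dser f s \<noteq> 0"
proof -
  let ?S = "{s::complex. Re s > 1}"
  have hol: "dser f holomorphic_on ?S" by (rule dser_holomorphic[OF subpoly_unit_char[OF f]])
  have conn: "connected ?S" by (intro convex_connected convex_halfspace_Re_gt)
  obtain k :: nat where k: "((\<lambda>e::real. of_real e * (deriv (dser f) (s + of_real e) / dser f (s + of_real e))) \<longlongrightarrow> of_nat k) (at_right 0)"
     "dser f s = 0 \<longleftrightarrow> k > 0"
    using logderiv_order[OF hol open_Re_gt conn, of s 3] s dser_nonzero_3[OF f] by auto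
  define B where "B = dser (\<lambda>n. f n * mangoldt n)"
  have "isCont B s" using dser_holomorphic[OF subpoly_mangoldt[OF f]] s open_Re_gt
    by (metis B_def continuous_on_eq_continuous_at holomorphic_on_imp_continuous_on mem_Collect_eq)
  have "((\<lambda>e::real. of_real e * (deriv (dser f) (s + of_real e) / dser f (s + of_real e))) \<longlongrightarrow> 0) (at_right 0)"
  proof (rule Lim_null_comparison)
    have "((\<lambda>e::real. s + of_real e) \<longlongrightarrow> s) (at_right 0)" by (auto intro!: tendsto_eq_intros)
    hence "((\<lambda>e::real. norm (of_real e * B (s + of_real e))) \<longlongrightarrow> norm (of_real 0 * B s)) (at_right 0)"
      using \<open>isCont B s\<close> by (intro tendsto_intros isCont_tendsto_compose[of s B])
    thus "((\<lambda>e::real. norm (of_real e * B (s + of_real e))) \<longlongrightarrow> 0) (at_right 0)" by simp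
    show "\<forall>\<^sub>F e::real in at_right 0. norm (of_real e * (deriv (dser f) (s + of_real e) / dser f (s + of_real e))) \<le> norm (of_real e * B (s + of_real e))"
      using eventually_at_right_less[of 0]
    proof eventually_elim
      case (elim e)
      have "deriv (dser f) (s + of_real e) = - (dser f (s + of_real e) * B (s + of_real e))"
        unfolding B_def using s elim by (intro DERIV_imp_deriv dser_logderiv f) auto
      thus ?case by (cases "dser f (s + of_real e) = 0") (auto simp: norm_mult)
    qed
  qed
  hence "of_nat k = (0::complex)" using k(1) tendsto_unique[OF trivial_limit_at_right_real] by blast
  thus ?thesis using k(2) by simp
qed

text \<open>
  Termwise this is \<open>3 + 4 f(n) cos \<theta> + cos (2 \<theta>) \<ge> 0\<close>. Since \<open>f(n)\<close> is \<open>0\<close> or a sign, the third term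
  may carry the weight \<open>1\<close> instead of \<open>f(n)\<^sup>2\<close>, so that only the zeta function occurs there.
\<close>
lemma three_four_one:
  assumes f: "unit_char f" and \<sigma>: "\<sigma> > 1"
  shows "3 * Re (dser mangoldt (of_real \<sigma>)) + 4 * Re (dser (\<lambda>n. f n * mangoldt n) (Complex \<sigma> t))
           + Re (dser mangoldt (Complex \<sigma> (2 * t))) \<ge> 0"
proof -
  have sm: "subpoly mangoldt" using subpoly_mangoldt[OF unit_char_1] by simp
  note sf = subpoly_mangoldt[OF f]
  have Re_term: "Re (of_real a * of_nat n powr (- Complex \<sigma> u)) = a * real n powr (-\<sigma>) * cos (u * ln (real n))" for a n u
  proof (cases "n = 0")
    case False
    have "of_nat n powr (- Complex \<sigma> u) = exp (- Complex \<sigma> u * of_real (ln (real n)))"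
      using False by (simp add: powr_def)
    thus ?thesis using False by (simp add: Re_exp powr_def mult_ac)
  qed auto
  have 1: "(\<lambda>n. Re (of_real (mangoldt n) * of_nat n powr (- Complex \<sigma> 0))) sums Re (dser mangoldt (Complex \<sigma> 0))"
    using \<sigma> by (intro sums_Re dser_sums sm) auto
  have 2: "(\<lambda>n. Re (of_real (f n * mangoldt n) * of_nat n powr (- Complex \<sigma> t))) sums Re (dser (\<lambda>n. f n * mangoldt n) (Complex \<sigma> t))"
    using \<sigma> by (intro sums_Re dser_sums sf) auto
  have 3: "(\<lambda>n. Re (of_real (mangoldt n) * of_nat n powr (- Complex \<sigma> (2 * t)))) sums Re (dser mangoldt (Complex \<sigma> (2 * t)))"
    using \<sigma> by (intro sums_Re dser_sums sm) auto
  note S = sums_add[OF sums_add[OF sums_mult[OF 1, of 3] sums_mult[OF 2, of 4]] 3]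
  have "3 * Re (dser mangoldt (Complex \<sigma> 0)) + 4 * Re (dser (\<lambda>n. f n * mangoldt n) (Complex \<sigma> t))
           + Re (dser mangoldt (Complex \<sigma> (2 * t))) \<ge> 0"
  proof (rule sums_le[OF _ sums_zero S])
    fix n
    define c where "c = cos (t * ln (real n))"
    have c2: "cos (2 * t * ln (real n)) = 2 * c\<^sup>2 - 1" by (simp add: c_def cos_double_cos mult.assoc)
    have "0 \<le> 3 + 4 * f n * c + (2 * c\<^sup>2 - 1)"
    proof -
      have "f n = 0 \<or> f n = 1 \<or> f n = -1" using unit_charD(3)[OF f, of n] by auto
      moreover have "3 + 4 * c + (2 * c\<^sup>2 - 1) = 2 * (1 + c)\<^sup>2" "3 + 4 * (-1) * c + (2 * c\<^sup>2 - 1) = 2 * (1 - c)\<^sup>2"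
        by (simp_all add: power2_eq_square algebra_simps)
      ultimately show ?thesis by (elim disjE) auto
    qed
    hence "0 \<le> mangoldt n * real n powr (-\<sigma>) * (3 + 4 * f n * c + (2 * c\<^sup>2 - 1))"
      by (intro mult_nonneg_nonneg) (auto simp: mangoldt_nonneg)
    also have "\<dots> = 3 * Re (of_real (mangoldt n) * of_nat n powr (- Complex \<sigma> 0))
        + 4 * Re (of_real (f n * mangoldt n) * of_nat n powr (- Complex \<sigma> t))
        + Re (of_real (mangoldt n) * of_nat n powr (- Complex \<sigma> (2 * t)))"
      unfolding Re_term c2 by (simp add: c_def algebra_simps)
    finally show "0 \<le> \<dots>" .
  qed
  thus ?thesis by (simp add: complex_of_real_def)
qed

lemma deriv_zeta1:
  assumes s: "Re s > 1"
  shows "deriv zeta1 s / zeta1 s = 1 / (s - 1) - dser mangoldt s" and "zeta1 s \<noteq> 0"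
proof -
  let ?z = "dser (\<lambda>_. 1)"
  have nz: "?z s \<noteq> 0" "s \<noteq> 1" using dser_nonzero[OF unit_char_1 s] s by auto
  have "(?z has_field_derivative - (?z s * dser mangoldt s)) (at s)"
    using dser_logderiv[OF unit_char_1 s] by simp
  hence "((\<lambda>s. (s - 1) * ?z s) has_field_derivative (?z s - (s - 1) * (?z s * dser mangoldt s))) (at s)"
    by (auto intro!: derivative_eq_intros)
  hence "(zeta1 has_field_derivative (?z s - (s - 1) * (?z s * dser mangoldt s))) (at s)"
    by (rule has_field_derivative_transform_within_open[OF _ open_Re_gt[of 1]]) (use s zeta1_eq in auto)
  hence "deriv zeta1 s = ?z s - (s - 1) * (?z s * dser mangoldt s)" by (rule DERIV_imp_deriv)
  moreover have "(z - w * (z * B)) / (w * z) = 1 / w - B" if "w \<noteq> 0" "z \<noteq> 0" for w z B :: complex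
    using that by (simp add: field_simps)
  ultimately show "deriv zeta1 s / zeta1 s = 1 / (s - 1) - dser mangoldt s" "zeta1 s \<noteq> 0"
    using nz by (simp_all add: zeta1_eq[OF s])
qed

text \<open>
  The residue of \<open>- \<zeta>' / \<zeta>\<close> on the line \<open>Re s = 1\<close>: it is \<open>1\<close> at the pole and minus the order of the zero
  elsewhere.
\<close>
lemma zeta1_order:
  obtains k :: nat where "((\<lambda>e::real. e * Re (dser mangoldt (Complex (1 + e) t))) \<longlongrightarrow> (if t = 0 then 1 else 0) - real k) (at_right 0)"
    "zeta1 (Complex 1 t) = 0 \<longleftrightarrow> k > 0"
proof -
  obtain k :: nat where k: "((\<lambda>e::real. of_real e * (deriv zeta1 (Complex 1 t + of_real e) / zeta1 (Complex 1 t + of_real e))) \<longlongrightarrow> of_nat k) (at_right 0)"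
    "zeta1 (Complex 1 t) = 0 \<longleftrightarrow> k > 0"
    using logderiv_order[OF zeta1_holomorphic open_Re_gt convex_connected[OF convex_halfspace_Re_gt], of "Complex 1 t" 1] by auto
  have 1: "((\<lambda>e::real. Re (of_real e / (of_real e + Complex 0 t))) \<longlongrightarrow> (if t = 0 then 1 else 0)) (at_right 0)"
  proof (cases "t = 0")
    case True
    have "\<forall>\<^sub>F e::real in at_right 0. 1 = Re (of_real e / (of_real e + Complex 0 t))"
      using eventually_at_right_less[of 0] by eventually_elim (auto simp: True Complex_eq)
    thus ?thesis using True by (auto intro: Lim_transform_eventually[OF tendsto_const])
  next
    case False
    hence nz: "Complex 0 t \<noteq> 0" by (simp add: complex_eq_iff)
    have "((\<lambda>e::real. Re (of_real e / (of_real e + Complex 0 t))) \<longlongrightarrow> Re (of_real 0 / (of_real 0 + Complex 0 t))) (at_right 0)"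
      using nz by (intro tendsto_intros) auto
    thus ?thesis using False by simp
  qed
  have "((\<lambda>e::real. Re (of_real e / (of_real e + Complex 0 t)) - Re (of_real e * (deriv zeta1 (Complex 1 t + of_real e) / zeta1 (Complex 1 t + of_real e)))) \<longlongrightarrow> (if t = 0 then 1 else 0) - Re (of_nat k)) (at_right 0)"
    by (intro tendsto_diff 1 tendsto_Re k(1))
  moreover have "\<forall>\<^sub>F e::real in at_right 0. Re (of_real e / (of_real e + Complex 0 t)) - Re (of_real e * (deriv zeta1 (Complex 1 t + of_real e) / zeta1 (Complex 1 t + of_real e)))
     = e * Re (dser mangoldt (Complex (1 + e) t))"
    using eventually_at_right_less[of 0]
  proof eventually_elim
    case (elim e)
    have a: "Complex 1 t + of_real e = Complex (1 + e) t" "Complex (1 + e) t - 1 = of_real e + Complex 0 t"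
      by (simp_all add: complex_eq_iff)
    have "deriv zeta1 (Complex (1 + e) t) / zeta1 (Complex (1 + e) t) = 1 / (of_real e + Complex 0 t) - dser mangoldt (Complex (1 + e) t)"
      using deriv_zeta1(1)[of "Complex (1 + e) t"] elim unfolding a by simp
    thus ?case unfolding a by (simp add: right_diff_distrib)
  qed
  ultimately have "((\<lambda>e::real. e * Re (dser mangoldt (Complex (1 + e) t))) \<longlongrightarrow> (if t = 0 then 1 else 0) - Re (of_nat k)) (at_right 0)"
    by (subst (asm) tendsto_cong) auto
  thus ?thesis using k(2) by (intro that[of k]) auto
qed

text \<open>
  Let \<open>m\<close> be the order of the zero of the series of \<open>f\<close> at \<open>1 + i t\<close>. Multiplying the inequality by \<open>e\<close> and letting
  \<open>e\<close> tend to \<open>0\<close> gives \<open>3 - 4 m - k \<ge> 0\<close>, where \<open>k \<ge> 0\<close> is the order of \<open>zeta1\<close> at \<open>1 + 2 i t\<close>.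
\<close>
lemma order_from_341:
  assumes f: "unit_char f" and t: "t \<noteq> 0"
    and m: "((\<lambda>e::real. e * Re (dser (\<lambda>n. f n * mangoldt n) (Complex (1 + e) t))) \<longlongrightarrow> - real m) (at_right 0)"
  shows "m = 0"
proof -
  obtain k0 :: nat where k0: "((\<lambda>e::real. e * Re (dser mangoldt (Complex (1 + e) 0))) \<longlongrightarrow> 1 - real k0) (at_right 0)"
    "zeta1 1 = 0 \<longleftrightarrow> k0 > 0"
    using zeta1_order[of 0] by (auto simp: one_complex.code[symmetric])
  hence "k0 = 0" by simp
  obtain k2 :: nat where k2: "((\<lambda>e::real. e * Re (dser mangoldt (Complex (1 + e) (2 * t)))) \<longlongrightarrow> 0 - real k2) (at_right 0)"
    using zeta1_order[of "2 * t"] t by auto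
  have "((\<lambda>e::real. 3 * (e * Re (dser mangoldt (Complex (1 + e) 0))) + 4 * (e * Re (dser (\<lambda>n. f n * mangoldt n) (Complex (1 + e) t)))
      + e * Re (dser mangoldt (Complex (1 + e) (2 * t)))) \<longlongrightarrow> 3 * (1 - real k0) + 4 * (- real m) + (0 - real k2)) (at_right 0)"
    by (intro tendsto_intros k0 k2 m)
  moreover have "\<forall>\<^sub>F e::real in at_right 0. 0 \<le> 3 * (e * Re (dser mangoldt (Complex (1 + e) 0))) + 4 * (e * Re (dser (\<lambda>n. f n * mangoldt n) (Complex (1 + e) t)))
      + e * Re (dser mangoldt (Complex (1 + e) (2 * t)))"
    using eventually_at_right_less[of 0]
  proof eventually_elim
    case (elim e)
    have "0 \<le> e * (3 * Re (dser mangoldt (of_real (1 + e))) + 4 * Re (dser (\<lambda>n. f n * mangoldt n) (Complex (1 + e) t)) + Re (dser mangoldt (Complex (1 + e) (2 * t))))"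
      using elim by (intro mult_nonneg_nonneg three_four_one f) auto
    thus ?case by (simp only: complex_of_real_def) (simp add: algebra_simps)
  qed
  ultimately have "0 \<le> 3 * (1 - real k0) + 4 * (- real m) + (0 - real k2)"
    by (rule tendsto_lowerbound) auto
  thus ?thesis using \<open>k0 = 0\<close> by simp
qed

lemma zeta1_nonzero:
  assumes "Re s \<ge> 1" shows "zeta1 s \<noteq> 0"
proof (cases "Re s > 1")
  case False
  hence s: "s = Complex 1 (Im s)" using assms by (simp add: complex_eq_iff)
  show ?thesis
  proof (cases "Im s = 0")
    case True
    hence "s = 1" using s by (simp add: complex_eq_iff)
    thus ?thesis by simp
  next
    case t: False
    obtain k :: nat where k: "((\<lambda>e::real. e * Re (dser mangoldt (Complex (1 + e) (Im s)))) \<longlongrightarrow> 0 - real k) (at_right 0)"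
      "zeta1 (Complex 1 (Im s)) = 0 \<longleftrightarrow> k > 0"
      using zeta1_order[of "Im s"] t by auto
    have "k = 0" by (rule order_from_341[OF unit_char_1 t]) (use k in simp)
    thus ?thesis using k(2) s by simp
  qed
qed (use deriv_zeta1 in auto)

section \<open>Chebyshev's bound\<close>

lemma multiples_image:
  assumes "d \<ge> (1::nat)"
  shows "{k\<in>{1..n}. d dvd k} = (\<lambda>j. d * j) ` {1..n div d}"
proof safe
    fix k assume k: "k \<in> {1..n}" "d dvd k"
    then obtain j where j: "k = d * j" by auto
    hence "j \<in> {1..n div d}" using k assms by (auto simp: less_eq_div_iff_mult_less_eq mult.commute Suc_le_eq)
    thus "k \<in> (\<lambda>j. d * j) ` {1..n div d}" using j by blast
  next
    fix j assume "j \<in> {1..n div d}"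
    thus "d * j \<in> {1..n}" "d dvd d * j" using assms by (auto simp: less_eq_div_iff_mult_less_eq mult.commute Suc_le_eq)
qed

lemma card_multiples:
  assumes "d \<ge> 1"
  shows "card {k\<in>{1..n}. d dvd k} = n div d"
  unfolding multiples_image[OF assms] using assms by (simp add: card_image inj_on_def)

text \<open>
  Summing \<open>ln k = \<Sum>d | d dvd k. \<Lambda>(d)\<close> over \<open>k\<close> counts each \<open>d\<close> once for every multiple up to \<open>n\<close>.
\<close>
lemma ln_fact_mangoldt:
  "ln (fact n :: real) = (\<Sum>d=1..n. mangoldt d * real (n div d))"
proof -
  have "ln (fact n :: real) = (\<Sum>k=1..n. ln (real k))"
    by (induction n) (auto simp: ln_mult)
  also have "\<dots> = (\<Sum>k=1..n. \<Sum>d | d dvd k. mangoldt d)"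
    by (intro sum.cong refl, subst mangoldt_sum) auto
  also have "\<dots> = (\<Sum>k=1..n. \<Sum>d\<in>{1..n}. if d dvd k then mangoldt d else 0)"
  proof (rule sum.cong)
    fix k assume k: "k \<in> {1..n}"
    have "{d\<in>{1..n}. d dvd k} = {d. d dvd k}"
      using k by (auto dest: dvd_imp_le intro!: Nat.gr0I simp: Suc_le_eq)
    thus "(\<Sum>d | d dvd k. mangoldt d) = (\<Sum>d\<in>{1..n}. if d dvd k then mangoldt d else (0::real))"
      by (simp add: sum.inter_filter[symmetric])
  qed auto
  also have "\<dots> = (\<Sum>d\<in>{1..n}. \<Sum>k=1..n. if d dvd k then mangoldt d else 0)" by (rule sum.swap)
  also have "\<dots> = (\<Sum>d=1..n. mangoldt d * real (n div d))"
  proof (rule sum.cong)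
    fix d assume d: "d \<in> {1..n}"
    have "(\<Sum>k=1..n. if d dvd k then mangoldt d else (0::real)) = (\<Sum>k\<in>{k\<in>{1..n}. d dvd k}. mangoldt d)"
      by (simp add: sum.inter_filter[symmetric])
    also have "\<dots> = mangoldt d * real (n div d)" using card_multiples[of d n] d by simp
    finally show "(\<Sum>k=1..n. if d dvd k then mangoldt d else (0::real)) = mangoldt d * real (n div d)" .
  qed auto
  finally show ?thesis .
qed

text \<open>
  In \<open>ln (2 n choose n)\<close> the term \<open>\<Lambda>(d)\<close> has the coefficient \<open>2 n div d - 2 * (n div d)\<close>, which is never
  negative and is \<open>1\<close> for \<open>n < d \<le> 2 n\<close>.
\<close>
lemma chebyshev_doubling:
  "(\<Sum>d=1..2*n. mangoldt d) - (\<Sum>d=1..n. mangoldt d) \<le> real n * ln 4"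
proof -
  have "ln (fact n :: real) = (\<Sum>d=1..2*n. mangoldt d * real (n div d))"
    unfolding ln_fact_mangoldt by (rule sum.mono_neutral_left) auto
  hence "ln (fact (2*n) :: real) - 2 * ln (fact n) = (\<Sum>d=1..2*n. mangoldt d * (real (2*n div d) - 2 * real (n div d)))"
    unfolding ln_fact_mangoldt[of "2*n"] by (simp add: sum_distrib_left sum_subtractf[symmetric] algebra_simps)
  also have "\<dots> \<ge> (\<Sum>d=1..2*n. if d > n then mangoldt d else 0)"
  proof (rule sum_mono)
    fix d assume d: "d \<in> {1..2*n}"
    have "2 * (n div d) \<le> 2 * n div d"
      using d by (subst less_eq_div_iff_mult_less_eq) (auto simp: mult.assoc)
    hence nn: "real (2*n div d) - 2 * real (n div d) \<ge> 0"
      by (metis diff_ge_0_iff_ge of_nat_le_iff of_nat_mult of_nat_numeral)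
    show "(if d > n then mangoldt d else 0) \<le> mangoldt d * (real (2*n div d) - 2 * real (n div d))"
    proof (cases "d > n")
      case True
      have "1 \<le> 2 * n div d" using d by (subst less_eq_div_iff_mult_less_eq) auto
      thus ?thesis using True mult_left_mono[of 1 "real (2*n div d)" "mangoldt d"] mangoldt_nonneg[of d] by simp
    next
      case False
      thus ?thesis using nn mangoldt_nonneg[of d] by simp
    qed
  qed
  moreover have "(\<Sum>d=1..2*n. if d > n then mangoldt d else (0::real)) = (\<Sum>d=1..2*n. mangoldt d) - (\<Sum>d=1..n. mangoldt d)"
  proof -
    have "(\<Sum>d=1..2*n. if d > n then mangoldt d else (0::real)) = (\<Sum>d\<in>{n<..2*n}. mangoldt d)"
      by (rule sum.mono_neutral_cong_right) auto
    moreover have "{1..2*n} = {1..n} \<union> {n<..2*n}" by auto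
    hence "(\<Sum>d=1..2*n. mangoldt d :: real) = (\<Sum>d=1..n. mangoldt d) + (\<Sum>d\<in>{n<..2*n}. mangoldt d)"
      by (simp only:) (rule sum.union_disjoint, auto)
    ultimately show ?thesis by simp
  qed
  moreover have "ln (fact (2*n) :: real) - 2 * ln (fact n) \<le> real n * ln 4"
  proof -
    have "fact (2*n) / (fact n * fact n) = (real (2*n choose n))" by (subst binomial_fact) (auto simp: mult_2)
    also have "\<dots> \<le> real (2 ^ (2*n))" using binomial_le_pow2[of "2*n" n] by (simp only: of_nat_le_iff)
    also have "\<dots> = 4 ^ n" by (simp add: power_mult)
    finally have "ln (fact (2*n) / (fact n * fact n) :: real) \<le> ln (4 ^ n)" by (intro ln_mono) auto
    thus ?thesis by (simp add: ln_div ln_mult ln_realpow)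
  qed
  ultimately show ?thesis by linarith
qed

lemma chebyshev_upper: "(\<Sum>d=1..n. mangoldt d :: real) \<le> 4 * real n"
proof (induction n rule: less_induct)
  case (less n)
  show ?case
  proof (cases "n = 0")
    case False
    define m where "m = n div 2"
    have m: "m < n" using False by (simp add: m_def)
    have l4: "ln 4 \<le> (3/2 :: real)"
    proof -
      have "ln 4 = 2 * ln (2::real)" using ln_realpow[of 2 2] by simp
      thus ?thesis using ln2_le_25_over_36 by simp
    qed
    have A: "(\<Sum>d=1..2*m. mangoldt d :: real) \<le> 4 * real m + real m * (3/2)"
      using chebyshev_doubling[of m] less.IH[OF m] mult_left_mono[OF l4, of "real m"] by simp
    show ?thesis
    proof (cases "even n")
      case True
      hence "n = 2 * m" by (simp add: m_def)
      thus ?thesis using A by simp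
    next
      case odd: False
      hence n: "n = Suc (2 * m)" by (simp add: m_def)
      have "mangoldt n \<le> ln (real n)" using False by (intro mangoldt_le) auto
      also have "ln (real n) \<le> real (2 * m)" using ln_le_minus_one[of "real n"] by (simp add: n)
      finally show ?thesis using A by (simp add: n)
    qed
  qed auto
qed

section \<open>Non-vanishing of L(1)\<close>

lemma divisor_sum_prime_power_mult:
  fixes f :: "nat \<Rightarrow> real"
  assumes f: "\<And>m n. f (m * n) = f m * f n" "f 1 = 1" and p: "prime p" "\<not> p dvd m" "m > 0"
  shows "(\<Sum>d | d dvd p ^ a * m. f d) = (\<Sum>i\<le>a. f p ^ i) * (\<Sum>d | d dvd m. f d)"
proof -
  have pw: "f (p ^ i) = f p ^ i" for i by (induction i) (use f in auto)
  have cop: "coprime (p ^ i) d" if "d dvd m" for i d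
    using p that by (metis coprime_commute coprime_power_left_iff dvd_trans prime_imp_coprime)
    have bij: "bij_betw (\<lambda>(i, d). p ^ i * d) ({..a} \<times> {d. d dvd m}) {d. d dvd p ^ a * m}"
      unfolding bij_betw_def
    proof
      show "inj_on (\<lambda>(i, d). p ^ i * d) ({..a} \<times> {d. d dvd m})"
      proof (rule inj_onI, clarsimp)
        fix i d j e assume *: "d dvd m" "e dvd m" "p ^ i * d = p ^ j * e"
        have "d > 0" "e > 0" using * p by (auto intro!: Nat.gr0I)
        have "p ^ i dvd p ^ j" using *(3) cop[OF *(2)] by (metis coprime_dvd_mult_left_iff dvd_triv_left)
        moreover have "p ^ j dvd p ^ i" using *(3) cop[OF *(1)] by (metis coprime_dvd_mult_left_iff dvd_triv_left)
        ultimately have "p ^ i = p ^ j" by (rule dvd_antisym)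
        moreover from this have "i = j" using p(1) prime_gt_1_nat power_inject_exp by blast
        ultimately show "i = j \<and> d = e" using * p(1) prime_gt_0_nat by auto
      qed
      show "(\<lambda>(i, d). p ^ i * d) ` ({..a} \<times> {d. d dvd m}) = {d. d dvd p ^ a * m}"
      proof safe
        fix i d assume "i \<le> a" "d dvd m"
        thus "p ^ i * d dvd p ^ a * m" by (intro mult_dvd_mono le_imp_power_dvd)
      next
        fix x assume "x dvd p ^ a * m"
        then obtain u v where uv: "x = u * v" "u dvd p ^ a" "v dvd m" by (metis division_decomp)
        then obtain i where "i \<le> a" "u = p ^ i" using p(1) by (auto simp: divides_primepow_nat)
        thus "x \<in> (\<lambda>(i, d). p ^ i * d) ` ({..a} \<times> {d. d dvd m})" using uv by force
      qed
    qed
  have "(\<Sum>d | d dvd p ^ a * m. f d) = (\<Sum>(i, d) \<in> {..a} \<times> {d. d dvd m}. f (p ^ i * d))"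
    using sum.reindex_bij_betw[OF bij, of f] by (simp add: case_prod_unfold)
  also have "\<dots> = (\<Sum>i\<le>a. \<Sum>d | d dvd m. f p ^ i * f d)"
    by (simp add: sum.cartesian_product f(1) pw)
  also have "\<dots> = (\<Sum>i\<le>a. f p ^ i) * (\<Sum>d | d dvd m. f d)"
    by (simp add: sum_product)
  finally show ?thesis .
qed

lemma geometric_unit_nonneg:
  fixes x :: real assumes "x \<in> {-1, 0, 1}"
  shows "(\<Sum>i\<le>a. x ^ i) \<ge> 0" "even a \<Longrightarrow> (\<Sum>i\<le>a. x ^ i) \<ge> 1"
proof -
  have m1: "(\<Sum>i\<le>a. (-1::real) ^ i) = (if even a then 1 else 0)" by (induction a) auto
  have 0: "(\<Sum>i\<le>a. (0::real) ^ i) = 1" by (induction a) auto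
  show "(\<Sum>i\<le>a. x ^ i) \<ge> 0" "even a \<Longrightarrow> (\<Sum>i\<le>a. x ^ i) \<ge> 1" using assms m1 0 by auto
qed

lemma divisor_sum_nonneg:
  fixes f :: "nat \<Rightarrow> real"
  assumes f: "\<And>m n. f (m * n) = f m * f n" "f 1 = 1" "\<And>n. f n \<in> {-1, 0, 1}" and n: "n > 0"
  shows "(\<Sum>d | d dvd n. f d) \<ge> 0"
  using n
proof (induction n rule: less_induct)
  case (less n)
  show ?case
  proof (cases "n = 1")
    case True thus ?thesis using f by simp
  next
    case False
    then obtain p where p: "prime p" "p dvd n" using prime_factor_nat by blast
    obtain m where m: "n = p ^ multiplicity p n * m" "\<not> p dvd m"
      using multiplicity_decompose'[of n p] less.prems p(1) by (metis not_prime_unit not_gr_zero)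
    have "multiplicity p n > 0" using p less.prems by (simp add: prime_multiplicity_gt_zero_iff)
    have "m > 0" using m less.prems by (auto intro!: Nat.gr0I)
    have "p ^ multiplicity p n > 1" using \<open>multiplicity p n > 0\<close> prime_gt_1_nat[OF p(1)] by (intro one_less_power) auto
    hence "m < n" using m(1) \<open>m > 0\<close> by (metis mult.left_neutral mult_less_mono1)
    from less.IH[OF this \<open>m > 0\<close>] show ?thesis
      using geometric_unit_nonneg(1)[OF f(3)[of p]] 
      by (subst m(1), subst divisor_sum_prime_power_mult[OF f(1,2) p(1) m(2) \<open>m > 0\<close>]) auto
  qed
qed

text \<open>
  At a prime power with even exponent the divisor sum is at least \<open>1\<close>, because the signs of an
  alternating sum of odd length leave \<open>1\<close> over.
\<close>
lemma divisor_sum_square_ge_1: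
  fixes f :: "nat \<Rightarrow> real"
  assumes f: "\<And>m n. f (m * n) = f m * f n" "f 1 = 1" "\<And>n. f n \<in> {-1, 0, 1}" and n: "n > 0"
  shows "(\<Sum>d | d dvd n\<^sup>2. f d) \<ge> 1"
  using n
proof (induction n rule: less_induct)
  case (less n)
  show ?case
  proof (cases "n = 1")
    case True thus ?thesis using f by simp
  next
    case False
    then obtain p where p: "prime p" "p dvd n" using prime_factor_nat by blast
    obtain m where m: "n = p ^ multiplicity p n * m" "\<not> p dvd m"
      using multiplicity_decompose'[of n p] less.prems p(1) by (metis not_prime_unit not_gr_zero)
    define a where "a = multiplicity p n"
    have "multiplicity p n > 0" using p less.prems by (simp add: prime_multiplicity_gt_zero_iff)
    have "m > 0" using m less.prems by (auto intro!: Nat.gr0I)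
    have "p ^ multiplicity p n > 1" using \<open>multiplicity p n > 0\<close> prime_gt_1_nat[OF p(1)] by (intro one_less_power) auto
    hence "m < n" using m(1) \<open>m > 0\<close> by (metis mult.left_neutral mult_less_mono1)
    note IH = less.IH[OF this \<open>m > 0\<close>]
    have "n\<^sup>2 = p ^ (2 * a) * m\<^sup>2" by (subst m(1)) (simp add: a_def power_mult_distrib power_mult[symmetric] mult.commute)
    moreover have "\<not> p dvd m\<^sup>2" "m\<^sup>2 > 0" using m(2) p(1) \<open>m > 0\<close> prime_dvd_power by auto
    ultimately have "(\<Sum>d | d dvd n\<^sup>2. f d) = (\<Sum>i\<le>2 * a. f p ^ i) * (\<Sum>d | d dvd m\<^sup>2. f d)"
      using divisor_sum_prime_power_mult[OF f(1,2) p(1)] by simp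
    moreover have "(\<Sum>i\<le>2 * a. f p ^ i) \<ge> 1" using geometric_unit_nonneg(2)[OF f(3)[of p]] by simp
    ultimately show ?thesis using IH mult_mono[of 1 "\<Sum>i\<le>2 * a. f p ^ i" 1 "\<Sum>d | d dvd m\<^sup>2. f d"] by simp
  qed
qed


text \<open>
  The arithmetic-geometric mean inequality for the pairs \<open>y^(2 i)\<close> and \<open>y^(2 (n - 1 - i))\<close>.
\<close>
lemma geometric_sum_ge:
  fixes y :: real assumes y: "0 \<le> y" "y \<le> 1"
  shows "(\<Sum>i<n. (y\<^sup>2) ^ i) \<ge> real n * y ^ (n - 1)"
proof -
  have "(\<Sum>i<n. (y\<^sup>2) ^ i) = (\<Sum>i<n. (y\<^sup>2) ^ (n - Suc i))" by (rule sum.nat_diff_reindex[symmetric])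
  hence "2 * (\<Sum>i<n. (y\<^sup>2) ^ i) = (\<Sum>i<n. (y\<^sup>2) ^ i + (y\<^sup>2) ^ (n - Suc i))" by (simp add: sum.distrib)
  also have "\<dots> \<ge> (\<Sum>i<n. 2 * y ^ (n - 1))"
  proof (rule sum_mono)
    fix i assume "i \<in> {..<n}"
    hence e: "n - 1 = i + (n - Suc i)" by simp
    have "0 \<le> (y ^ i - y ^ (n - Suc i))\<^sup>2" by simp
    thus "2 * y ^ (n - 1) \<le> (y\<^sup>2) ^ i + (y\<^sup>2) ^ (n - Suc i)"
      unfolding e power_add by (simp add: power2_diff power_mult[symmetric] mult.commute mult_ac)
  qed
  finally show ?thesis by simp
qed

context
  fixes x :: real assumes x: "0 < x" "x < 1"
begin

text \<open>
  The difference between \<open>1 / (n * (1 - x))\<close> and the coefficient of \<open>f(n)\<close> in the Lambert series. If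
  \<open>\<Sum>n. f(n) / n\<close> vanishes, the Lambert series is minus the sum of \<open>f(n) * monsky_b n\<close>.
\<close>
definition monsky_b :: "nat \<Rightarrow> real" where
  "monsky_b n = 1 / (real n * (1 - x)) - x ^ n / (1 - x ^ n)"

lemma one_minus_pow: "1 - x ^ n = (1 - x) * (\<Sum>i<n. x ^ i)"
  by (rule one_diff_power_eq)

lemma geo_pos: "n \<ge> 1 \<Longrightarrow> (\<Sum>i<n. x ^ i) > 0"
  using x by (intro sum_pos) (auto simp: lessThan_empty_iff)

lemma monsky_b_1: "monsky_b 1 = 1"
  using x by (simp add: monsky_b_def diff_divide_distrib[symmetric])

lemma monsky_b_nonneg:
  assumes "n \<ge> 1" shows "monsky_b n \<ge> 0"
proof -
  have "(\<Sum>i<n. x ^ i) \<ge> (\<Sum>i<n. x ^ n)" using x by (intro sum_mono power_decreasing) auto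
  hence "real n * x ^ n \<le> (\<Sum>i<n. x ^ i)" by simp
  hence "x ^ n / (\<Sum>i<n. x ^ i) \<le> 1 / real n" using geo_pos[OF assms] assms by (simp add: divide_simps mult.commute)
  hence "(x ^ n / (\<Sum>i<n. x ^ i)) / (1 - x) \<le> (1 / real n) / (1 - x)" using x by (intro divide_right_mono) auto
  thus ?thesis unfolding monsky_b_def one_minus_pow by (simp add: mult.commute)
qed

text \<open>
  After division by \<open>1 - x\<close> this reads \<open>n (n + 1) x^n \<le> s(n) s(n + 1)\<close> for the geometric sums \<open>s\<close>, and
  follows from \<open>geometric_sum_ge\<close> with \<open>y = sqrt x\<close>.
\<close>
lemma monsky_b_decreasing:
  assumes n: "n \<ge> 1" shows "monsky_b (Suc n) \<le> monsky_b n"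
proof -
  define y where "y = sqrt x"
  have y: "0 < y" "y < 1" "x = y\<^sup>2" using x by (auto simp: y_def)
  let ?s = "\<lambda>n. \<Sum>i<n. x ^ i"
  have "real n * y ^ (n - 1) * (real (Suc n) * y ^ n) \<le> ?s n * ?s (Suc n)"
    using geometric_sum_ge[of y n] geometric_sum_ge[of y "Suc n"] y geo_pos[OF n]
    by (intro mult_mono) auto
  moreover have "x ^ n \<le> y ^ (n - 1) * y ^ n"
  proof -
    have "x ^ n = y ^ n * y ^ n" by (simp add: y(3) power_mult[symmetric] mult_2 power_add)
    also have "\<dots> \<le> y ^ (n - 1) * y ^ n" using y by (intro mult_right_mono power_decreasing) auto
    finally show ?thesis .
  qed
  hence "real n * real (Suc n) * x ^ n \<le> real n * real (Suc n) * (y ^ (n - 1) * y ^ n)"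
    by (intro mult_left_mono) auto
  ultimately have key: "real n * real (Suc n) * x ^ n \<le> ?s n * ?s (Suc n)" by (simp add: mult_ac)
  have p: "?s n > 0" "?s (Suc n) > 0" using geo_pos[OF n] geo_pos[of "Suc n"] by auto
  have "x ^ n / ?s n - x ^ Suc n / ?s (Suc n) = x ^ n * (?s (Suc n) - x * ?s n) / (?s n * ?s (Suc n))"
    using p by (simp add: field_simps del: sum.lessThan_Suc)
  also have "?s (Suc n) - x * ?s n = 1" by (simp add: sum.lessThan_Suc_shift sum_distrib_left del: sum.lessThan_Suc)
  also have "x ^ n * 1 / (?s n * ?s (Suc n)) \<le> 1 / (real n * real (Suc n))"
    using key p n by (simp add: divide_simps mult_ac del: sum.lessThan_Suc of_nat_Suc)
  also have "\<dots> = 1 / real n - 1 / real (Suc n)" using n by (simp add: field_simps)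
  finally have "1 / real (Suc n) - x ^ Suc n / ?s (Suc n) \<le> 1 / real n - x ^ n / ?s n" by simp
  hence "(1 / real (Suc n) - x ^ Suc n / ?s (Suc n)) / (1 - x) \<le> (1 / real n - x ^ n / ?s n) / (1 - x)"
    using x by (intro divide_right_mono) auto
  thus ?thesis unfolding monsky_b_def one_minus_pow by (simp add: diff_divide_distrib mult.commute del: sum.lessThan_Suc)
qed

text \<open>
  Summation by parts: the weights decrease from \<open>monsky_b 1 = 1\<close> and are nonnegative.
\<close>
lemma monsky_abel:
  fixes f :: "nat \<Rightarrow> real"
  assumes C: "\<And>n. \<bar>\<Sum>k=1..n. f k\<bar> \<le> C"
  shows "\<bar>\<Sum>n=1..N. f n * monsky_b n\<bar> \<le> C"
proof -
  define S where "S = (\<lambda>n. \<Sum>k=1..n. f k)"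
  have "(\<Sum>n=1..N. f n * monsky_b n) = (\<Sum>n=1..N. S n * (monsky_b n - monsky_b (Suc n))) + S N * monsky_b (Suc N)"
    by (induction N) (simp_all add: S_def algebra_simps)
  also have "\<bar>\<dots>\<bar> \<le> (\<Sum>n=1..N. C * (monsky_b n - monsky_b (Suc n))) + C * monsky_b (Suc N)"
  proof (rule order_trans[OF abs_triangle_ineq add_mono])
    show "\<bar>\<Sum>n=1..N. S n * (monsky_b n - monsky_b (Suc n))\<bar> \<le> (\<Sum>n=1..N. C * (monsky_b n - monsky_b (Suc n)))"
    proof (rule order_trans[OF sum_abs sum_mono])
      fix n assume "n \<in> {1..N}"
      hence "monsky_b n - monsky_b (Suc n) \<ge> 0" using monsky_b_decreasing[of n] by simp
      thus "\<bar>S n * (monsky_b n - monsky_b (Suc n))\<bar> \<le> C * (monsky_b n - monsky_b (Suc n))"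
        using C[of n] unfolding abs_mult by (intro mult_mono) (auto simp: S_def intro: order_trans[OF abs_ge_zero C])
    qed
    show "\<bar>S N * monsky_b (Suc N)\<bar> \<le> C * monsky_b (Suc N)"
      unfolding abs_mult using C[of N] monsky_b_nonneg[of "Suc N"] by (intro mult_mono) (auto simp: S_def intro: order_trans[OF abs_ge_zero C])
  qed
  also have "(\<Sum>n=1..N. C * (monsky_b n - monsky_b (Suc n))) + C * monsky_b (Suc N) = C * monsky_b 1"
    by (induction N) (simp_all add: algebra_simps)
  finally show ?thesis by (simp add: monsky_b_1[simplified])
qed

text \<open>
  Expanding \<open>x^n / (1 - x^n)\<close> as a geometric series and collecting powers of \<open>x\<close> gives the divisor
  sums. The error comes from the terms with exponent above \<open>N\<close>.
\<close>
lemma lambert_partial: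
  fixes f :: "nat \<Rightarrow> real"
  assumes f: "\<And>n. \<bar>f n\<bar> \<le> 1"
  shows "\<bar>(\<Sum>j=1..N. (\<Sum>d | d dvd j. f d) * x ^ j) - (\<Sum>n=1..N. f n * (x ^ n / (1 - x ^ n)))\<bar> \<le> real N * x ^ N / (1 - x)"
proof -
  have "(\<Sum>j=1..N. (\<Sum>d | d dvd j. f d) * x ^ j) = (\<Sum>j=1..N. \<Sum>d\<in>{1..N}. if d dvd j then f d * x ^ j else 0)"
  proof (rule sum.cong)
    fix k assume k: "k \<in> {1..N}"
    have "{d\<in>{1..N}. d dvd k} = {d. d dvd k}"
      using k by (auto dest: dvd_imp_le intro!: Nat.gr0I simp: Suc_le_eq)
    thus "(\<Sum>d | d dvd k. f d) * x ^ k = (\<Sum>d\<in>{1..N}. if d dvd k then f d * x ^ k else 0)"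
      by (simp add: sum.inter_filter[symmetric] sum_distrib_right)
  qed auto
  also have "\<dots> = (\<Sum>d\<in>{1..N}. \<Sum>j=1..N. if d dvd j then f d * x ^ j else 0)" by (rule sum.swap)
  also have "\<dots> = (\<Sum>d=1..N. f d * ((x ^ d - (x ^ d) ^ Suc (N div d)) / (1 - x ^ d)))"
  proof (rule sum.cong)
    fix d assume d: "d \<in> {1..N}"
    have xd: "x ^ d < 1" "x ^ d \<noteq> 1" using d x power_Suc_less_one[of x "d - 1"] by auto
    have "(\<Sum>j=1..N. if d dvd j then f d * x ^ j else 0) = (\<Sum>j\<in>{j\<in>{1..N}. d dvd j}. f d * x ^ j)"
      by (simp add: sum.inter_filter[symmetric])
    also have "\<dots> = (\<Sum>m=1..N div d. f d * x ^ (d * m))"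
      using d by (subst multiples_image) (auto simp: sum.reindex inj_on_def)
    also have "\<dots> = f d * (\<Sum>m=1..N div d. (x ^ d) ^ m)" by (simp add: sum_distrib_left power_mult)
    also have "(\<Sum>m=1..N div d. (x ^ d) ^ m) = (x ^ d - (x ^ d) ^ Suc (N div d)) / (1 - x ^ d)"
      using xd by (subst sum_gp) auto
    finally show "(\<Sum>j=1..N. if d dvd j then f d * x ^ j else 0) = f d * ((x ^ d - (x ^ d) ^ Suc (N div d)) / (1 - x ^ d))" .
  qed auto
  finally have A: "(\<Sum>j=1..N. (\<Sum>d | d dvd j. f d) * x ^ j)
      = (\<Sum>d=1..N. f d * ((x ^ d - (x ^ d) ^ Suc (N div d)) / (1 - x ^ d)))" .
  have "(\<Sum>j=1..N. (\<Sum>d | d dvd j. f d) * x ^ j) - (\<Sum>n=1..N. f n * (x ^ n / (1 - x ^ n)))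
      = (\<Sum>d=1..N. f d * (- ((x ^ d) ^ Suc (N div d) / (1 - x ^ d))))"
    unfolding A sum_subtractf[symmetric] by (simp add: diff_divide_distrib algebra_simps)
  also have "\<bar>\<dots>\<bar> \<le> (\<Sum>d=1..N. x ^ N / (1 - x))"
  proof (rule order_trans[OF sum_abs sum_mono])
    fix d assume d: "d \<in> {1..N}"
    have xd: "x ^ d \<le> x" using d x power_decreasing[of 1 d x] by simp
    have "N < Suc (N div d) * d" using d by (simp add: dividend_less_div_times)
    hence le: "(x ^ d) ^ Suc (N div d) \<le> x ^ N"
      unfolding power_mult[symmetric] using x by (intro power_decreasing) (auto simp: mult.commute)
    have "\<bar>f d * (- ((x ^ d) ^ Suc (N div d) / (1 - x ^ d)))\<bar> = \<bar>f d\<bar> * ((x ^ d) ^ Suc (N div d) / (1 - x ^ d))"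
      using x xd by (simp add: abs_mult)
    also have "\<dots> \<le> 1 * (x ^ N / (1 - x))"
      using f[of d] x xd le by (intro mult_mono frac_le) auto
    finally show "\<bar>f d * (- ((x ^ d) ^ Suc (N div d) / (1 - x ^ d)))\<bar> \<le> x ^ N / (1 - x)" by simp
  qed
  finally show ?thesis by simp
qed

end

text \<open>
  If the series had the sum \<open>0\<close>, the Lambert series \<open>\<Sum>n. f(n) x^n / (1 - x^n)\<close> would be bounded by \<open>C\<close>
  for all \<open>x\<close> between \<open>0\<close> and \<open>1\<close>. But its power series coefficients are nonnegative, and at least
  \<open>1\<close> at the squares, so it exceeds every bound as \<open>x\<close> tends to \<open>1\<close>.
\<close>
theorem monsky:
  fixes f :: "nat \<Rightarrow> real"
  assumes f: "\<And>m n. f (m * n) = f m * f n" "f 1 = 1" "\<And>n. f n \<in> {-1, 0, 1}"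
    and C: "\<And>n. \<bar>\<Sum>k=1..n. f k\<bar> \<le> C"
  shows "\<not> (\<lambda>N. \<Sum>n=1..N. f n / real n) \<longlonglongrightarrow> 0"
proof
  assume T: "(\<lambda>N. \<Sum>n=1..N. f n / real n) \<longlonglongrightarrow> 0"
  let ?c = "\<lambda>n. \<Sum>d | d dvd n. f d"
  have f1: "\<bar>f n\<bar> \<le> 1" for n using f(3)[of n] by auto
  have bound: "(\<Sum>k=1..K. x ^ k\<^sup>2) \<le> C" if x: "0 < x" "x < 1" for x :: real and K
  proof -
    let ?U = "\<lambda>N. \<bar>\<Sum>n=1..N. f n / real n\<bar> / (1 - x) + C + real N * x ^ N / (1 - x)"
    have "(\<Sum>k=1..K. x ^ k\<^sup>2) \<le> ?U N" if N: "N \<ge> K\<^sup>2" for N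
    proof -
      have inj: "inj_on (\<lambda>k::nat. k\<^sup>2) {1..K}" by (rule inj_onI) simp
      have "(\<Sum>k=1..K. x ^ k\<^sup>2) \<le> (\<Sum>k=1..K. ?c (k\<^sup>2) * x ^ k\<^sup>2)"
      proof (rule sum_mono)
        fix k assume "k \<in> {1..K}"
        hence "?c (k\<^sup>2) \<ge> 1" by (intro divisor_sum_square_ge_1 f) auto
        thus "x ^ k\<^sup>2 \<le> ?c (k\<^sup>2) * x ^ k\<^sup>2" using x mult_right_mono[of 1 "?c (k\<^sup>2)" "x ^ k\<^sup>2"] by simp
      qed
      also have "\<dots> = (\<Sum>j\<in>(\<lambda>k. k\<^sup>2) ` {1..K}. ?c j * x ^ j)" by (subst sum.reindex[OF inj]) (simp add: o_def)
      also have "\<dots> \<le> (\<Sum>j=1..N. ?c j * x ^ j)"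
      proof (rule sum_mono2)
        show "(\<lambda>k. k\<^sup>2) ` {1..K} \<subseteq> {1..N}"
        proof safe
          fix k assume k: "k \<in> {1..K}"
          hence "k\<^sup>2 \<le> K\<^sup>2" by (intro power_mono) auto
          from order_trans[OF this \<open>K\<^sup>2 \<le> N\<close>] have "k\<^sup>2 \<le> N" .
          thus "k\<^sup>2 \<in> {1..N}" using k by (simp add: Suc_le_eq)
        qed
        fix j assume "j \<in> {1..N} - (\<lambda>k. k\<^sup>2) ` {1..K}"
        thus "0 \<le> ?c j * x ^ j" using x divisor_sum_nonneg[of f j] f by auto
      qed simp
      also have "\<dots> \<le> (\<Sum>n=1..N. f n * (x ^ n / (1 - x ^ n))) + real N * x ^ N / (1 - x)"
        using lambert_partial[where f = f and N = N, OF x f1] by linarith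
      also have "(\<Sum>n=1..N. f n * (x ^ n / (1 - x ^ n))) = (\<Sum>n=1..N. f n / real n) / (1 - x) - (\<Sum>n=1..N. f n * monsky_b x n)"
        unfolding sum_divide_distrib sum_subtractf[symmetric]
        by (intro sum.cong refl) (simp add: monsky_b_def[OF x] algebra_simps)
      also have "\<dots> \<le> \<bar>\<Sum>n=1..N. f n / real n\<bar> / (1 - x) + C"
      proof -
        have "(\<Sum>n=1..N. f n / real n) / (1 - x) \<le> \<bar>\<Sum>n=1..N. f n / real n\<bar> / (1 - x)"
          using x by (intro divide_right_mono) auto
        thus ?thesis using monsky_abel[where f = f and N = N, OF x C] by linarith
      qed
      finally show ?thesis by simp
    qed
    moreover have "?U \<longlonglongrightarrow> \<bar>0\<bar> / (1 - x) + C + 0"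
    proof (intro tendsto_intros T)
      show "(\<lambda>N. real N * x ^ N / (1 - x)) \<longlonglongrightarrow> 0"
        using tendsto_divide[OF powser_times_n_limit_0[of x] tendsto_const[of "1 - x"]] x by simp
    qed (use x in auto)
    ultimately have "(\<Sum>k=1..K. x ^ k\<^sup>2) \<le> \<bar>0\<bar> / (1 - x) + C + 0"
      by (intro tendsto_lowerbound[where F = sequentially and f = ?U])
         (auto simp: eventually_at_top_linorder intro!: exI[of _ "K\<^sup>2"])
    thus ?thesis by simp
  qed
  have "real K \<le> C" for K
  proof -
    have "((\<lambda>x::real. \<Sum>k=1..K. x ^ k\<^sup>2) \<longlongrightarrow> (\<Sum>k=1..K. 1 ^ k\<^sup>2)) (at_left 1)"
      by (intro tendsto_intros)
    moreover have "\<forall>\<^sub>F x::real in at_left 1. (\<Sum>k=1..K. x ^ k\<^sup>2) \<le> C"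
      using eventually_at_left_real[OF zero_less_one]
      by eventually_elim (rule bound, auto)
    ultimately have "(\<Sum>k=1..K. 1 ^ k\<^sup>2) \<le> C" by (rule tendsto_upperbound) auto
    thus ?thesis by simp
  qed
  from this[of "nat \<lceil>C\<rceil> + 1"] show False by linarith
qed

section \<open>The prime number theorem with a real character\<close>

text \<open>
  The series of \<open>f\<close> after summation by parts, which converges for \<open>Re s > 0\<close> when the partial sums of \<open>f\<close>
  are bounded.
\<close>
definition Lcont :: "(nat \<Rightarrow> real) \<Rightarrow> complex \<Rightarrow> complex" where
  "Lcont f s = (\<Sum>n. of_real (\<Sum>k=1..Suc n. f k) * (of_nat (Suc n) powr (-s) - of_nat (Suc (Suc n)) powr (-s)))"

context
  fixes f :: "nat \<Rightarrow> real" and C :: real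
  assumes f: "unit_char f" and C: "\<And>n. \<bar>\<Sum>k=1..n. f k\<bar> \<le> C"
begin

lemma C0: "C \<ge> 0" using C[of 0] by simp

lemma Lcont_bound:
  assumes "Re s > 0"
  shows "norm (of_real (\<Sum>k=1..Suc n. f k) * (of_nat (Suc n) powr (-s) - of_nat (Suc (Suc n)) powr (-s)))
     \<le> C * (1 + norm s)\<^sup>2 * real (Suc n) powr (-1 - Re s)"
proof -
  have "norm (of_real (\<Sum>k=1..Suc n. f k) * (of_nat (Suc n) powr (-s) - of_nat (Suc (Suc n)) powr (-s)))
     \<le> C * (norm s * real (Suc n) powr (- Re s - 1))"
    unfolding norm_mult norm_of_real using assms C0 by (intro mult_mono C nat_powr_diff_bound) auto
  also have "- Re s - 1 = -1 - Re s" by simp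
  also have "C * (norm s * real (Suc n) powr (-1 - Re s)) = C * norm s * real (Suc n) powr (-1 - Re s)" by simp
  also have "\<dots> \<le> C * (1 + norm s)\<^sup>2 * real (Suc n) powr (-1 - Re s)"
    using C0 by (intro mult_right_mono mult_left_mono) (auto simp: power2_eq_square algebra_simps)
  finally show ?thesis .
qed

lemma Lcont_holomorphic: "Lcont f holomorphic_on {s. Re s > 0}"
  and Lcont_sums: "Re s > 0 \<Longrightarrow> (\<lambda>n. of_real (\<Sum>k=1..Suc n. f k) * (of_nat (Suc n) powr (-s) - of_nat (Suc (Suc n)) powr (-s))) sums Lcont f s"
proof -
  have h: "(\<lambda>s. of_real (\<Sum>k=1..Suc n. f k) * (of_nat (Suc n) powr (-s) - of_nat (Suc (Suc n)) powr (-s)) :: complex) holomorphic_on {s. Re s > 0}" for n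
    by (intro holomorphic_intros)
  show "Lcont f holomorphic_on {s. Re s > 0}"
    unfolding Lcont_def by (rule series_holomorphic_halfplane(1)[OF h C0 Lcont_bound])
  show "Re s > 0 \<Longrightarrow> (\<lambda>n. of_real (\<Sum>k=1..Suc n. f k) * (of_nat (Suc n) powr (-s) - of_nat (Suc (Suc n)) powr (-s))) sums Lcont f s"
    unfolding Lcont_def by (intro summable_sums series_holomorphic_halfplane(2)[OF h C0 Lcont_bound])
qed

lemma Lcont_limit:
  assumes s: "Re s > 0"
  shows "(\<lambda>N. \<Sum>n=1..N. of_real (f n) * of_nat n powr (-s)) \<longlonglongrightarrow> Lcont f s"
proof -
  have e: "(\<Sum>k=1..n. complex_of_real (f k)) = of_real (\<Sum>k=1..n. f k)" for n by simp
  have "(\<lambda>N. \<Sum>n=1..N. of_real (\<Sum>k=1..n. f k) * (of_nat n powr (-s) - of_nat (Suc n) powr (-s))) \<longlonglongrightarrow> Lcont f s"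
    using Lcont_sums[OF s] sums_Suc_from_atLeast1[of "\<lambda>n. of_real (\<Sum>k=1..n. f k) * (of_nat n powr (-s) - of_nat (Suc n) powr (-s))"] by blast
  moreover have "(\<lambda>N. of_real (\<Sum>k=1..N. f k) * of_nat (Suc N) powr (-s) :: complex) \<longlonglongrightarrow> 0"
  proof (rule Lim_null_comparison)
    show "\<forall>\<^sub>F N in sequentially. norm (of_real (\<Sum>k=1..N. f k) * of_nat (Suc N) powr (-s) :: complex) \<le> C * real (Suc N) powr (- Re s)"
      unfolding norm_mult norm_nat_powr norm_of_real
      by (intro always_eventually allI mult_mono C C0) auto
    show "(\<lambda>N. C * real (Suc N) powr (- Re s)) \<longlonglongrightarrow> 0" using s by real_asymp
  qed
  ultimately have "(\<lambda>N. (\<Sum>n=1..N. of_real (\<Sum>k=1..n. f k) * (of_nat n powr (-s) - of_nat (Suc n) powr (-s)))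
     + of_real (\<Sum>k=1..N. f k) * of_nat (Suc N) powr (-s)) \<longlonglongrightarrow> Lcont f s + 0" by (rule tendsto_add)
  thus ?thesis unfolding abel_powr e by simp
qed

lemma Lcont_eq: "Re s > 1 \<Longrightarrow> Lcont f s = dser f s"
proof -
  assume s: "Re s > 1"
  have "(\<lambda>N. \<Sum>n=1..N. of_real (f n) * of_nat n powr (-s)) \<longlonglongrightarrow> dser f s"
    using dser_sums[OF subpoly_unit_char[OF f] s] by (subst (asm) sums_from_atLeast1) auto
  thus ?thesis using LIMSEQ_unique[OF Lcont_limit[of s]] s by auto
qed

lemma Lcont_1_nonzero: "Lcont f 1 \<noteq> 0"
proof
  assume "Lcont f 1 = 0"
  hence "(\<lambda>N. Re (\<Sum>n=1..N. of_real (f n) * of_nat n powr (-1))) \<longlonglongrightarrow> Re 0"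
    using Lcont_limit[of 1] by (intro tendsto_Re) simp
  also have "(\<lambda>N. Re (\<Sum>n=1..N. of_real (f n) * of_nat n powr (-1))) = (\<lambda>N. \<Sum>n=1..N. f n / real n)"
  proof (intro ext)
    fix N
    have "of_real (f n) * of_nat n powr (-1) = complex_of_real (f n / real n)" for n
      by (cases "n = 0") (simp_all add: powr_minus field_simps)
    thus "Re (\<Sum>n=1..N. of_real (f n) * of_nat n powr (-1)) = (\<Sum>n=1..N. f n / real n)"
      by (simp only: of_real_sum[symmetric] Re_complex_of_real)
  qed
  finally show False using monsky[of f C, OF unit_charD(2,1)[OF f] unit_charD(3)[OF f] C] by simp
qed

lemma deriv_Lcont:
  assumes s: "Re s > 1"
  shows "deriv (Lcont f) s / Lcont f s = - dser (\<lambda>n. f n * mangoldt n) s" "Lcont f s \<noteq> 0"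
proof -
  have nz: "dser f s \<noteq> 0" by (rule dser_nonzero[OF f s])
  have "(Lcont f has_field_derivative - (dser f s * dser (\<lambda>n. f n * mangoldt n) s)) (at s)"
    by (rule has_field_derivative_transform_within_open[OF dser_logderiv[OF f s] open_Re_gt[of 1]]) (use s Lcont_eq in auto)
  hence "deriv (Lcont f) s = - (dser f s * dser (\<lambda>n. f n * mangoldt n) s)" by (rule DERIV_imp_deriv)
  thus "deriv (Lcont f) s / Lcont f s = - dser (\<lambda>n. f n * mangoldt n) s" "Lcont f s \<noteq> 0"
    using nz Lcont_eq[OF s] by simp_all
qed

lemma Lcont_nonzero:
  assumes "Re s \<ge> 1" shows "Lcont f s \<noteq> 0"
proof (cases "Re s > 1")
  case False
  define t where "t = Im s"
  have s: "s = Complex 1 t" using assms False by (simp add: complex_eq_iff t_def)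
  show ?thesis
  proof (cases "t = 0")
    case True
    hence "s = 1" using s by (simp add: complex_eq_iff)
    thus ?thesis using Lcont_1_nonzero by simp
  next
    case t: False
    obtain k :: nat where k: "((\<lambda>e::real. of_real e * (deriv (Lcont f) (Complex 1 t + of_real e) / Lcont f (Complex 1 t + of_real e))) \<longlongrightarrow> of_nat k) (at_right 0)"
      "Lcont f (Complex 1 t) = 0 \<longleftrightarrow> k > 0"
      using logderiv_order[OF Lcont_holomorphic open_Re_gt convex_connected[OF convex_halfspace_Re_gt], of "Complex 1 t" 2] deriv_Lcont(2)[of 2] by auto
    have "((\<lambda>e::real. - Re (of_real e * (deriv (Lcont f) (Complex 1 t + of_real e) / Lcont f (Complex 1 t + of_real e)))) \<longlongrightarrow> - Re (of_nat k)) (at_right 0)"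
      by (intro tendsto_minus tendsto_Re k)
    moreover have "\<forall>\<^sub>F e::real in at_right 0. - Re (of_real e * (deriv (Lcont f) (Complex 1 t + of_real e) / Lcont f (Complex 1 t + of_real e)))
        = e * Re (dser (\<lambda>n. f n * mangoldt n) (Complex (1 + e) t))"
      using eventually_at_right_less[of 0]
    proof eventually_elim
      case (elim e)
      have a: "Complex 1 t + of_real e = Complex (1 + e) t" by (simp add: complex_eq_iff)
      show ?case unfolding a using deriv_Lcont(1)[of "Complex (1 + e) t"] elim by simp
    qed
    ultimately have "((\<lambda>e::real. e * Re (dser (\<lambda>n. f n * mangoldt n) (Complex (1 + e) t))) \<longlongrightarrow> - Re (of_nat k)) (at_right 0)"
      by (subst (asm) tendsto_cong) auto
    hence "k = 0" by (intro order_from_341[OF f t]) simp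
    thus ?thesis using k(2) s by simp
  qed
qed (use deriv_Lcont in auto)

end

text \<open>
  The holomorphic part \<open>\<zeta>(s) - 1 / (s - 1)\<close>, with the removable singularity filled in.
\<close>
definition zeta_rem :: "complex \<Rightarrow> complex" where
  "zeta_rem s = (if s = 1 then deriv zeta1 1 else (zeta1 s - zeta1 1) / (s - 1))"

lemma zeta_rem_holomorphic: "zeta_rem holomorphic_on {s. Re s > 0}"
  unfolding zeta_rem_def[abs_def]
  by (rule pole_lemma_open[OF zeta1_holomorphic open_Re_gt])

lemma open_nonzero:
  assumes "f holomorphic_on S" "open S"
  shows "open {s\<in>S. f s \<noteq> (0::complex)}"
proof -
  have "open (S \<inter> f -` (- {0}))"
    using assms by (intro continuous_open_preimage holomorphic_on_imp_continuous_on) auto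
  also have "S \<inter> f -` (- {0}) = {s\<in>S. f s \<noteq> 0}" by auto
  finally show ?thesis .
qed

lemma mangoldt_minus_1_sums:
  assumes s: "Re s > 1"
  shows "(\<lambda>n. of_real (mangoldt n - 1) * of_nat n powr (-s)) sums (- (deriv zeta1 s / zeta1 s) - zeta_rem s)"
proof -
  have "(\<lambda>n. of_real (mangoldt n) * of_nat n powr (-s) - of_real 1 * of_nat n powr (-s)) sums (dser mangoldt s - dser (\<lambda>_. 1) s)"
    using subpoly_mangoldt[OF unit_char_1] s subpoly_unit_char[OF unit_char_1] by (intro sums_diff dser_sums) auto
  moreover have "dser mangoldt s - dser (\<lambda>_. 1) s = - (deriv zeta1 s / zeta1 s) - zeta_rem s"
  proof -
    have "s \<noteq> 1" using s by auto
    hence "1 / (s - 1) - dser (\<lambda>_. 1) s = - zeta_rem s" by (simp add: zeta_rem_def zeta1_eq[OF s] field_simps)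
    thus ?thesis using deriv_zeta1(1)[OF s] by (simp add: algebra_simps)
  qed
  ultimately show ?thesis by (simp add: left_diff_distrib)
qed

text \<open>
  For \<open>Re s > 1\<close> the series with coefficients \<open>\<Lambda>(n) - 1\<close> is \<open>- \<zeta>' / \<zeta> - \<zeta>\<close>, in which the poles at \<open>1\<close>
  cancel.
\<close>
theorem PNT_mangoldt: "(\<lambda>n. (\<Sum>k=1..n. mangoldt k - 1) / real n) \<longlonglongrightarrow> 0"
proof (rule tauberian[where K = 5 and U = "{s\<in>{s. Re s > 0}. zeta1 s \<noteq> 0}" and J = "\<lambda>s. - (deriv zeta1 s / zeta1 s) - zeta_rem s"])
  show "\<bar>\<Sum>k=1..n. mangoldt k - 1\<bar> \<le> 5 * real n" for n
  proof -
    have "0 \<le> (\<Sum>k=1..n. mangoldt k :: real)" by (intro sum_nonneg mangoldt_nonneg)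
    thus ?thesis using chebyshev_upper[of n] by (simp add: sum_subtractf)
  qed
  show "open {s\<in>{s. Re s > 0}. zeta1 s \<noteq> 0}" by (rule open_nonzero[OF zeta1_holomorphic open_Re_gt])
  show "{s. 1 \<le> Re s} \<subseteq> {s\<in>{s. Re s > 0}. zeta1 s \<noteq> 0}" using zeta1_nonzero by auto
  have sub: "{s\<in>{s. Re s > 0}. zeta1 s \<noteq> 0} \<subseteq> {s. Re s > 0}" by blast
  note h = holomorphic_on_subset[OF zeta1_holomorphic sub] holomorphic_on_subset[OF zeta_rem_holomorphic sub]
    holomorphic_on_subset[OF holomorphic_deriv[OF zeta1_holomorphic open_Re_gt] sub]
  show "(\<lambda>s. - (deriv zeta1 s / zeta1 s) - zeta_rem s) holomorphic_on {s\<in>{s. Re s > 0}. zeta1 s \<noteq> 0}"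
    by (intro holomorphic_intros h) auto
  show "(\<lambda>n. of_real (mangoldt n - 1) * of_nat n powr (-s)) sums (- (deriv zeta1 s / zeta1 s) - zeta_rem s)"
    if "Re s > 1" for s by (rule mangoldt_minus_1_sums[OF that])
qed (simp_all add: mangoldt_nonneg)

text \<open>
  The Tauberian theorem needs nonnegative coefficients, therefore it is applied to
  \<open>(1 + f(n)) \<Lambda>(n)\<close>, and the case of \<open>\<Lambda>(n)\<close> is subtracted.
\<close>
theorem PNT_character:
  assumes f: "unit_char f" and C: "\<And>n. \<bar>\<Sum>k=1..n. f k\<bar> \<le> C"
  shows "(\<lambda>n. (\<Sum>k=1..n. f k * mangoldt k) / real n) \<longlonglongrightarrow> 0"
proof -
  let ?U = "{s\<in>{s\<in>{s. Re s > 0}. zeta1 s \<noteq> 0}. Lcont f s \<noteq> 0}"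
  have op: "open {s\<in>{s. Re s > 0}. zeta1 s \<noteq> 0}" by (rule open_nonzero[OF zeta1_holomorphic open_Re_gt])
  note Lh = Lcont_holomorphic[OF f C]
  have f1: "0 \<le> 1 + f n" "1 + f n \<le> 2" for n using unit_charD(4)[OF f, of n] by auto
  have "(\<lambda>n. (\<Sum>k=1..n. (1 + f k) * mangoldt k - 1) / real n) \<longlonglongrightarrow> 0"
  proof (rule tauberian[where K = 9 and U = ?U and J = "\<lambda>s. (- (deriv zeta1 s / zeta1 s) - zeta_rem s) - deriv (Lcont f) s / Lcont f s"])
    show "0 \<le> (1 + f n) * mangoldt n" for n
      by (intro mult_nonneg_nonneg f1 mangoldt_nonneg)
    show "\<bar>\<Sum>k=1..n. (1 + f k) * mangoldt k - 1\<bar> \<le> 9 * real n" for n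
    proof -
      have "0 \<le> (\<Sum>k=1..n. (1 + f k) * mangoldt k)"
        by (intro sum_nonneg mult_nonneg_nonneg f1 mangoldt_nonneg)
      moreover have "(\<Sum>k=1..n. (1 + f k) * mangoldt k) \<le> (\<Sum>k=1..n. 2 * mangoldt k)"
        by (intro sum_mono mult_right_mono f1 mangoldt_nonneg)
      ultimately show ?thesis using chebyshev_upper[of n] by (simp add: sum_subtractf sum_distrib_left[symmetric])
    qed
    show "open ?U"
    proof (rule open_nonzero[OF _ op])
      show "Lcont f holomorphic_on {s\<in>{s. Re s > 0}. zeta1 s \<noteq> 0}"
        by (rule holomorphic_on_subset[OF Lh]) blast
    qed
    show "{s. 1 \<le> Re s} \<subseteq> ?U" using zeta1_nonzero Lcont_nonzero[OF f C] by auto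
    have sub: "?U \<subseteq> {s. Re s > 0}" by blast
    note h = holomorphic_on_subset[OF zeta1_holomorphic sub] holomorphic_on_subset[OF zeta_rem_holomorphic sub]
      holomorphic_on_subset[OF holomorphic_deriv[OF zeta1_holomorphic open_Re_gt] sub]
      holomorphic_on_subset[OF Lh sub] holomorphic_on_subset[OF holomorphic_deriv[OF Lh open_Re_gt] sub]
    show "(\<lambda>s. (- (deriv zeta1 s / zeta1 s) - zeta_rem s) - deriv (Lcont f) s / Lcont f s) holomorphic_on ?U"
      by (intro holomorphic_intros h) auto
    fix s :: complex assume s: "Re s > 1"
    have "(\<lambda>n. of_real (mangoldt n - 1) * of_nat n powr (-s) + of_real (f n * mangoldt n) * of_nat n powr (-s))
        sums ((- (deriv zeta1 s / zeta1 s) - zeta_rem s) + dser (\<lambda>n. f n * mangoldt n) s)"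
      by (intro sums_add mangoldt_minus_1_sums s dser_sums subpoly_mangoldt f)
    also have "dser (\<lambda>n. f n * mangoldt n) s = - (deriv (Lcont f) s / Lcont f s)"
      using deriv_Lcont(1)[OF f C s] by simp
    finally show "(\<lambda>n. of_real ((1 + f n) * mangoldt n - 1) * of_nat n powr (-s))
       sums ((- (deriv zeta1 s / zeta1 s) - zeta_rem s) - deriv (Lcont f) s / Lcont f s)"
      by (simp add: algebra_simps)
  qed simp_all
  from tendsto_diff[OF this PNT_mangoldt]
  have "(\<lambda>n. (\<Sum>k=1..n. (1 + f k) * mangoldt k - 1) / real n - (\<Sum>k=1..n. mangoldt k - 1) / real n) \<longlonglongrightarrow> 0" by simp
  also have "(\<lambda>n. (\<Sum>k=1..n. (1 + f k) * mangoldt k - 1) / real n - (\<Sum>k=1..n. mangoldt k - 1) / real n) = (\<lambda>n. (\<Sum>k=1..n. f k * mangoldt k) / real n)"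
    by (auto simp: diff_divide_distrib[symmetric] sum_subtractf[symmetric] algebra_simps)
  finally show ?thesis .
qed

section \<open>The Legendre symbol\<close>

lemma Legendre_values: "Legendre a p \<in> {-1, 0, 1}"
  by (simp add: Legendre_def)

lemma Legendre_cong: "[a = b] (mod p) \<Longrightarrow> Legendre a p = Legendre b p"
  by (simp add: Legendre_def QuadRes_def cong_def)

lemma eq_if_cong_small:
  assumes "[x = y] (mod int p)" "p > 2" "x \<in> {-1, 0, 1::int}" "y \<in> {-1, 0, 1}"
  shows "x = y"
proof -
  have "int p dvd x - y" using assms(1) by (simp add: cong_iff_dvd_diff)
  moreover have "\<bar>x - y\<bar> < int p" using assms by auto
  ultimately show ?thesis using zdvd_imp_le[of "int p" "\<bar>x - y\<bar>"] by fastforce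
qed

lemma Legendre_mult:
  assumes "prime p" "p > 2"
  shows "Legendre (a * b) (int p) = Legendre a (int p) * Legendre b (int p)"
proof -
  note e = euler_criterion[OF assms]
  have "[Legendre a p * Legendre b p = a ^ ((p - 1) div 2) * b ^ ((p - 1) div 2)] (mod int p)"
    by (intro cong_mult e)
  hence "[Legendre (a * b) p = Legendre a p * Legendre b p] (mod int p)"
    using e[of "a * b"] by (metis cong_sym cong_trans power_mult_distrib)
  thus ?thesis
  proof (rule eq_if_cong_small[OF _ assms(2) Legendre_values])
    show "Legendre a (int p) * Legendre b (int p) \<in> {-1, 0, 1}"
      using Legendre_values[of a "int p"] Legendre_values[of b "int p"] by auto
  qed
qed

lemma Legendre_square:
  assumes "prime p" "\<not> int p dvd a" shows "Legendre (a\<^sup>2) (int p) = 1"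
proof -
  have "\<not> int p dvd a\<^sup>2" using assms prime_dvd_power[of "int p" a 2] by auto
  thus ?thesis unfolding Legendre_def QuadRes_def by (auto simp: cong_0_iff intro!: exI[of _ a])
qed

lemma Legendre_minus_1:
  assumes "prime p" "p > 2" shows "Legendre (-1) (int p) = (if p mod 4 = 1 then 1 else -1)"
proof -
  have "odd p" using assms prime_odd_nat by auto
  have "[Legendre (-1) p = (-1) ^ ((p - 1) div 2)] (mod int p)" by (rule euler_criterion[OF assms])
  hence "Legendre (-1) (int p) = (-1) ^ ((p - 1) div 2)"
    by (rule eq_if_cong_small[OF _ assms(2) Legendre_values]) (cases "even ((p - 1) div 2)"; simp)
  moreover have "even ((p - 1) div 2) \<longleftrightarrow> p mod 4 = 1" using \<open>odd p\<close> by presburger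
  ultimately show ?thesis by auto
qed

text \<open>
  Gauss's lemma: the residues \<open>2 x\<close> with \<open>x \<le> h = (p - 1) / 2\<close> that exceed \<open>h\<close> are those with
  \<open>x > h / 2\<close>.
\<close>
lemma Legendre_2:
  assumes "prime p" "p > 2" shows "Legendre 2 (int p) = (if p mod 8 = 1 \<or> p mod 8 = 7 then 1 else -1)"
proof -
  have op: "odd p" using assms prime_odd_nat by auto
  interpret GAUSS p 2
    using assms by unfold_locales (auto simp: cong_0_iff dest: zdvd_imp_le)
  define h where "h = (p - 1) div 2"
  have h: "(int p - 1) div 2 = int h" "p = 2 * h + 1" using op assms by (auto simp: h_def of_nat_diff zdiv_int)
  have "E = (\<lambda>x. 2 * int x) ` {h div 2<..h}"
  proof
    show "E \<subseteq> (\<lambda>x. 2 * int x) ` {h div 2<..h}"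
    proof
      fix z assume "z \<in> E"
      then obtain x where x: "x \<in> {0<..int h}" "z = (x * 2) mod int p" "z > int h"
        unfolding E_def C_def B_def A_def h(1) by auto
      have "(x * 2) mod int p = x * 2" using x(1) h(2) by (intro mod_pos_pos_trivial) auto
      hence "z = 2 * int (nat x)" "nat x \<in> {h div 2<..h}" using x by auto
      thus "z \<in> (\<lambda>x. 2 * int x) ` {h div 2<..h}" by blast
    qed
    show "(\<lambda>x. 2 * int x) ` {h div 2<..h} \<subseteq> E"
    proof safe
      fix x assume x: "x \<in> {h div 2<..h}"
      have "(int x * 2) mod int p = int x * 2" using x h(2) by (intro mod_pos_pos_trivial) auto
      hence "2 * int x \<in> C" unfolding C_def B_def A_def h(1) using x by (auto simp: image_image intro!: image_eqI[of _ _ "int x"])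
      thus "2 * int x \<in> E" unfolding E_def h(1) using x by auto
    qed
  qed
  hence "card E = h - h div 2" by (simp add: card_image inj_on_def)
  hence L: "Legendre 2 (int p) = (-1) ^ (h - h div 2)" using gauss_lemma by simp
  have "even (h - h div 2) \<longleftrightarrow> (p mod 8 = 1 \<or> p mod 8 = 7)"
  proof -
    define k r where "k = h div 4" and "r = h mod 4"
    have hk: "h = 4 * k + r" "r < 4" by (auto simp: k_def r_def)
    hence "r = 0 \<or> r = 1 \<or> r = 2 \<or> r = 3" by auto
    moreover have "(2 * (4 * k + r) + 1) mod 8 = (2 * r + 1) mod 8"
      using mod_mult_self4[of 8 k "2 * r + 1"] by (simp add: algebra_simps)
    moreover have "(4 * k + r) - (4 * k + r) div 2 = 2 * k + (r - r div 2)"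
      using div_mult_self4[of 2 "2 * k" r] by simp
    ultimately show ?thesis unfolding h(2) hk(1) by auto
  qed
  thus ?thesis unfolding L by auto
qed

text \<open>
  Otherwise squaring would permute the nonzero residues, but \<open>1\<close> and \<open>q - 1\<close> have the same square.
\<close>
lemma exists_nonresidue:
  assumes "prime q" "q > 2" obtains r :: nat where "Legendre (int r) (int q) = -1"
proof (rule ccontr)
  assume no: "\<not> thesis"
  let ?S = "{1..q-1}"
  let ?sq = "\<lambda>x. x\<^sup>2 mod q"
  have "?S \<subseteq> ?sq ` ?S"
  proof
    fix r assume r: "r \<in> ?S"
    have nz: "\<not> q dvd r" using r by (auto dest: dvd_imp_le)
    have "Legendre (int r) (int q) \<noteq> -1" using no that by blast
    hence "QuadRes (int q) (int r)" using nz by (auto simp: Legendre_def cong_0_iff split: if_splits)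
    then obtain y where y: "[y\<^sup>2 = int r] (mod int q)" by (auto simp: QuadRes_def)
    define x where "x = nat (y mod int q)"
    have x: "int x = y mod int q" using assms by (simp add: x_def)
    have "[(int x)\<^sup>2 = int r] (mod int q)" unfolding x using y by (simp add: cong_def power_mod)
    hence "[x\<^sup>2 = r] (mod q)" by (simp flip: cong_int_iff)
    hence e: "?sq x = r" using r assms by (auto simp: cong_def)
    moreover have "x < q" using assms x by (metis of_nat_less_iff of_nat_0_less_iff pos_mod_bound prime_gt_0_nat)
    moreover have "x \<noteq> 0" using e r by (cases "x = 0") simp_all
    ultimately show "r \<in> ?sq ` ?S" by (auto intro!: image_eqI[of _ _ x])
  qed
  hence "card ?S \<le> card (?sq ` ?S)" by (intro card_mono) auto
  hence "card (?sq ` ?S) = card ?S" using card_image_le[of ?S ?sq] by simp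
  hence "inj_on ?sq ?S" by (intro eq_card_imp_inj_on) auto
  note inj = this
  have sq: "?sq 1 = ?sq (q - 1)"
  proof -
    have "(int (q - 1))\<^sup>2 = int q * (int q - 2) + 1" using assms by (simp add: of_nat_diff power2_eq_square algebra_simps)
    hence "[(int (q - 1))\<^sup>2 = 1\<^sup>2] (mod int q)" by (simp add: cong_def)
    hence "[(q - 1)\<^sup>2 = 1\<^sup>2] (mod q)" by (simp flip: cong_int_iff)
    thus ?thesis by (simp add: cong_def)
  qed
  have "1 = q - 1" by (rule inj_onD[OF inj sq]) (use assms in auto)
  thus False using assms by simp
qed

section \<open>Quadratic characters\<close>

definition chi_odd :: "nat \<Rightarrow> real" where "chi_odd n = (if even n then 0 else 1)"
definition chi_m1 :: "nat \<Rightarrow> real" where "chi_m1 n = (if even n then 0 else if n mod 4 = 1 then 1 else -1)"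
definition chi_2 :: "nat \<Rightarrow> real" where "chi_2 n = (if even n then 0 else if n mod 8 = 1 \<or> n mod 8 = 7 then 1 else -1)"
text \<open>
  The character whose value at an odd prime \<open>p\<close> other than \<open>q\<close> is \<open>Legendre q p\<close>. For odd \<open>q\<close> this is
  \<open>Legendre p q\<close> by reciprocity, corrected for \<open>q\<close> congruent to \<open>3\<close> modulo \<open>4\<close> by the character modulo \<open>4\<close>.
\<close>
definition chi_prime :: "nat \<Rightarrow> nat \<Rightarrow> real" where
  "chi_prime q n = (if q = 2 then chi_2 n else of_int (Legendre (int n) (int q)) * (if q mod 4 = 1 then chi_odd n else chi_m1 n))"
text \<open>
  The character of the squarefree integer with prime factors \<open>Q\<close>, taken negative if \<open>neg\<close>. The first
  factor accounts for the sign.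
\<close>
definition chi_quad :: "bool \<Rightarrow> nat set \<Rightarrow> nat \<Rightarrow> real" where
  "chi_quad neg Q n = (if neg then chi_m1 n else chi_odd n) * (\<Prod>q\<in>Q. chi_prime q n)"

lemma unit_char_mult: "unit_char f \<Longrightarrow> unit_char g \<Longrightarrow> unit_char (\<lambda>n. f n * g n)"
proof -
  assume f: "unit_char f" and g: "unit_char g"
  have "f n * g n \<in> {-1, 0, 1}" for n
  proof -
    have "f n \<in> {-1, 0, 1}" "g n \<in> {-1, 0, 1}" using f g unfolding unit_char_def by blast+
    thus ?thesis by auto
  qed
  moreover have "f 1 * g 1 = 1" "f (m * n) * g (m * n) = f m * g m * (f n * g n)" for m n
    using f g unfolding unit_char_def by simp_all
  ultimately show ?thesis unfolding unit_char_def by blast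
qed

lemma unit_char_chi_odd: "unit_char chi_odd"
  by (auto simp: unit_char_def chi_odd_def)

lemma odd_mod_4: "odd (n::nat) \<Longrightarrow> n mod 4 = 1 \<or> n mod 4 = 3" by presburger
lemma odd_mod_8: "odd (n::nat) \<Longrightarrow> n mod 8 = 1 \<or> n mod 8 = 3 \<or> n mod 8 = 5 \<or> n mod 8 = 7" by presburger

lemma unit_char_chi_m1: "unit_char chi_m1"
proof -
  have "chi_m1 (m * n) = chi_m1 m * chi_m1 n" for m n
  proof (cases "odd m \<and> odd n")
    case True
    have "(m * n) mod 4 = ((m mod 4) * (n mod 4)) mod 4" by (simp add: mod_mult_eq)
    thus ?thesis using True odd_mod_4[of m] odd_mod_4[of n] by (auto simp: chi_m1_def)
  qed (auto simp: chi_m1_def)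
  moreover have "chi_m1 n \<in> {-1, 0, 1}" "chi_m1 1 = 1" for n by (simp_all add: chi_m1_def)
  ultimately show ?thesis unfolding unit_char_def by blast
qed

lemma unit_char_chi_2: "unit_char chi_2"
proof -
  have "chi_2 (m * n) = chi_2 m * chi_2 n" for m n
  proof (cases "odd m \<and> odd n")
    case True
    have "(m * n) mod 8 = ((m mod 8) * (n mod 8)) mod 8" by (simp add: mod_mult_eq)
    thus ?thesis using True odd_mod_8[of m] odd_mod_8[of n] by (auto simp: chi_2_def)
  qed (auto simp: chi_2_def)
  moreover have "chi_2 n \<in> {-1, 0, 1}" "chi_2 1 = 1" for n by (simp_all add: chi_2_def)
  ultimately show ?thesis unfolding unit_char_def by blast
qed

lemma unit_char_Legendre:
  assumes "prime q" "q > 2" shows "unit_char (\<lambda>n. of_int (Legendre (int n) (int q)))"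
proof -
  have "Legendre 1 (int q) = 1" using Legendre_square[of q 1] assms by auto
  moreover have "real_of_int (Legendre a q) \<in> {-1, 0, 1}" for a using Legendre_values[of a q] by auto
  ultimately show ?thesis using Legendre_mult[OF assms] by (simp add: unit_char_def)
qed

lemma unit_char_chi_prime:
  assumes "prime q" shows "unit_char (chi_prime q)"
proof (cases "q = 2")
  case True thus ?thesis using unit_char_chi_2 by (simp add: chi_prime_def[abs_def])
next
  case False
  hence "q > 2" using prime_ge_2_nat[OF assms] by simp
  show ?thesis using False unit_char_mult[OF unit_char_Legendre[OF assms \<open>q > 2\<close>] unit_char_chi_odd]
     unit_char_mult[OF unit_char_Legendre[OF assms \<open>q > 2\<close>] unit_char_chi_m1]
    by (cases "q mod 4 = 1") (simp_all add: chi_prime_def[abs_def])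
qed

lemma unit_char_chi_quad:
  assumes "finite Q" "\<And>q. q \<in> Q \<Longrightarrow> prime q" shows "unit_char (chi_quad neg Q)"
proof -
  have "unit_char (\<lambda>n. \<Prod>q\<in>Q. chi_prime q n)" using assms
    by (induction Q rule: finite_induct) (auto intro!: unit_char_mult unit_char_chi_prime simp: unit_char_def[of "\<lambda>_. 1"])
  thus ?thesis using unit_char_mult[OF unit_char_chi_m1] unit_char_mult[OF unit_char_chi_odd]
    by (cases neg) (simp_all add: chi_quad_def[abs_def])
qed

lemma chi_prime_cong:
  assumes "[m = n] (mod 8)" "[m = n] (mod q)" shows "chi_prime q m = chi_prime q n"
proof -
  have 4: "[m = n] (mod 4)" using cong_modulus_mult_nat[of m n 4 2] assms(1) by simp
  have 2: "[m = n] (mod 2)" using cong_modulus_mult_nat[of m n 2 4] assms(1) by simp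
  have "even m = even n" using 2 by (simp add: cong_def even_iff_mod_2_eq_zero)
  moreover have "Legendre (int m) (int q) = Legendre (int n) (int q)"
    using assms(2) by (intro Legendre_cong) (simp add: cong_int_iff)
  ultimately show ?thesis using assms(1) 4 by (simp add: chi_prime_def chi_2_def chi_odd_def chi_m1_def cong_def)
qed

lemma chi_sign_cong:
  assumes "[m = n] (mod 8)"
  shows "chi_m1 m = chi_m1 n" "chi_odd m = chi_odd n"
proof -
  have 4: "[m = n] (mod 4)" using cong_modulus_mult_nat[of m n 4 2] assms(1) by simp
  have 2: "[m = n] (mod 2)" using cong_modulus_mult_nat[of m n 2 4] assms(1) by simp
  have "even m = even n" using 2 by (simp add: cong_def even_iff_mod_2_eq_zero)
  thus "chi_m1 m = chi_m1 n" "chi_odd m = chi_odd n" using 4 by (simp_all add: chi_odd_def chi_m1_def cong_def)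
qed

lemma chi_quad_cong:
  assumes "[m = n] (mod (8 * \<Prod>Q))" "finite Q" shows "chi_quad neg Q m = chi_quad neg Q n"
proof -
  have 8: "[m = n] (mod 8)" using assms(1) cong_modulus_mult_nat by blast
  have "chi_prime q m = chi_prime q n" if "q \<in> Q" for q
  proof (rule chi_prime_cong[OF 8])
    have "q dvd 8 * \<Prod>Q" using that assms(2) by (intro dvd_mult dvd_prodI)
    thus "[m = n] (mod q)" using assms(1) cong_dvd_modulus_nat by blast
  qed
  thus ?thesis using chi_sign_cong[OF 8] by (simp add: chi_quad_def)
qed

lemma chi_prime_Legendre:
  assumes "prime p" "p > 2" "prime q" "p \<noteq> q"
  shows "chi_prime q p = of_int (Legendre (int q) (int p))"
proof -
  have op: "odd p" using assms prime_odd_nat by auto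
  show ?thesis
  proof (cases "q = 2")
    case True
    thus ?thesis using Legendre_2[OF assms(1,2)] op by (simp add: chi_prime_def chi_2_def)
  next
    case False
    hence q2: "q > 2" using prime_ge_2_nat[OF assms(3)] by simp
    hence oq: "odd q" using assms prime_odd_nat by auto
    let ?a = "Legendre (int p) (int q)" and ?b = "Legendre (int q) (int p)"
    have R: "?a * ?b = (-1) ^ ((p - 1) div 2 * ((q - 1) div 2))"
      by (rule Quadratic_Reciprocity[OF assms(1,2,3) q2 assms(4)])
    have "even ((p - 1) div 2) \<longleftrightarrow> p mod 4 = 1" "even ((q - 1) div 2) \<longleftrightarrow> q mod 4 = 1" using op oq by presburger+
    hence S: "(-1) ^ ((p - 1) div 2 * ((q - 1) div 2)) = (if q mod 4 = 1 \<or> p mod 4 = 1 then 1 else (-1::int))" by auto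
    have "?b = ?a * (if q mod 4 = 1 \<or> p mod 4 = 1 then 1 else -1)"
      using R Legendre_values[of "int p" "int q"] unfolding S by (auto split: if_splits)
    thus ?thesis using False op by (auto simp: chi_prime_def chi_odd_def chi_m1_def)
  qed
qed

lemma Legendre_prod:
  assumes "prime p" "p > 2" "finite Q"
  shows "Legendre (int (\<Prod>Q)) (int p) = (\<Prod>q\<in>Q. Legendre (int q) (int p))"
  using assms(3)
proof (induction Q rule: finite_induct)
  case empty
  show ?case using Legendre_square[of p 1] assms(1,2) by auto
qed (simp add: Legendre_mult[OF assms(1,2)])

lemma chi_quad_Legendre:
  assumes p: "prime p" "p > 2" "p \<notin> Q" and Q: "finite Q" "\<And>q. q \<in> Q \<Longrightarrow> prime q"
  shows "chi_quad neg Q p = of_int (Legendre ((if neg then -1 else 1) * int (\<Prod>Q)) (int p))"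
proof -
  have op: "odd p" using p prime_odd_nat by auto
  have "(\<Prod>q\<in>Q. chi_prime q p) = of_int (Legendre (int (\<Prod>Q)) (int p))"
    unfolding Legendre_prod[OF p(1,2) Q(1)] of_int_prod
    by (intro prod.cong refl chi_prime_Legendre) (use p Q in auto)
  moreover have "(if neg then chi_m1 p else chi_odd p) = of_int (Legendre (if neg then -1 else 1) (int p))"
    using op Legendre_minus_1[OF p(1,2)] Legendre_square[of p 1] p by (auto simp: chi_m1_def chi_odd_def)
  ultimately show ?thesis by (simp add: chi_quad_def Legendre_mult[OF p(1,2)])
qed

text \<open>
  If \<open>Q\<close> contains an odd prime \<open>q\<close>, the Chinese remainder theorem provides a number that is a
  non-residue modulo \<open>q\<close> and congruent to \<open>1\<close> modulo \<open>8\<close> and modulo the other primes of \<open>Q\<close>; all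
  other factors of the character are \<open>1\<close> there. The remaining characters are those of \<open>-1\<close>, \<open>2\<close> and
  \<open>-2\<close>, with the values \<open>-1\<close> at \<open>3\<close>, \<open>5\<close> and \<open>5\<close>.
\<close>
lemma chi_quad_nonprincipal:
  assumes Q: "finite Q" "\<And>q. q \<in> Q \<Longrightarrow> prime q" and ne: "neg \<or> Q \<noteq> {}"
  obtains n where "coprime n (8 * \<Prod>Q)" "chi_quad neg Q n = -1"
proof -
  have one: "chi_prime q 1 = 1" if "q \<in> Q" for q using unit_char_chi_prime[OF Q(2)[OF that]] by (simp add: unit_char_def)
  show ?thesis
  proof (cases "Q \<subseteq> {2}")
    case True
    then consider "Q = {}" | "Q = {2}" by blast
    thus ?thesis
    proof cases
      case 1
      hence "chi_quad neg Q 3 = -1" using ne by (simp add: chi_quad_def chi_m1_def)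
      moreover have "coprime 3 (8 * \<Prod>Q)" using 1 by (simp add: coprime_iff_gcd_eq_1 gcd_nat.simps)
      ultimately show ?thesis using that by blast
    next
      case 2
      hence "chi_quad neg Q 5 = -1" by (simp add: chi_quad_def chi_m1_def chi_odd_def chi_prime_def chi_2_def)
      moreover have "coprime 5 (8 * \<Prod>Q)" using 2 by (simp add: coprime_iff_gcd_eq_1 gcd_nat.simps)
      ultimately show ?thesis using that by blast
    qed
  next
    case False
    then obtain q where q: "q \<in> Q" "q \<noteq> 2" by blast
    have pq: "prime q" "q > 2" using Q(2)[OF q(1)] prime_ge_2_nat[of q] q(2) by auto
    obtain r where r: "Legendre (int r) (int q) = -1" by (rule exists_nonresidue[OF pq])
    define m where "m = 8 * \<Prod>(Q - {q})"
    have mq: "8 * \<Prod>Q = m * q" using prod.remove[OF Q(1) q(1), of "\<lambda>x. x"] by (simp add: m_def)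
    have cq: "coprime q (\<Prod>(Q - {q}))"
      by (intro prod_coprime_right) (use pq Q(2) primes_coprime in auto)
    have c8: "coprime q 8"
    proof -
      have "odd q" using pq prime_odd_nat by auto
      hence "coprime q (2 ^ 3)" by (subst coprime_power_right_iff) simp
      thus ?thesis by simp
    qed
    have "coprime m q" using cq c8 by (simp add: m_def coprime_commute)
    then obtain n where n: "[n = 1] (mod m)" "[n = r] (mod q)" using binary_chinese_remainder_nat by blast
    have n8: "[n = 1] (mod 8)" using n(1) unfolding m_def using cong_modulus_mult_nat by blast
    have "chi_prime q' n = 1" if "q' \<in> Q - {q}" for q'
    proof -
      have "q' dvd m" unfolding m_def using that Q(1) by (intro dvd_mult dvd_prodI) auto
      hence "[n = 1] (mod q')" using n(1) cong_dvd_modulus_nat by blast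
      thus ?thesis using chi_prime_cong[OF n8] one that by auto
    qed
    hence "(\<Prod>q'\<in>Q - {q}. chi_prime q' n) = 1" by simp
    moreover have "chi_prime q n = -1"
    proof -
      have "Legendre (int n) (int q) = Legendre (int r) (int q)" using n(2) by (intro Legendre_cong) (simp add: cong_int_iff)
      thus ?thesis using r pq chi_sign_cong[OF n8] by (simp add: chi_prime_def chi_m1_def chi_odd_def)
    qed
    moreover have "(if neg then chi_m1 n else chi_odd n) = 1" using chi_sign_cong[OF n8] by (simp add: chi_m1_def chi_odd_def)
    ultimately have "chi_quad neg Q n = -1"
      unfolding chi_quad_def by (simp add: prod.remove[OF Q(1) q(1)])
    moreover have "coprime n (8 * \<Prod>Q)"
    proof -
      have "coprime n m" using n(1) cong_imp_coprime cong_sym coprime_1_left by blast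
      moreover have "\<not> q dvd r"
      proof
        assume "q dvd r"
        hence "Legendre (int r) (int q) = 0" by (simp add: Legendre_def cong_0_iff)
        thus False using r by simp
      qed
      hence "coprime n q" using n(2) pq cong_imp_coprime cong_sym prime_imp_coprime coprime_commute by metis
      ultimately show ?thesis unfolding mq by simp
    qed
    ultimately show ?thesis using that by blast
  qed
qed

text \<open>
  Multiplication by \<open>n0\<close> permutes the residues and changes the sign of \<open>f\<close>, so the sum over a period
  is \<open>0\<close>.
\<close>
lemma character_partial_sums_bounded:
  fixes f :: "nat \<Rightarrow> real"
  assumes f: "unit_char f" and per: "\<And>a b. [a = b] (mod m) \<Longrightarrow> f a = f b" and m: "m > 0"
    and n0: "coprime n0 m" "f n0 = -1"
  shows "\<bar>\<Sum>k=1..n. f k\<bar> \<le> real m"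
proof -
  have bij: "bij_betw (\<lambda>k. n0 * k mod m) {..<m} {..<m}"
  proof (rule bij_betwI')
    show "(n0 * x mod m = n0 * y mod m) = (x = y)" if "x \<in> {..<m}" "y \<in> {..<m}" for x y
    proof
      assume "n0 * x mod m = n0 * y mod m"
      hence "[n0 * x = n0 * y] (mod m)" by (simp add: cong_def)
      hence "[x = y] (mod m)" using n0(1) cong_mult_lcancel_nat by blast
      thus "x = y" using that by (simp add: cong_def)
    qed auto
    show "n0 * x mod m \<in> {..<m}" for x using m by simp
    fix y assume y: "y \<in> {..<m}"
    obtain i where i: "[n0 * i = Suc 0] (mod m)" using cong_solve_coprime_nat[OF n0(1)] by blast
    have "[n0 * (i * y mod m) = n0 * i * y] (mod m)" by (simp add: cong_def mod_mult_right_eq mult.assoc)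
    moreover have "[n0 * i * y = Suc 0 * y] (mod m)" by (rule cong_mult[OF i cong_refl])
    ultimately have "[n0 * (i * y mod m) = y] (mod m)" using cong_trans by (simp only: mult_1 One_nat_def[symmetric]) blast
    thus "\<exists>x\<in>{..<m}. y = n0 * x mod m" using y m by (intro bexI[of _ "i * y mod m"]) (auto simp: cong_def)
  qed
  have "(\<Sum>k<m. f k) = (\<Sum>k<m. f (n0 * k mod m))" by (rule sum.reindex_bij_betw[OF bij, symmetric])
  also have "\<dots> = (\<Sum>k<m. f n0 * f k)"
  proof (intro sum.cong refl)
    fix k
    have "f (n0 * k mod m) = f (n0 * k)" by (rule per) (simp add: cong_def)
    thus "f (n0 * k mod m) = f n0 * f k" using f by (simp add: unit_char_def)
  qed
  finally have S0: "(\<Sum>k<m. f k) = 0" using n0(2) by (simp add: sum_negf)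
  have window: "(\<Sum>k\<in>{n..<n + m}. f k) = 0" for n
  proof (induction n)
    case 0
    thus ?case using S0 by (simp add: lessThan_atLeast0)
  next
    case (Suc n)
    have "(\<Sum>k\<in>{n..<Suc (n + m)}. f k) = f n + (\<Sum>k\<in>{Suc n..<Suc n + m}. f k)" by (subst sum.atLeast_Suc_lessThan) auto
    moreover have "(\<Sum>k\<in>{n..<Suc (n + m)}. f k) = (\<Sum>k\<in>{n..<n + m}. f k) + f (n + m)" by simp
    moreover have "f (n + m) = f n" by (rule per) (simp add: cong_def)
    ultimately show ?case using Suc by simp
  qed
  show ?thesis
  proof (induction n rule: less_induct)
    case (less n)
    show ?case
    proof (cases "n \<le> m")
      case True
      have "\<bar>\<Sum>k=1..n. f k\<bar> \<le> (\<Sum>k=1..n. 1)"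
      proof (rule order_trans[OF sum_abs sum_mono])
        fix k
        have "f k \<in> {-1, 0, 1}" using f by (simp add: unit_char_def)
        thus "\<bar>f k\<bar> \<le> 1" by auto
      qed
      thus ?thesis using True by simp
    next
      case False
      have "{1..n} = {1..n-m} \<union> {Suc (n-m)..<Suc (n-m) + m}" using False by auto
      hence "(\<Sum>k=1..n. f k) = (\<Sum>k=1..n-m. f k) + (\<Sum>k\<in>{Suc (n-m)..<Suc (n-m) + m}. f k)"
        by (simp only:) (rule sum.union_disjoint, auto)
      hence "(\<Sum>k=1..n. f k) = (\<Sum>k=1..n-m. f k)" by (simp only: window add_0_right)
      thus ?thesis using less.IH[of "n - m"] False m by simp
    qed
  qed
qed

text \<open>
  Square factors of \<open>D\<close> do not change the Legendre symbol at primes that do not divide \<open>D\<close>, so the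
  character is that of the squarefree part with the sign of \<open>D\<close>.
\<close>
theorem quadratic_character_exists:
  fixes D :: int
  assumes D: "\<not> (\<exists>k. D = k\<^sup>2)"
  obtains f :: "nat \<Rightarrow> real" and C where "unit_char f" "\<And>n. \<bar>\<Sum>k=1..n. f k\<bar> \<le> C"
    "\<And>p. prime p \<Longrightarrow> p > 2 \<Longrightarrow> \<not> int p dvd D \<Longrightarrow> f p = of_int (Legendre D (int p))"
proof -
  define N where "N = nat \<bar>D\<bar>"
  define k :: nat where "k = square_part N"
  define Q :: "nat set" where "Q = prime_factors (squarefree_part N)"
  have Dn: "D \<noteq> 0" using D by (metis zero_power2)
  hence N0: "N \<noteq> 0" by (simp add: N_def)
  have Q: "finite Q" "\<And>q. q \<in> Q \<Longrightarrow> prime q" by (auto simp: Q_def in_prime_factors_iff)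
  have "(squarefree_part N :: nat) = (\<Prod>q\<in>Q. q ^ multiplicity q (squarefree_part N))"
    using prod_prime_factors[of "squarefree_part N :: nat", OF squarefree_part_nonzero] by (simp add: Q_def)
  also have "\<dots> = \<Prod>Q"
  proof (rule prod.cong)
    fix q assume "q \<in> Q"
    hence "multiplicity q (squarefree_part N) > 0" "prime q"
      by (auto simp: Q_def prime_factors_multiplicity)
    hence "multiplicity q (squarefree_part N) = 1" by (simp add: prime_multiplicity_squarefree_part)
    thus "q ^ multiplicity q (squarefree_part N) = q" by simp
  qed auto
  finally have NQ: "N = \<Prod>Q * k\<^sup>2" using squarefree_decompose[of N] by (simp add: k_def)
  have "D = (if D < 0 then -1 else 1) * int N" by (simp add: N_def)
  hence Deq: "D = (if D < 0 then -1 else 1) * int (\<Prod>Q) * (int k)\<^sup>2" by (simp add: NQ mult.assoc)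
  have "D < 0 \<or> Q \<noteq> {}"
  proof (rule ccontr)
    assume "\<not> (D < 0 \<or> Q \<noteq> {})"
    hence "D = (int k)\<^sup>2" using Deq by simp
    thus False using D by blast
  qed
  then obtain n0 where n0: "coprime n0 (8 * \<Prod>Q)" "chi_quad (D < 0) Q n0 = -1"
    using chi_quad_nonprincipal[OF Q] by metis
  have m: "8 * \<Prod>Q > 0" using Q by (auto intro!: prod_pos prime_gt_0_nat)
  show ?thesis
  proof (rule that[of "chi_quad (D < 0) Q" "real (8 * \<Prod>Q)"])
    show u: "unit_char (chi_quad (D < 0) Q)" by (rule unit_char_chi_quad[OF Q])
    show "\<bar>\<Sum>k=1..n. chi_quad (D < 0) Q k\<bar> \<le> real (8 * \<Prod>Q)" for n
      by (rule character_partial_sums_bounded[OF u chi_quad_cong[OF _ Q(1)] m n0])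
    fix p assume p: "prime p" "p > 2" "\<not> int p dvd D"
    have "p \<notin> Q"
    proof
      assume "p \<in> Q"
      hence "int p dvd int (\<Prod>Q)" using Q(1) by (simp only: of_nat_dvd_iff) (rule dvd_prodI, auto)
      hence "int p dvd D" by (subst Deq) simp
      thus False using p by simp
    qed
    moreover have "\<not> int p dvd int k"
    proof
      assume "int p dvd int k"
      hence "int p dvd (int k)\<^sup>2" by (simp add: power2_eq_square del: of_nat_dvd_iff)
      hence "int p dvd D" by (subst Deq) (rule dvd_mult)
      thus False using p by simp
    qed
    ultimately show "chi_quad (D < 0) Q p = of_int (Legendre D (int p))"
      by (subst (2) Deq) (simp add: Legendre_mult[OF p(1,2)] Legendre_square[OF p(1)] chi_quad_Legendre[OF p(1,2) _ Q])
  qed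
qed

section \<open>From prime powers to counts of primes\<close>

text \<open>
  A prime power \<open>p^k\<close> up to \<open>N\<close> with \<open>k \<ge> 2\<close> has \<open>p \<le> sqrt N\<close> and \<open>k \<le> log 2 N\<close>.
\<close>
lemma sum_mangoldt_nonprime_le:
  assumes N: "N \<ge> 1"
  shows "(\<Sum>n\<in>{n\<in>{1..N}. \<not> prime n}. mangoldt n) \<le> sqrt (real N) * log 2 (real N) * ln (real N)"
proof -
  define s l where "s = nat \<lfloor>sqrt (real N)\<rfloor>" and "l = nat \<lfloor>log 2 (real N)\<rfloor>"
  let ?X = "{n\<in>{1..N}. \<not> prime n \<and> primepow n}"
  have "?X \<subseteq> (\<lambda>(p, k). p ^ k) ` ({1..s} \<times> {1..l})"
  proof
    fix n assume n: "n \<in> ?X"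
    then obtain p k where pk: "prime p" "k > 0" "n = p ^ k" by (auto simp: primepow_def)
    have "k \<noteq> 1" using n pk by auto
    hence k: "k \<ge> 2" using pk by simp
    have p2: "p \<ge> 2" using pk prime_ge_2_nat by blast
    have "p\<^sup>2 \<le> p ^ k" using k p2 by (intro power_increasing) auto
    hence "real p ^ 2 \<le> real N" using n pk by (simp flip: of_nat_power)
    hence "real p \<le> sqrt (real N)" by (rule real_le_rsqrt)
    hence ps: "p \<le> s" unfolding s_def by (simp add: le_nat_floor)
    have "2 ^ k \<le> p ^ k" using p2 by (intro power_mono) auto
    hence "2 ^ k \<le> real N" using n pk by (metis (mono_tags, lifting) atLeastAtMost_iff le_trans mem_Collect_eq of_nat_le_iff of_nat_numeral of_nat_power)
    hence "real k \<le> log 2 (real N)" using N by (simp add: le_log_iff powr_realpow)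
    hence "k \<le> l" unfolding l_def by (simp add: le_nat_floor)
    thus "n \<in> (\<lambda>(p, k). p ^ k) ` ({1..s} \<times> {1..l})" using pk ps p2 by (auto intro!: image_eqI[of _ _ "(p, k)"])
  qed
  hence "card ?X \<le> card ({1..s} \<times> {1..l})"
    using card_mono[of "(\<lambda>(p, k). p ^ k) ` ({1..s} \<times> {1..l})" ?X] card_image_le[of "{1..s} \<times> {1..l}" "\<lambda>(p, k). p ^ k"] by simp
  hence "real (card ?X) \<le> real s * real l" by (simp flip: of_nat_mult)
  also have "\<dots> \<le> sqrt (real N) * log 2 (real N)"
    using N by (intro mult_mono) (auto simp: s_def l_def)
  finally have card: "real (card ?X) \<le> sqrt (real N) * log 2 (real N)" .
  have "(\<Sum>n\<in>{n\<in>{1..N}. \<not> prime n}. mangoldt n :: real) = (\<Sum>n\<in>?X. mangoldt n)"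
    by (rule sum.mono_neutral_right) (auto simp: mangoldt_def)
  also have "\<dots> \<le> (\<Sum>n\<in>?X. ln (real N))"
  proof (rule sum_mono)
    fix n assume "n \<in> ?X"
    hence n: "n > 0" "n \<le> N" by auto
    have "mangoldt n \<le> ln (real n)" using n(1) by (rule mangoldt_le)
    also have "\<dots> \<le> ln (real N)" using n by simp
    finally show "mangoldt n \<le> ln (real N)" .
  qed
  also have "\<dots> = real (card ?X) * ln (real N)" by simp
  also have "\<dots> \<le> sqrt (real N) * log 2 (real N) * ln (real N)" using card N by (intro mult_right_mono) auto
  finally show ?thesis .
qed

lemma theta_tendsto:
  fixes f :: "nat \<Rightarrow> real"
  assumes f: "\<And>n. \<bar>f n\<bar> \<le> 1" and lim: "(\<lambda>n. (\<Sum>k=1..n. f k * mangoldt k) / real n) \<longlonglongrightarrow> c"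
  shows "(\<lambda>N. (\<Sum>p | prime p \<and> p \<le> N. f p * ln (real p)) / real N) \<longlonglongrightarrow> c"
proof -
  let ?\<psi> = "\<lambda>N. \<Sum>k=1..N. f k * mangoldt k" and ?\<theta> = "\<lambda>N. \<Sum>p | prime p \<and> p \<le> N. f p * ln (real p)"
  have diff: "\<bar>?\<psi> N - ?\<theta> N\<bar> \<le> sqrt (real N) * log 2 (real N) * ln (real N)" if N: "N \<ge> 1" for N
  proof -
    have U: "{p. prime p \<and> p \<le> N} \<union> {n\<in>{1..N}. \<not> prime n} = {1..N}"
      by (auto dest: prime_gt_0_nat simp: Suc_le_eq)
    have "(\<Sum>k\<in>{p. prime p \<and> p \<le> N} \<union> {n\<in>{1..N}. \<not> prime n}. f k * mangoldt k)
        = (\<Sum>p | prime p \<and> p \<le> N. f p * mangoldt p) + (\<Sum>n\<in>{n\<in>{1..N}. \<not> prime n}. f n * mangoldt n)"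
      by (rule sum.union_disjoint) auto
    hence "?\<psi> N = (\<Sum>p | prime p \<and> p \<le> N. f p * mangoldt p) + (\<Sum>n\<in>{n\<in>{1..N}. \<not> prime n}. f n * mangoldt n)"
      unfolding U .
    also have "(\<Sum>p | prime p \<and> p \<le> N. f p * mangoldt p) = ?\<theta> N" by (intro sum.cong) auto
    finally have "\<bar>?\<psi> N - ?\<theta> N\<bar> = \<bar>\<Sum>n\<in>{n\<in>{1..N}. \<not> prime n}. f n * mangoldt n\<bar>" by simp
    also have "\<dots> \<le> (\<Sum>n\<in>{n\<in>{1..N}. \<not> prime n}. mangoldt n)"
    proof (rule order_trans[OF sum_abs sum_mono])
      fix n
      show "\<bar>f n * mangoldt n\<bar> \<le> mangoldt n"
        using mult_right_mono[OF f[of n] mangoldt_nonneg[of n]] by (simp add: abs_mult)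
    qed
    also have "\<dots> \<le> sqrt (real N) * log 2 (real N) * ln (real N)" by (rule sum_mangoldt_nonprime_le[OF N])
    finally show ?thesis .
  qed
  have "(\<lambda>N. (?\<psi> N - ?\<theta> N) / real N) \<longlonglongrightarrow> 0"
  proof (rule Lim_null_comparison)
    show "\<forall>\<^sub>F N in sequentially. norm ((?\<psi> N - ?\<theta> N) / real N) \<le> sqrt (real N) * log 2 (real N) * ln (real N) / real N"
      using eventually_ge_at_top[of 1]
    proof eventually_elim
      case (elim N)
      thus ?case using divide_right_mono[OF diff[OF elim], of "real N"] by (simp add: abs_divide)
    qed
    show "(\<lambda>N. sqrt (real N) * log 2 (real N) * ln (real N) / real N) \<longlonglongrightarrow> 0" by real_asymp
  qed
  from tendsto_diff[OF lim this] show ?thesis by (simp add: diff_divide_distrib)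
qed

text \<open>
  The primes above \<open>N powr (1 - e)\<close> satisfy \<open>1 - e \<le> ln p / ln N \<le> 1\<close>, so for them the weights \<open>ln p\<close>
  may be replaced by \<open>ln N\<close> up to a relative error \<open>e\<close>; the smaller primes are negligible because
  there are at least \<open>N / (2 ln N)\<close> primes in all.
\<close>
lemma prime_average_from_theta:
  fixes f :: "nat \<Rightarrow> real"
  assumes f: "\<And>n. \<bar>f n\<bar> \<le> 1"
    and lim: "(\<lambda>N. (\<Sum>p | prime p \<and> p \<le> N. f p * ln (real p)) / real N) \<longlonglongrightarrow> 0"
    and PNT: "(\<lambda>N. (\<Sum>p | prime p \<and> p \<le> N. ln (real p)) / real N) \<longlonglongrightarrow> 1"
  shows "(\<lambda>N. (\<Sum>p | prime p \<and> p \<le> N. f p) / real (card {p. prime p \<and> p \<le> N})) \<longlonglongrightarrow> 0"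
proof (rule LIMSEQ_I)
  let ?P = "\<lambda>N. {p::nat. prime p \<and> p \<le> N}"
  let ?\<theta> = "\<lambda>N. \<Sum>p\<in>?P N. f p * ln (real p)"
  have fin: "finite (?P N)" for N by (rule finite_subset[of _ "{..N}"]) auto
  fix \<epsilon> :: real assume \<epsilon>: "\<epsilon> > 0"
  define e where "e = min \<epsilon> 1 / 2"
  have e: "e > 0" "e < 1" "e \<le> \<epsilon> / 2" using \<epsilon> by (auto simp: e_def)
  have "(\<lambda>N. 2 * ln (real N) * real N powr (1 - e) / real N) \<longlonglongrightarrow> 0" using e by real_asymp
  hence "(\<lambda>N. 2 * ln (real N) * real N powr (1 - e) / real N + 2 * \<bar>?\<theta> N / real N\<bar>) \<longlonglongrightarrow> 0 + 2 * \<bar>0\<bar>"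
    by (intro tendsto_intros lim)
  hence "\<forall>\<^sub>F N in sequentially. 2 * ln (real N) * real N powr (1 - e) / real N + 2 * \<bar>?\<theta> N / real N\<bar> < \<epsilon> / 2"
    using \<epsilon> by (intro order_tendstoD) auto
  moreover have "\<forall>\<^sub>F N in sequentially. (\<Sum>p\<in>?P N. ln (real p)) / real N > 1 / 2"
    by (rule order_tendstoD(1)[OF PNT]) simp
  ultimately have "\<forall>\<^sub>F N in sequentially. norm ((\<Sum>p\<in>?P N. f p) / real (card (?P N)) - 0) < \<epsilon>"
    using eventually_ge_at_top[of 2]
  proof eventually_elim
    case (elim N)
    let ?L = "ln (real N)" and ?\<pi> = "real (card (?P N))"
    have N: "real N > 0" and L: "?L > 0" using elim(3) by auto
    have "(\<Sum>p\<in>?P N. ln (real p)) \<le> (\<Sum>p\<in>?P N. ?L)"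
      using prime_gt_0_nat by (intro sum_mono ln_mono) auto
    hence piL: "?\<pi> * ?L > real N / 2" using elim(2) N by (simp add: field_simps)
    hence pi0: "?\<pi> > 0" using L N by (smt (verit) divide_pos_pos mult_nonpos_nonneg)
    have weight: "\<bar>f p * (1 - ln (real p) / ?L)\<bar> \<le> e + (if real p \<le> real N powr (1 - e) then 1 else 0)" if p: "p \<in> ?P N" for p
    proof -
      have p0: "real p \<ge> 1" "real p \<le> real N" using p prime_gt_0_nat[of p] by auto
      have r: "0 \<le> ln (real p) / ?L" "ln (real p) / ?L \<le> 1" using p0 L by auto
      have "\<bar>f p * (1 - ln (real p) / ?L)\<bar> \<le> 1 * (1 - ln (real p) / ?L)"
        unfolding abs_mult using r f[of p] by (intro mult_mono) auto
      also have "\<dots> \<le> e + (if real p \<le> real N powr (1 - e) then 1 else 0)"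
      proof (cases "real p \<le> real N powr (1 - e)")
        case False
        hence "ln (real N powr (1 - e)) \<le> ln (real p)" using p0 N by (intro ln_mono) auto
        hence "(1 - e) * ?L \<le> ln (real p)" using N by (simp add: ln_powr)
        hence "1 - e \<le> ln (real p) / ?L" using L by (simp add: field_simps)
        thus ?thesis using False by simp
      qed (use r e in auto)
      finally show ?thesis .
    qed
    have "\<bar>(\<Sum>p\<in>?P N. f p) - ?\<theta> N / ?L\<bar> = \<bar>\<Sum>p\<in>?P N. f p * (1 - ln (real p) / ?L)\<bar>"
      by (simp add: sum_divide_distrib sum_subtractf[symmetric] algebra_simps)
    also have "\<dots> \<le> (\<Sum>p\<in>?P N. e + (if real p \<le> real N powr (1 - e) then 1 else 0))"
      by (rule order_trans[OF sum_abs sum_mono[OF weight]])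
    also have "\<dots> = ?\<pi> * e + real (card {p\<in>?P N. real p \<le> real N powr (1 - e)})"
      using fin by (simp add: sum.distrib sum.If_cases Int_def conj_commute conj_left_commute)
    also have "real (card {p\<in>?P N. real p \<le> real N powr (1 - e)}) \<le> real N powr (1 - e)"
    proof -
      have "{p\<in>?P N. real p \<le> real N powr (1 - e)} \<subseteq> {1..nat \<lfloor>real N powr (1 - e)\<rfloor>}"
        using prime_gt_0_nat by (auto simp: le_nat_floor Suc_le_eq)
      from card_mono[OF _ this] have "card {p\<in>?P N. real p \<le> real N powr (1 - e)} \<le> nat \<lfloor>real N powr (1 - e)\<rfloor>" by simp
      also have "real (nat \<lfloor>real N powr (1 - e)\<rfloor>) \<le> real N powr (1 - e)" by simp
      finally show ?thesis by (simp add: of_nat_le_iff)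
    qed
    finally have "\<bar>(\<Sum>p\<in>?P N. f p) - ?\<theta> N / ?L\<bar> \<le> ?\<pi> * e + real N powr (1 - e)" by simp
    moreover have "\<bar>?\<theta> N / ?L\<bar> = \<bar>?\<theta> N\<bar> / ?L" using L by simp
    ultimately have "\<bar>\<Sum>p\<in>?P N. f p\<bar> \<le> ?\<pi> * e + real N powr (1 - e) + \<bar>?\<theta> N\<bar> / ?L"
      by linarith
    hence "\<bar>\<Sum>p\<in>?P N. f p\<bar> / ?\<pi> \<le> (?\<pi> * e + real N powr (1 - e) + \<bar>?\<theta> N\<bar> / ?L) / ?\<pi>"
      using pi0 by (intro divide_right_mono) auto
    also have "\<dots> = e + (real N powr (1 - e) * ?L + \<bar>?\<theta> N\<bar>) / (?\<pi> * ?L)"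
    proof -
      have "(x * e + A + B / y) / x = e + (A * y + B) / (x * y)" if "x > 0" "y > 0" for x y A B :: real
        using that by (simp add: field_simps)
      thus ?thesis using pi0 L by blast
    qed
    also have "\<dots> \<le> e + (real N powr (1 - e) * ?L + \<bar>?\<theta> N\<bar>) / (real N / 2)"
    proof -
      have "c / q \<le> c / (n / 2)" if "q > n / 2" "n > 0" "c \<ge> 0" for c q n :: real
        using that by (intro divide_left_mono) auto
      moreover have "real N powr (1 - e) * ?L + \<bar>?\<theta> N\<bar> \<ge> 0" using L by (intro add_nonneg_nonneg mult_nonneg_nonneg) auto
      ultimately show ?thesis using piL N by (intro add_left_mono) blast
    qed
    also have "\<dots> = e + (2 * ?L * real N powr (1 - e) / real N + 2 * \<bar>?\<theta> N / real N\<bar>)"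
    proof -
      have "(A * y + \<bar>t\<bar>) / (n / 2) = 2 * y * A / n + 2 * \<bar>t / n\<bar>" if "n > 0" for A y t n :: real
        using that by (simp add: field_simps)
      thus ?thesis using N by (intro arg_cong[where f = "\<lambda>x. e + x"]) blast
    qed
    also have "\<dots> < \<epsilon>" using elim(1) e by linarith
    finally show ?case by (simp add: abs_divide)
  qed
  thus "\<exists>no. \<forall>n\<ge>no. norm ((\<Sum>p\<in>?P n. f p) / real (card (?P n)) - 0) < \<epsilon>"
    by (simp add: eventually_sequentially)
qed

text \<open>
  Up to a bounded number of exceptions every prime contributes at least \<open>(1 - f(p)) / 2\<close> to the count of
  \<open>S\<close>, and the average of \<open>f(p)\<close> tends to \<open>0\<close>.
\<close>
lemma prime_lower_density_ge_half:
  fixes f :: "nat \<Rightarrow> real" and S :: "nat set"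
  assumes f: "\<And>n. f n \<in> {-1, 0, 1}"
    and lim: "(\<lambda>N. (\<Sum>p | prime p \<and> p \<le> N. f p) / real (card {p. prime p \<and> p \<le> N})) \<longlonglongrightarrow> 0"
    and S: "\<And>p. prime p \<Longrightarrow> p \<ge> B \<Longrightarrow> f p \<noteq> 1 \<Longrightarrow> p \<in> S"
  shows "prime_lower_density S \<ge> 1 / 2"
proof -
  let ?P = "\<lambda>N. {p::nat. prime p \<and> p \<le> N}"
  let ?\<pi> = "\<lambda>N. real (card (?P N))" and ?\<sigma> = "\<lambda>N. \<Sum>p\<in>?P N. f p"
  have fin: "finite (?P N)" for N by (rule finite_subset[of _ "{..N}"]) auto
  have bound: "(1 - ?\<sigma> N / ?\<pi> N) / 2 - real B / ?\<pi> N \<le> real (card {p\<in>S. prime p \<and> p \<le> N}) / ?\<pi> N" if N: "N \<ge> 2" for N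
  proof -
    have "2 \<in> ?P N" using N by simp
    hence pi0: "?\<pi> N > 0" using fin card_gt_0_iff by fastforce
    have "(\<Sum>p\<in>?P N. (1 - f p) / 2) \<le> (\<Sum>p\<in>?P N. (if p < B then 1 else 0) + (if p \<in> S then 1 else 0))"
    proof (rule sum_mono)
      fix p assume "p \<in> ?P N"
      thus "(1 - f p) / 2 \<le> (if p < B then 1 else 0) + (if p \<in> S then 1 else 0)"
        using S[of p] f[of p] by auto
    qed
    also have "\<dots> = real (card {p\<in>?P N. p < B}) + real (card {p\<in>?P N. p \<in> S})"
      using fin by (simp add: sum.distrib sum.If_cases Int_def)
    also have "card {p\<in>?P N. p < B} \<le> card {..<B}" by (intro card_mono) auto
    also have "{p\<in>?P N. p \<in> S} = {p\<in>S. prime p \<and> p \<le> N}" by auto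
    finally have "(?\<pi> N - ?\<sigma> N) / 2 \<le> real B + real (card {p\<in>S. prime p \<and> p \<le> N})"
      by (simp add: sum_divide_distrib[symmetric] sum_subtractf)
    hence "(?\<pi> N - ?\<sigma> N) / 2 / ?\<pi> N \<le> (real B + real (card {p\<in>S. prime p \<and> p \<le> N})) / ?\<pi> N"
      using pi0 by (intro divide_right_mono) auto
    moreover have "(x - s) / 2 / x = (1 - s / x) / 2" if "x > 0" for x s :: real
      using that by (simp add: diff_divide_distrib)
    note this[OF pi0, of "?\<sigma> N"]
    ultimately show ?thesis unfolding add_divide_distrib by linarith
  qed
  have "filterlim ?\<pi> at_top sequentially"
  proof (rule filterlim_at_top_mono[OF _ always_eventually])
    show "filterlim (\<lambda>N. real (card (?P N))) at_top sequentially"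
      unfolding filterlim_at_top
    proof
      fix Z :: real
      obtain T where T: "T \<subseteq> {p::nat. prime p}" "finite T" "card T = nat \<lceil>Z\<rceil>"
        using infinite_arbitrarily_large[OF primes_infinite] by metis
      obtain m where m: "\<And>p. p \<in> T \<Longrightarrow> p \<le> m" using T(2) by (meson finite_nat_set_iff_bounded_le)
      have "Z \<le> ?\<pi> N" if "N \<ge> m" for N
      proof -
        have "T \<subseteq> ?P N" using T m that by (auto intro: order_trans)
        hence "card T \<le> card (?P N)" using fin by (intro card_mono)
        thus ?thesis using T(3) by linarith
      qed
      thus "\<forall>\<^sub>F N in sequentially. Z \<le> ?\<pi> N" by (auto simp: eventually_at_top_linorder)
    qed
  qed auto
  hence "(\<lambda>N. real B / ?\<pi> N) \<longlonglongrightarrow> 0" by (intro real_tendsto_divide_at_top[OF tendsto_const])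
  hence "(\<lambda>N. (1 - ?\<sigma> N / ?\<pi> N) / 2 - real B / ?\<pi> N) \<longlonglongrightarrow> (1 - 0) / 2 - 0"
    by (intro tendsto_intros lim) auto
  hence "(\<lambda>N. ereal ((1 - ?\<sigma> N / ?\<pi> N) / 2 - real B / ?\<pi> N)) \<longlonglongrightarrow> ereal (1 / 2)" by (intro tendsto_ereal) simp
  hence "liminf (\<lambda>N. ereal ((1 - ?\<sigma> N / ?\<pi> N) / 2 - real B / ?\<pi> N)) = ereal (1 / 2)"
    by (intro lim_imp_Liminf) auto
  moreover have "liminf (\<lambda>N. ereal ((1 - ?\<sigma> N / ?\<pi> N) / 2 - real B / ?\<pi> N)) \<le> prime_lower_density S"
    unfolding prime_lower_density_def
    by (rule Liminf_mono, rule eventually_mono[OF eventually_ge_at_top[of 2]]) (simp only: ereal_less_eq bound)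
  moreover have "ereal (1 / 2) = 1 / 2" by (simp add: one_ereal_def numeral_eq_ereal divide_ereal_def)
  ultimately show ?thesis by simp
qed

section \<open>The density of the primes with a linear congruence\<close>

theorem corollary1p2:
  fixes M :: nat and chi :: "int \<Rightarrow> int" and a b :: int
  assumes "good_function M chi"
    and "b \<noteq> 0"
    and "P_in_int_power_series a b chi"
    and "\<not> [a\<^sup>2 - b = 3] (mod 4)"
    and "\<not> (\<exists>k. a\<^sup>2 - b = k\<^sup>2)"
  shows "prime_lower_density {p. prime p \<and> linear_congruence (H a b chi) p} \<ge> 1 / 2"
proof -
  define D where "D = a\<^sup>2 - b"
  have nonsquare: "\<not> (\<exists>k. D = k\<^sup>2)" using assms(5) by (simp add: D_def)
  hence D0: "D \<noteq> 0" by (metis zero_power2)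
  have M: "M > 0" and per: "\<And>x. chi (x + int M) = chi x" and sum0: "(\<Sum>j<M. chi (int j)) = 0"
    using assms(1) by (auto simp: good_function_def)
  obtain f :: "nat \<Rightarrow> real" and C where f: "unit_char f" "\<And>n. \<bar>\<Sum>k=1..n. f k\<bar> \<le> C"
    "\<And>p. prime p \<Longrightarrow> p > 2 \<Longrightarrow> \<not> int p dvd D \<Longrightarrow> f p = of_int (Legendre D (int p))"
    using quadratic_character_exists[OF nonsquare] by metis
  have cong: "linear_congruence (H a b chi) p"
    if p: "prime p" and large: "p \<ge> 3 + M + nat \<bar>b\<bar> + nat \<bar>D\<bar>" and fp: "f p \<noteq> 1" for p
  proof (cases "b > 0")
    case True
    have pM: "\<not> p dvd M" using large M by (auto dest: dvd_imp_le)
    have small: "\<not> int p dvd z" if "z \<noteq> 0" "nat \<bar>z\<bar> < p" for z :: int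
      using that zdvd_imp_le[of "int p" "\<bar>z\<bar>"] by auto
    have pb: "\<not> int p dvd b" by (rule small) (use large assms(2) in auto)
    have pD: "\<not> int p dvd D" by (rule small) (use large D0 in auto)
    have "f p = of_int (Legendre D (int p))" using f(3)[OF p _ pD] large by simp
    hence "\<not> QuadRes (int p) D" using fp pD by (auto simp: Legendre_def cong_0_iff split: if_splits)
    hence "\<not> [x\<^sup>2 = a\<^sup>2 - b] (mod int p)" for x by (auto simp: QuadRes_def D_def)
    thus ?thesis by (rule linear_congruence_nonresidue[OF True M per sum0 p pM pb])
  next
    case False
    hence "b < 0" using assms(2) by simp
    hence "H a b chi = (\<lambda>_. 0)" using H_eq_0_if_b_neg[OF assms(3) _ M per] by blast
    moreover have "cong_zero_mod p 0" by (rule cong_zero_mod_0[OF p])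
    ultimately show ?thesis unfolding linear_congruence_def using prime_gt_1_nat[OF p] by (intro exI[of _ 1]) auto
  qed
  have f_abs: "\<bar>f n\<bar> \<le> 1" for n by (rule unit_charD(4)[OF f(1)])
  have theta_f: "(\<lambda>N. (\<Sum>p | prime p \<and> p \<le> N. f p * ln (real p)) / real N) \<longlonglongrightarrow> 0"
    by (rule theta_tendsto[OF f_abs PNT_character[OF f(1,2)]])
  have "(\<lambda>n. (\<Sum>k=1..n. 1 * mangoldt k) / real n) \<longlonglongrightarrow> (1 :: real)"
  proof (rule Lim_transform_eventually)
    show "(\<lambda>n. (\<Sum>k=1..n. mangoldt k - 1) / real n + 1) \<longlonglongrightarrow> (1 :: real)"
      using tendsto_add[OF PNT_mangoldt tendsto_const[of 1]] by simp
    show "\<forall>\<^sub>F n in sequentially. (\<Sum>k=1..n. mangoldt k - 1) / real n + 1 = (\<Sum>k=1..n. 1 * mangoldt k) / real n"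
      using eventually_gt_at_top[of 0] by eventually_elim (simp add: sum_subtractf diff_divide_distrib)
  qed
  hence theta: "(\<lambda>N. (\<Sum>p | prime p \<and> p \<le> N. ln (real p)) / real N) \<longlonglongrightarrow> 1"
    using theta_tendsto[of "\<lambda>_. 1" 1] by simp
  show ?thesis
    by (rule prime_lower_density_ge_half[OF unit_charD(3)[OF f(1)] prime_average_from_theta[OF f_abs theta_f theta],
          where B = "3 + M + nat \<bar>b\<bar> + nat \<bar>D\<bar>"]) (use cong in auto)
qed

end
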